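(* Let $\{\psi_j\}_{j=1}^N$ be a basis of $X_h$, $\{\phi_i^c\}_{i=1}^{n_c}$ a basis of $V_h^c$, and $\{\phi_i^{\mathrm{CR}}\}_{i=1}^{n_{\mathrm{CR}}}$ a basis of $V_{h,0}^{\mathrm{CR}}$. Define matrices by $$(M_0)_{ij}:=(\psi_j,\psi_i),\quad (A_c)_{ik}:=(\nabla\phi_k^c,\nabla\phi_i^c),\quad (B_c)_{ij}:=(\psi_j,\phi_i^c),$$ $$(A_{\mathrm{CR}})_{ik}:=(\nabla_h\phi_k^{\mathrm{CR}},\nabla_h\phi_i^{\mathrm{CR}}),\quad (B_{\mathrm{CR}})_{ij}:=(\psi_j,\phi_i^{\mathrm{CR}}),$$ $$G_{\rm gap}:=B_{\mathrm{CR}}^\top A_{\mathrm{CR}}^{-1}B_{\mathrm{CR}}-B_c^\top A_c^{-1}B_c,\qquad (D_M)_{ij}:=\frac1{d^2}\sum_{T\in\mathbb T_h}\mu_T(\psi_j|_T)(\psi_i|_T),$$ $$(G_M)_{ij}:=\bigl(\bm\sigma_h^M(\psi_j)-\nabla z_h^c(\psi_j),\ \bm\sigma_h^M(\psi_i)-\nabla z_h^c(\psi_i)\bigr),$$ where $\mu_T:=\int_T|\bm x-\bm x_T|^2\,dx$. Then $$G_M=G_{\rm gap}+D_M\qquad\text{and}\qquad \kappa_{M,h}^2=\max_{0\ne\mathbf g\in\mathbb R^N}\frac{\mathbf g^\top(G_{\rm gap}+D_M)\mathbf g}{\mathbf g^\top M_0\mathbf g}=\lambda_{\max}(G_{\rm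 gap}+D_M,M_0),$$ where $\lambda_{\max}(A,M)$ denotes the largest generalised eigenvalue of $A\mathbf v=\lambda M\mathbf v$.
   Context: Let $d\in\{2,3\}$, let $\Omega\subset\mathbb R^d$ be a bounded polyhedral Lipschitz domain, and let $\mathbb T_h$ be a finite conforming triangulation of $\overline\Omega$ into non-degenerate closed $d$-simplices (the intersection of two distinct elements is empty or a common subsimplex); no shape regularity is assumed. $(\cdot,\cdot)$ is the $L^2(\Omega)$ inner product (scalar or vector valued). $\nabla_h$ is the elementwise (broken) gradient. $X_h$ is the space of functions constant on each $T\in\mathbb T_h$. $V_h^c:=\{v\in H_0^1(\Omega): v|_T \text{ affine } \forall T\in\mathbb T_h\}$. The Crouzeix--Raviart space $V_{h,0}^{\mathrm{CR}}$ consists of the elementwise affine functions $v$ such that $\int_F[\![v]\!]\,ds=0$ for all faces $F$, where $[\![v]\!]$ is the jump across an interior face and the trace of $v$ on a boundary face. For $g_h\in X_h$: $z_h^c(g_h)\in V_h^c$ is the unique solution of $(\nabla z_h^c(g_h),\nabla v_h)=(g_h,v_h)$ for all $v_h\in V_h^c$; $z_h^{\mathrm{CR}}(g_h)\in V_{h,0}^{\mathrm{CR}}$ is the unique solution of $(\nabla_h z_h^{\mathrm{CR}}(g_h),\nabla_h v_h)=(g_h,v_h)$ for all $v_h\in V_{h,0}^{\mathrm{CR}}$; the Marini flux is $\bm\sigma_h^M(g_h)|_T:=\nabla_h z_h^{\mathrm{CR}}(g_h)|_T-\frac{g_h|_T}{d}(\bm x-\bm x_T)$, with $\bm x_T$ the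 barycentre of $T$; and $$\kappa_{M,h}:=\sup_{0\ne g_h\in X_h}\frac{\|\bm\sigma_h^M(g_h)-\nabla z_h^c(g_h)\|_{L^2(\Omega)^d}}{\|g_h\|_{L^2(\Omega)}}.$$ *)

theory Defs
  imports "HOL-Analysis.Analysis" "Jordan_Normal_Form.Gauss_Jordan_Elimination"
begin

text \<open>
  Both libraries define \<open>vec\<close>, \<open>mat\<close> and the infix dot: \<open>real ^ 'd\<close> and \<open>inner\<close> below belong to
  HOL-Analysis (points of space), \<open>Matrix.vec\<close>, \<open>Matrix.mat\<close> and \<open>scalar_prod\<close> to
  Jordan_Normal_Form (coefficient vectors and matrices; their dimensions are terms and may be \<open>0\<close>,
  as happens for the finite element spaces on very coarse meshes).
\<close>


section \<open>Domains and meshes\<close>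

text \<open>Locally, in a rotated coordinate system with vertical axis \<open>e\<close>, \<open>\<Omega>\<close> is the strict subgraph of
  a Lipschitz function \<open>\<gamma>\<close> of the remaining coordinates \<open>x - (x \<bullet> e) e\<close>.\<close>

definition lipschitz_boundary :: "'a::euclidean_space set \<Rightarrow> bool" where
  "lipschitz_boundary \<Omega> \<longleftrightarrow>
     (\<forall>p \<in> frontier \<Omega>. \<exists>e r L \<gamma>. norm e = 1 \<and> r > 0 \<and> lipschitz_on L {y. inner y e = 0} \<gamma> \<and>
        (\<forall>x \<in> ball p r. x \<in> \<Omega> \<longleftrightarrow> inner x e < \<gamma> (x - inner x e *\<^sub>R e)))"

text \<open>The library's \<open>polyhedron\<close> and \<open>polytope\<close> are convex; a polyhedral domain need not be.\<close>

definition polyhedral_lipschitz_domain :: "'a::euclidean_space set \<Rightarrow> bool" where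
  "polyhedral_lipschitz_domain \<Omega> \<longleftrightarrow>
     open \<Omega> \<and> connected \<Omega> \<and> \<Omega> \<noteq> {} \<and> lipschitz_boundary \<Omega> \<and>
     (\<exists>P. finite P \<and> (\<forall>K\<in>P. polytope K) \<and> closure \<Omega> = \<Union>P)"

definition conforming_mesh :: "'a::euclidean_space set set \<Rightarrow> 'a set \<Rightarrow> bool" where
  "conforming_mesh \<T> \<Omega> \<longleftrightarrow>
     triangulation \<T> \<and> (\<forall>T\<in>\<T>. int DIM('a) simplex T) \<and> \<Union>\<T> = closure \<Omega>"

definition barycentre :: "'a::euclidean_space set \<Rightarrow> 'a" where
  "barycentre T = (\<Sum>v | v extreme_point_of T. v) /\<^sub>R (real DIM('a) + 1)"


section \<open>Lebesgue and Sobolev spaces\<close>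

definition L2_space :: "'a::euclidean_space set \<Rightarrow> ('a \<Rightarrow> 'b::euclidean_space) set" where
  "L2_space \<Omega> = {f. f \<in> borel_measurable (lebesgue_on \<Omega>) \<and>
                     integrable (lebesgue_on \<Omega>) (\<lambda>x. (norm (f x))\<^sup>2)}"

definition L2_inner :: "'a::euclidean_space set \<Rightarrow> ('a \<Rightarrow> 'b::euclidean_space) \<Rightarrow> ('a \<Rightarrow> 'b) \<Rightarrow> real" where
  "L2_inner \<Omega> f g = integral\<^sup>L (lebesgue_on \<Omega>) (\<lambda>x. inner (f x) (g x))"

definition L2_norm :: "'a::euclidean_space set \<Rightarrow> ('a \<Rightarrow> 'b::euclidean_space) \<Rightarrow> real" where
  "L2_norm \<Omega> f = sqrt (L2_inner \<Omega> f f)"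

definition grad :: "('a::euclidean_space \<Rightarrow> real) \<Rightarrow> 'a \<Rightarrow> 'a" where
  "grad f x = (THE D. GDERIV f x :> D)"

primrec Ck_function :: "nat \<Rightarrow> ('a::euclidean_space \<Rightarrow> real) \<Rightarrow> bool" where
  "Ck_function 0 f \<longleftrightarrow> continuous_on UNIV f"
| "Ck_function (Suc k) f \<longleftrightarrow>
     (\<forall>x. f differentiable (at x)) \<and> (\<forall>b\<in>Basis. Ck_function k (\<lambda>x. inner (grad f x) b))"

definition test_functions :: "'a::euclidean_space set \<Rightarrow> ('a \<Rightarrow> real) set" where
  "test_functions \<Omega> =
     {\<phi>. (\<forall>k. Ck_function k \<phi>) \<and> compact (closure {x. \<phi> x \<noteq> 0}) \<and> closure {x. \<phi> x \<noteq> 0} \<subseteq> \<Omega>}"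

definition has_weak_gradient ::
    "'a::euclidean_space set \<Rightarrow> ('a \<Rightarrow> real) \<Rightarrow> ('a \<Rightarrow> 'a) \<Rightarrow> bool" where
  "has_weak_gradient \<Omega> v G \<longleftrightarrow>
     (\<forall>\<phi> \<in> test_functions \<Omega>.
        integral\<^sup>L (lebesgue_on \<Omega>) (\<lambda>x. v x *\<^sub>R grad \<phi> x) =
        - integral\<^sup>L (lebesgue_on \<Omega>) (\<lambda>x. \<phi> x *\<^sub>R G x))"

text \<open>\<open>v\<close> is in \<open>H\<^sup>1(\<Omega>)\<close> with weak gradient \<open>G\<close>, and is a limit of test functions in the
  \<open>H\<^sup>1\<close>-norm. Weak gradients are unique almost everywhere, so the choice in \<open>H10_grad\<close> does not
  matter under an integral.\<close>

definition has_H10_gradient ::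
    "'a::euclidean_space set \<Rightarrow> ('a \<Rightarrow> real) \<Rightarrow> ('a \<Rightarrow> 'a) \<Rightarrow> bool" where
  "has_H10_gradient \<Omega> v G \<longleftrightarrow>
     v \<in> L2_space \<Omega> \<and> G \<in> L2_space \<Omega> \<and> has_weak_gradient \<Omega> v G \<and>
     (\<exists>\<phi>. (\<forall>n. \<phi> n \<in> test_functions \<Omega>) \<and>
          (\<lambda>n. L2_norm \<Omega> (\<lambda>x. \<phi> n x - v x)) \<longlonglongrightarrow> 0 \<and>
          (\<lambda>n. L2_norm \<Omega> (\<lambda>x. grad (\<phi> n) x - G x)) \<longlonglongrightarrow> 0)"

definition H10_space :: "'a::euclidean_space set \<Rightarrow> ('a \<Rightarrow> real) set" where
  "H10_space \<Omega> = {v. \<exists>G. has_H10_gradient \<Omega> v G}"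

definition H10_grad :: "'a::euclidean_space set \<Rightarrow> ('a \<Rightarrow> real) \<Rightarrow> 'a \<Rightarrow> 'a" where
  "H10_grad \<Omega> v = (SOME G. has_H10_gradient \<Omega> v G)"


section \<open>Traces and integrals over faces\<close>

definition unit_normal :: "'a::euclidean_space set \<Rightarrow> 'a" where
  "unit_normal F = (SOME n. norm n = 1 \<and> (\<exists>b. \<forall>x\<in>F. inner n x = b))"

text \<open>Surface integral over a subset \<open>F\<close> of a hyperplane \<open>{x. n \<bullet> x = b}\<close>: by Fubini it is the
  volume integral, over the right prism of height \<open>1\<close> erected on \<open>F\<close>, of the integrand extended
  constantly in the normal direction.\<close>

definition face_integral :: "'a::euclidean_space set \<Rightarrow> ('a \<Rightarrow> real) \<Rightarrow> real" where
  "face_integral F f =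
     (let n = unit_normal F;
          b = (THE b. \<forall>x\<in>F. inner n x = b);
          foot = (\<lambda>x. x - (inner n x - b) *\<^sub>R n)
      in integral\<^sup>L (lebesgue_on {x. foot x \<in> F \<and> inner n x - b \<in> {0..1}}) (\<lambda>x. f (foot x)))"

definition trace_from :: "'a::euclidean_space set \<Rightarrow> ('a \<Rightarrow> real) \<Rightarrow> 'a \<Rightarrow> real" where
  "trace_from T v x = Lim (at x within interior T) v"


section \<open>Finite element spaces\<close>

text \<open>Elements of the discrete spaces are classes modulo null sets. Each class is represented by
  its member that vanishes off the union of the open elements (the mesh skeleton is a null set), so
  that equality of functions is equality in \<open>L\<^sup>2(\<Omega>)\<close>.\<close>

definition X_space :: "'a::euclidean_space set set \<Rightarrow> ('a \<Rightarrow> real) set" where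
  "X_space \<T> = {g. (\<forall>T\<in>\<T>. \<exists>c. \<forall>x\<in>interior T. g x = c) \<and>
                     (\<forall>x. x \<notin> (\<Union>T\<in>\<T>. interior T) \<longrightarrow> g x = 0)}"

definition pw_affine_space :: "'a::euclidean_space set set \<Rightarrow> ('a \<Rightarrow> real) set" where
  "pw_affine_space \<T> = {v. (\<forall>T\<in>\<T>. \<exists>a c. \<forall>x\<in>interior T. v x = inner a x + c) \<and>
                             (\<forall>x. x \<notin> (\<Union>T\<in>\<T>. interior T) \<longrightarrow> v x = 0)}"

definition Vc_space :: "'a::euclidean_space set set \<Rightarrow> 'a set \<Rightarrow> ('a \<Rightarrow> real) set" where
  "Vc_space \<T> \<Omega> = pw_affine_space \<T> \<inter> H10_space \<Omega>"

definition CR_space :: "'a::euclidean_space set set \<Rightarrow> 'a set \<Rightarrow> ('a \<Rightarrow> real) set" where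
  "CR_space \<T> \<Omega> =
     {v \<in> pw_affine_space \<T>.
        (\<forall>T\<in>\<T>. \<forall>T'\<in>\<T>. \<forall>F. T \<noteq> T' \<and> F facet_of T \<and> F facet_of T' \<longrightarrow>
           face_integral F (\<lambda>x. trace_from T v x - trace_from T' v x) = 0) \<and>
        (\<forall>T\<in>\<T>. \<forall>F. F facet_of T \<and> F \<subseteq> frontier \<Omega> \<longrightarrow> face_integral F (trace_from T v) = 0)}"

definition broken_grad :: "'a::euclidean_space set set \<Rightarrow> ('a \<Rightarrow> real) \<Rightarrow> 'a \<Rightarrow> 'a" where
  "broken_grad \<T> v x = (if x \<in> (\<Union>T\<in>\<T>. interior T) then grad v x else 0)"

definition is_basis :: "nat \<Rightarrow> (nat \<Rightarrow> 'a \<Rightarrow> real) \<Rightarrow> ('a \<Rightarrow> real) set \<Rightarrow> bool" where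
  "is_basis n \<phi> V \<longleftrightarrow>
     (\<forall>i<n. \<phi> i \<in> V) \<and>
     (\<forall>c. (\<lambda>x. \<Sum>i<n. c i * \<phi> i x) = (\<lambda>_. 0) \<longrightarrow> (\<forall>i<n. c i = 0)) \<and>
     (\<forall>v\<in>V. \<exists>c. v = (\<lambda>x. \<Sum>i<n. c i * \<phi> i x))"


section \<open>Discrete solutions, Marini flux and its constant\<close>

definition z_c :: "'a::euclidean_space set set \<Rightarrow> 'a set \<Rightarrow> ('a \<Rightarrow> real) \<Rightarrow> 'a \<Rightarrow> real" where
  "z_c \<T> \<Omega> g = (THE z. z \<in> Vc_space \<T> \<Omega> \<and>
     (\<forall>v \<in> Vc_space \<T> \<Omega>. L2_inner \<Omega> (H10_grad \<Omega> z) (H10_grad \<Omega> v) = L2_inner \<Omega> g v))"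

definition z_CR :: "'a::euclidean_space set set \<Rightarrow> 'a set \<Rightarrow> ('a \<Rightarrow> real) \<Rightarrow> 'a \<Rightarrow> real" where
  "z_CR \<T> \<Omega> g = (THE z. z \<in> CR_space \<T> \<Omega> \<and>
     (\<forall>v \<in> CR_space \<T> \<Omega>. L2_inner \<Omega> (broken_grad \<T> z) (broken_grad \<T> v) = L2_inner \<Omega> g v))"

definition marini_flux :: "'a::euclidean_space set set \<Rightarrow> 'a set \<Rightarrow> ('a \<Rightarrow> real) \<Rightarrow> 'a \<Rightarrow> 'a" where
  "marini_flux \<T> \<Omega> g x =
     (\<Sum>T\<in>\<T>. indicator (interior T) x *\<^sub>R
        (broken_grad \<T> (z_CR \<T> \<Omega> g) x - (g x / real DIM('a)) *\<^sub>R (x - barycentre T)))"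

definition marini_gap :: "'a::euclidean_space set set \<Rightarrow> 'a set \<Rightarrow> ('a \<Rightarrow> real) \<Rightarrow> 'a \<Rightarrow> 'a" where
  "marini_gap \<T> \<Omega> g x = marini_flux \<T> \<Omega> g x - H10_grad \<Omega> (z_c \<T> \<Omega> g) x"

definition kappa_M :: "'a::euclidean_space set set \<Rightarrow> 'a set \<Rightarrow> real" where
  "kappa_M \<T> \<Omega> = (SUP g \<in> X_space \<T> - {\<lambda>_. 0}. L2_norm \<Omega> (marini_gap \<T> \<Omega> g) / L2_norm \<Omega> g)"

definition elem_value :: "('a::euclidean_space \<Rightarrow> real) \<Rightarrow> 'a set \<Rightarrow> real" where
  "elem_value g T = (THE c. \<forall>x\<in>interior T. g x = c)"

definition second_moment :: "'a::euclidean_space set \<Rightarrow> real" where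
  "second_moment T = integral\<^sup>L (lebesgue_on T) (\<lambda>x. (norm (x - barycentre T))\<^sup>2)"


section \<open>Generalised eigenvalues\<close>

definition gen_eigenvalue :: "real Matrix.mat \<Rightarrow> real Matrix.mat \<Rightarrow> real \<Rightarrow> bool" where
  "gen_eigenvalue A M l \<longleftrightarrow>
     (\<exists>v \<in> carrier_vec (dim_col A). v \<noteq> 0\<^sub>v (dim_col A) \<and> A *\<^sub>v v = l \<cdot>\<^sub>v (M *\<^sub>v v))"

definition rayleigh_quotient :: "real Matrix.mat \<Rightarrow> real Matrix.mat \<Rightarrow> real Matrix.vec \<Rightarrow> real" where
  "rayleigh_quotient A M g = scalar_prod g (A *\<^sub>v g) / scalar_prod g (M *\<^sub>v g)"

text \<open>Attained maximum of a possibly infinite set, which \<open>Max\<close> does not cover.\<close>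

definition is_maximum :: "real set \<Rightarrow> real \<Rightarrow> bool" where
  "is_maximum S m \<longleftrightarrow> m \<in> S \<and> (\<forall>s\<in>S. s \<le> m)"

end

(* The gap is piecewise constant up to the term g_h (x - x_T) / d, and x - x_T has mean zero on T, so the
   mixed terms with that part vanish and its square contributes D_M. What remains is
   |grad_h z_CR - grad z_c|^2. Its polarisation reduces to B_CR^T A_CR^-1 B_CR - B_c^T A_c^-1 B_c because
   V_c is a subspace of the Crouzeix-Raviart space, so that z_c is an admissible test function in both
   discrete problems. The identity for kappa is then the Rayleigh principle for a symmetric pencil.

   V_c lies in the Crouzeix-Raviart space since a piecewise affine limit v in H^1 of test functions,
   extended by zero, satisfies |v(y) - v(x)| <= K |y - x| at its points of continuity, also outside the
   domain; hence the traces from both sides of a face coincide, and they vanish on the boundary.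
   The Crouzeix-Raviart stiffness matrix is regular since a piecewise constant function of that space
   does not change along a segment that avoids all faces of codimension two and leaves the domain. *)

theory Submission
  imports Defs "Jordan_Normal_Form.Determinant"
begin


section \<open>Gradients and test functions\<close>

text \<open>The analytic obstacle: membership in \<open>H10_space\<close> supplies only an
  L2-convergent sequence of test functions and a gradient \<open>G\<close> fixed up to null sets,
  whereas the Crouzeix-Raviart conditions concern traces, which live on null sets. Both the
  identification of \<open>G\<close> with the elementwise slopes and the Lipschitz bound are drawn
  from the approximating sequence. A test function is averaged over a set of finite measure and over
  its translates, the mean value theorem is applied to the average as a function of the translation,
  and averages survive the passage to the L2 limit. Since test functions vanish outside the domain,
  the translates may leave it. That x - x_T has mean zero comes from symmetry: exchanging two
  vertices of a simplex preserves Lebesgue measure, so no coordinate computation occurs. After these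
  steps both discrete problems are expressed by one form, \<open>energy\<close>, the volume-weighted
  sum of products of slopes. They are then two instances of a single abstract Galerkin system, whose
  stiffness matrix is regular because the form is definite.\<close>

lemma gderiv_grad:
  fixes f :: "'a::euclidean_space \<Rightarrow> real"
  assumes "f differentiable (at x)"
  shows "(f has_derivative (\<lambda>h. inner h (grad f x))) (at x)"
proof -
  obtain f' where f': "(f has_derivative f') (at x)"
    using assms unfolding differentiable_def by blast
  \<comment> \<open>Riesz representative of the functional \<open>f'\<close> in the orthonormal
    basis.\<close>
  define D where "D = (\<Sum>b\<in>Basis. f' b *\<^sub>R b)"
  have lin: "linear f'" using f' has_derivative_linear by blast
  have "f' h = inner h D" for h
  proof -
    have "f' h = f' (\<Sum>b\<in>Basis. inner h b *\<^sub>R b)" by (simp add: euclidean_representation)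
    also have "\<dots> = (\<Sum>b\<in>Basis. inner h b *\<^sub>R f' b)"
      by (simp add: linear_sum[OF lin] linear_cmul[OF lin])
    also have "\<dots> = inner h D" by (simp add: D_def inner_sum_right mult.commute)
    finally show ?thesis .
  qed
  then have "f' = (\<lambda>h. inner h D)" by auto
  with f' have D: "GDERIV f x :> D" by (simp add: gderiv_def)
  have "GDERIV f x :> grad f x"
    unfolding grad_def
  proof (rule theI[of _ D])
    show "GDERIV f x :> D" by (rule D)
    fix E assume "GDERIV f x :> E"
    then have "(\<lambda>h. inner h E) = (\<lambda>h. inner h D)"
      using D unfolding gderiv_def by (rule has_derivative_unique)
    then have "inner h (E - D) = 0" for h
      by (simp add: fun_eq_iff inner_diff_right)
    then show "E = D" using inner_eq_zero_iff[of "E - D"] by auto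
  qed
  then show ?thesis by (simp add: gderiv_def)
qed

lemma grad_eqI:
  fixes f :: "'a::euclidean_space \<Rightarrow> real"
  assumes "(f has_derivative (\<lambda>h. inner h D)) (at x)"
  shows "grad f x = D"
proof -
  have "f differentiable (at x)" using assms unfolding differentiable_def by blast
  from gderiv_grad[OF this] have "(\<lambda>h. inner h (grad f x)) = (\<lambda>h. inner h D)"
    using assms by (rule has_derivative_unique)
  then have "inner h (grad f x - D) = 0" for h
    by (simp add: fun_eq_iff inner_diff_right)
  then show ?thesis using inner_eq_zero_iff[of "grad f x - D"] by auto
qed

context
  fixes \<Omega> :: "'a::euclidean_space set" and \<phi> :: "'a \<Rightarrow> real"
  assumes \<phi>: "\<phi> \<in> test_functions \<Omega>"
begin

lemma test_deriv: "(\<phi> has_derivative (\<lambda>h. inner h (grad \<phi> x))) (at x)"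
proof -
  have "Ck_function (Suc 0) \<phi>" using \<phi> by (simp only: test_functions_def mem_Collect_eq)
  then show ?thesis by (intro gderiv_grad) simp
qed

lemma test_continuous: "continuous_on UNIV \<phi>"
proof (rule continuous_at_imp_continuous_on, rule ballI)
  fix x show "isCont \<phi> x" using test_deriv by (rule has_derivative_continuous)
qed

lemma test_grad_continuous: "continuous_on UNIV (grad \<phi>)"
proof -
  have "Ck_function (Suc 0) \<phi>" using \<phi> by (simp only: test_functions_def mem_Collect_eq)
  then have "\<forall>b\<in>Basis. continuous_on UNIV (\<lambda>x. inner (grad \<phi> x) b)" by simp
  then show ?thesis using continuous_on_componentwise by blast
qed

text \<open>The support is closed, so a point off it has a neighbourhood on which
  \<open>\<phi>\<close> is zero; the gradient therefore vanishes off the same compact set. This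
  controls \<open>\<phi>\<close> on the whole space, as translations require.\<close>

lemma test_support:
  "\<exists>K. compact K \<and> K \<subseteq> \<Omega> \<and> (\<forall>x. x \<notin> K \<longrightarrow> \<phi> x = 0) \<and> (\<forall>x. x \<notin> K \<longrightarrow> grad \<phi> x = 0)"
proof -
  define K where "K = closure {x. \<phi> x \<noteq> 0}"
  have K: "compact K \<and> K \<subseteq> \<Omega>"
    using \<phi> by (simp only: test_functions_def mem_Collect_eq K_def simp_thms)
  have z: "\<forall>x. x \<notin> K \<longrightarrow> \<phi> x = 0" using closure_subset[of "{x. \<phi> x \<noteq> 0}"] unfolding K_def by blast
  have "grad \<phi> x = 0" if x: "x \<notin> K" for x
  proof (rule grad_eqI)
    have "((\<lambda>_. 0::real) has_derivative (\<lambda>h. inner h (0::'a))) (at x)" by simp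
    then show "(\<phi> has_derivative (\<lambda>h. inner h (0::'a))) (at x)"
      by (rule has_derivative_transform_within_open[where f="\<lambda>_. 0" and s="- K" and g=\<phi>])
         (simp_all add: x z K compact_imp_closed open_Compl)
  qed
  with K z show ?thesis by blast
qed

lemma test_zero_outside: "x \<notin> \<Omega> \<Longrightarrow> \<phi> x = 0" "x \<notin> \<Omega> \<Longrightarrow> grad \<phi> x = 0"
proof -
  obtain K where "K \<subseteq> \<Omega>" "\<forall>x. x \<notin> K \<longrightarrow> \<phi> x = 0" "\<forall>x. x \<notin> K \<longrightarrow> grad \<phi> x = 0"
    using test_support by blast
  then show "x \<notin> \<Omega> \<Longrightarrow> \<phi> x = 0" "x \<notin> \<Omega> \<Longrightarrow> grad \<phi> x = 0" by auto
qed

lemma test_bounded: "\<exists>M>0. (\<forall>x. norm (grad \<phi> x) \<le> M) \<and> (\<forall>x. \<bar>\<phi> x\<bar> \<le> M)"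
proof -
  obtain K where K: "compact K" "\<And>x. x \<notin> K \<Longrightarrow> \<phi> x = 0" "\<And>x. x \<notin> K \<Longrightarrow> grad \<phi> x = 0"
    using test_support by blast
  have "bounded (grad \<phi> ` K)" "bounded (\<phi> ` K)"
    using K(1) test_grad_continuous test_continuous
    by (auto intro!: compact_imp_bounded compact_continuous_image intro: continuous_on_subset)
  then obtain A B where A: "\<forall>x\<in>K. norm (grad \<phi> x) \<le> A" and B: "\<forall>x\<in>K. norm (\<phi> x) \<le> B"
    unfolding bounded_iff by auto
  \<comment> \<open>For empty \<open>K\<close> the numbers \<open>A\<close> and \<open>B\<close> are
    arbitrary; the entry 1 makes the common bound positive in every case.\<close>
  have "norm (grad \<phi> x) \<le> max 1 (max A B)" "\<bar>\<phi> x\<bar> \<le> max 1 (max A B)" for x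
    using A B K by (cases "x \<in> K"; force)+
  then show ?thesis by (intro exI[of _ "max 1 (max A B)"]) auto
qed

lemma test_borel: "\<phi> \<in> borel_measurable borel" "grad \<phi> \<in> borel_measurable borel"
  by (rule borel_measurable_continuous_onI, rule test_continuous)
     (rule borel_measurable_continuous_onI, rule test_grad_continuous)

lemma test_integrable:
  "integrable lborel (\<lambda>x. (\<phi> x)\<^sup>2)" "integrable lborel (\<lambda>x. (norm (grad \<phi> x))\<^sup>2)"
proof -
  obtain K where K: "compact K" "\<forall>x. x \<notin> K \<longrightarrow> \<phi> x = 0" "\<forall>x. x \<notin> K \<longrightarrow> grad \<phi> x = 0"
    using test_support by blast
  have c: "continuous_on K \<phi>" "continuous_on K (grad \<phi>)"
    using test_continuous test_grad_continuous continuous_on_subset by blast+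
  have "continuous_on K (\<lambda>x. (\<phi> x)\<^sup>2)" "continuous_on K (\<lambda>x. (norm (grad \<phi> x))\<^sup>2)"
    by (intro continuous_on_power continuous_on_norm c)+
  note * = this[THEN borel_integrable_compact[OF K(1)]]
  have **: "(\<lambda>x. indicator K x *\<^sub>R (\<phi> x)\<^sup>2) = (\<lambda>x. (\<phi> x)\<^sup>2)"
    "(\<lambda>x. indicator K x *\<^sub>R (norm (grad \<phi> x))\<^sup>2) = (\<lambda>x. (norm (grad \<phi> x))\<^sup>2)"
    using K(2,3) by (auto simp: indicator_def intro!: ext)
  show "integrable lborel (\<lambda>x. (\<phi> x)\<^sup>2)" "integrable lborel (\<lambda>x. (norm (grad \<phi> x))\<^sup>2)"
    using * unfolding ** .
qed

end

section \<open>Averages of a test function over translates of a set\<close>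

lemma borel_imp_lebesgue_on:
  "f \<in> borel_measurable borel \<Longrightarrow> f \<in> borel_measurable (lebesgue_on S)"
  by (simp add: measurable_restrict_space1 measurable_completion)

lemma borel_shift:
  fixes f :: "'a::euclidean_space \<Rightarrow> 'b::topological_space"
  shows "f \<in> borel_measurable borel \<Longrightarrow> (\<lambda>x. f (x + c)) \<in> borel_measurable borel"
  by (rule measurable_compose[of "\<lambda>x. x + c" borel borel f]) auto

lemma bounded_integrable_lebesgue_on:
  fixes f :: "'a::euclidean_space \<Rightarrow> 'b::euclidean_space"
  assumes "f \<in> borel_measurable borel" "E \<in> lmeasurable" "\<And>x. norm (f x) \<le> M"
  shows "integrable (lebesgue_on E) f"
proof (rule integrableI_bounded_set[where A=E and B=M])
  show "E \<in> sets (lebesgue_on E)" by simp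
  show "f \<in> borel_measurable (lebesgue_on E)" by (rule borel_imp_lebesgue_on[OF assms(1)])
  show "emeasure (lebesgue_on E) E < \<infinity>"
    using fmeasurableD2[OF assms(2)] by (simp add: emeasure_restrict_space fmeasurableD[OF assms(2)] less_top del: emeasure_completion)
  show "AE x in lebesgue_on E. x \<in> E \<longrightarrow> norm (f x) \<le> M" using assms(3) by simp
qed auto

context
  fixes \<Omega> :: "'a::euclidean_space set" and \<phi> :: "'a \<Rightarrow> real" and E :: "'a set" and e :: 'a
  assumes \<phi>: "\<phi> \<in> test_functions \<Omega>" and E: "E \<in> lmeasurable" and e: "norm e = 1"
begin

text \<open>An unnormalised average over \<open>E\<close>, translated by \<open>h\<close> along
  \<open>e\<close>. Averages are used since, unlike point values, they are stable under L2
  convergence of test functions; \<open>shift_slope\<close> turns out to be the derivative in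
  \<open>h\<close>.\<close>

definition "shift_integral h = integral\<^sup>L (lebesgue_on E) (\<lambda>x. \<phi> (x + h *\<^sub>R e))"
definition "shift_slope h = integral\<^sup>L (lebesgue_on E) (\<lambda>x. inner (grad \<phi> (x + h *\<^sub>R e)) e)"

lemma line_deriv:
  "((\<lambda>h. \<phi> (x + h *\<^sub>R e)) has_real_derivative inner (grad \<phi> (x + h *\<^sub>R e)) e) (at h)"
proof -
  have "((\<lambda>h. \<phi> (x + h *\<^sub>R e)) has_derivative (\<lambda>s. inner (s *\<^sub>R e) (grad \<phi> (x + h *\<^sub>R e)))) (at h)"
    by (rule has_derivative_compose[OF _ test_deriv[OF \<phi>], where f="\<lambda>h. x + h *\<^sub>R e" and f'="\<lambda>s. s *\<^sub>R e"])
       (auto intro!: derivative_eq_intros)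
  then show ?thesis
    by (simp add: has_field_derivative_def inner_commute[of e] mult_commute_abs)
qed

lemma shift_slope_cont: "isCont shift_slope h"
proof -
  obtain M where M: "\<And>x. norm (grad \<phi> x) \<le> M" using test_bounded[OF \<phi>] by blast
  note [measurable] = test_borel[OF \<phi>]
  have "(\<lambda>n. shift_slope (X n)) \<longlonglongrightarrow> shift_slope h" if X: "X \<longlonglongrightarrow> h" for X :: "nat \<Rightarrow> real"
    unfolding shift_slope_def
  proof (rule integral_dominated_convergence[where w="\<lambda>_. M"])
    show "integrable (lebesgue_on E) (\<lambda>_. M)"
      by (rule bounded_integrable_lebesgue_on[OF _ E, where M="\<bar>M\<bar>"]) auto
    show "AE x in lebesgue_on E. (\<lambda>i. inner (grad \<phi> (x + X i *\<^sub>R e)) e) \<longlonglongrightarrow> inner (grad \<phi> (x + h *\<^sub>R e)) e"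
      using X test_grad_continuous[OF \<phi>]
      by (intro AE_I2 tendsto_inner tendsto_const continuous_on_tendsto_compose[where s=UNIV and f="grad \<phi>"]
          tendsto_add tendsto_scaleR) auto
    fix i show "AE x in lebesgue_on E. norm (inner (grad \<phi> (x + X i *\<^sub>R e)) e) \<le> M"
      using M e by (intro AE_I2) (metis Cauchy_Schwarz_ineq2 mult.right_neutral order_trans real_norm_def)
  qed (intro borel_imp_lebesgue_on; measurable)+
  then show ?thesis unfolding isCont_def tendsto_at_iff_sequentially by (auto simp: comp_def)
qed

text \<open>Differentiation under the integral: along a line the difference quotients of
  \<open>\<phi>\<close> are dominated by the gradient bound \<open>M\<close>, which is integrable
  over \<open>E\<close> as \<open>E\<close> has finite measure.\<close>

lemma shift_integral_deriv: "(shift_integral has_real_derivative shift_slope h) (at h)"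
proof -
  obtain M where M: "M > 0" "\<And>x. norm (grad \<phi> x) \<le> M" "\<And>x. \<bar>\<phi> x\<bar> \<le> M" using test_bounded[OF \<phi>] by blast
  note [measurable] = test_borel[OF \<phi>]
  have b: "\<bar>inner (grad \<phi> y) e\<bar> \<le> M" for y
    using M e by (metis Cauchy_Schwarz_ineq2 mult.right_neutral order_trans)
  have lip: "\<bar>\<phi> (x + (h+s) *\<^sub>R e) - \<phi> (x + h *\<^sub>R e)\<bar> \<le> M * \<bar>s\<bar>" for x s
    using field_differentiable_bound[of UNIV "\<lambda>h. \<phi> (x + h *\<^sub>R e)"
        "\<lambda>h. inner (grad \<phi> (x + h *\<^sub>R e)) e" M "h+s" h] line_deriv b by auto
  have int: "integrable (lebesgue_on E) (\<lambda>x. \<phi> (x + c))" for c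
    by (rule bounded_integrable_lebesgue_on[OF _ E]) (use M in \<open>auto intro!: borel_shift\<close>)
  have "(\<lambda>n. (shift_integral (h + X n) - shift_integral h) / X n) \<longlonglongrightarrow> shift_slope h"
    if X: "X \<longlonglongrightarrow> 0" "\<And>n. X n \<noteq> 0" for X :: "nat \<Rightarrow> real"
  proof -
    have eq: "(shift_integral (h + X n) - shift_integral h) / X n
        = integral\<^sup>L (lebesgue_on E) (\<lambda>x. (\<phi> (x + (h + X n) *\<^sub>R e) - \<phi> (x + h *\<^sub>R e)) / X n)" for n
      unfolding shift_integral_def using int by simp
    show ?thesis unfolding eq shift_slope_def
    proof (rule integral_dominated_convergence[where w="\<lambda>_. M"])
      show "integrable (lebesgue_on E) (\<lambda>_. M)"
        by (rule bounded_integrable_lebesgue_on[OF _ E, where M="\<bar>M\<bar>"]) auto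
      show "AE x in lebesgue_on E. (\<lambda>i. (\<phi> (x + (h + X i) *\<^sub>R e) - \<phi> (x + h *\<^sub>R e)) / X i)
              \<longlonglongrightarrow> inner (grad \<phi> (x + h *\<^sub>R e)) e"
      proof (rule AE_I2)
        fix x
        have "((\<lambda>s. (\<phi> (x + (h + s) *\<^sub>R e) - \<phi> (x + h *\<^sub>R e)) / s) \<longlongrightarrow> inner (grad \<phi> (x + h *\<^sub>R e)) e) (at 0)"
          using line_deriv[of x h] unfolding DERIV_def by simp
        then show "(\<lambda>i. (\<phi> (x + (h + X i) *\<^sub>R e) - \<phi> (x + h *\<^sub>R e)) / X i) \<longlonglongrightarrow> inner (grad \<phi> (x + h *\<^sub>R e)) e"
          using X unfolding tendsto_at_iff_sequentially by (auto simp: comp_def)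
      qed
      fix i show "AE x in lebesgue_on E. norm ((\<phi> (x + (h + X i) *\<^sub>R e) - \<phi> (x + h *\<^sub>R e)) / X i) \<le> M"
        using lip[of _ "X i"] X(2)[of i] by (intro AE_I2) (simp add: pos_divide_le_eq)
    qed (intro borel_imp_lebesgue_on; measurable)+
  qed
  then show ?thesis unfolding DERIV_def tendsto_at_iff_sequentially by (simp add: comp_def)
qed

lemma shift_integral_mvt: assumes "h > 0" shows "\<exists>\<xi>. 0 < \<xi> \<and> \<xi> < h \<and> shift_integral h - shift_integral 0 = h * shift_slope \<xi>"
proof -
  have "\<exists>z>0. z < h \<and> shift_integral h - shift_integral 0 = (h - 0) * shift_slope z"
    by (rule MVT2) (use assms shift_integral_deriv in auto)
  then show ?thesis by auto
qed

end


section \<open>Square integrable functions\<close>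

lemma norm_add_sq_le: "(norm (a + b))\<^sup>2 \<le> 2 * (norm a)\<^sup>2 + 2 * (norm (b::'b::real_inner))\<^sup>2"
proof -
  have "0 \<le> inner (a - b) (a - b)" by simp
  then show ?thesis
    by (simp add: power2_norm_eq_inner inner_add_left inner_add_right inner_diff_left inner_diff_right inner_commute)
qed

lemma L2_space_scaleR: "f \<in> L2_space \<Omega> \<Longrightarrow> (\<lambda>x. c *\<^sub>R f x) \<in> L2_space \<Omega>"
  unfolding L2_space_def by (auto simp: power_mult_distrib)

lemma L2_space_add:
  assumes "f \<in> L2_space \<Omega>" "g \<in> L2_space \<Omega>"
  shows "(\<lambda>x. f x + g x) \<in> L2_space \<Omega>"
proof -
  have "integrable (lebesgue_on \<Omega>) (\<lambda>x. (norm (f x + g x))\<^sup>2)"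
  proof (rule Bochner_Integration.integrable_bound)
    show "integrable (lebesgue_on \<Omega>) (\<lambda>x. 2 * (norm (f x))\<^sup>2 + 2 * (norm (g x))\<^sup>2)"
      using assms unfolding L2_space_def by auto
    have [measurable]: "f \<in> borel_measurable (lebesgue_on \<Omega>)" "g \<in> borel_measurable (lebesgue_on \<Omega>)"
      using assms unfolding L2_space_def by auto
    show "(\<lambda>x. (norm (f x + g x))\<^sup>2) \<in> borel_measurable (lebesgue_on \<Omega>)" by measurable
    show "AE x in lebesgue_on \<Omega>. norm ((norm (f x + g x))\<^sup>2) \<le> norm (2 * (norm (f x))\<^sup>2 + 2 * (norm (g x))\<^sup>2)"
      using norm_add_sq_le by (intro AE_I2) fastforce
  qed
  then show ?thesis using assms unfolding L2_space_def by auto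
qed

lemma L2_space_diff:
  assumes "f \<in> L2_space \<Omega>" "g \<in> L2_space \<Omega>"
  shows "(\<lambda>x. f x - g x) \<in> L2_space \<Omega>"
  using L2_space_add[OF assms(1) L2_space_scaleR[OF assms(2), of "-1"]] by simp

lemma L2_norm_sq: "(L2_norm \<Omega> f)\<^sup>2 = integral\<^sup>L (lebesgue_on \<Omega>) (\<lambda>x. (norm (f x))\<^sup>2)"
  unfolding L2_norm_def L2_inner_def
  by (simp add: real_sqrt_pow2 Bochner_Integration.integral_nonneg power2_norm_eq_inner)

lemma L2_norm_nonneg [simp]: "0 \<le> L2_norm \<Omega> f"
  unfolding L2_norm_def L2_inner_def by (simp add: Bochner_Integration.integral_nonneg)

lemma L2_norm_scaleR: "L2_norm \<Omega> (\<lambda>x. c *\<^sub>R f x) = \<bar>c\<bar> * L2_norm \<Omega> f"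
  unfolding L2_norm_def L2_inner_def
  by (simp add: real_sqrt_mult power2_eq_square[symmetric] mult.assoc[symmetric])

text \<open>The factor 2 stands in for Minkowski's inequality. It comes from the pointwise bound on
  the square of a sum and is harmless where norms tend to zero.\<close>

lemma L2_norm_add_le:
  assumes "f \<in> L2_space \<Omega>" "g \<in> L2_space \<Omega>"
  shows "L2_norm \<Omega> (\<lambda>x. f x + g x) \<le> 2 * (L2_norm \<Omega> f + L2_norm \<Omega> g)"
proof (rule power2_le_imp_le)
  have i: "integrable (lebesgue_on \<Omega>) (\<lambda>x. (norm (f x))\<^sup>2)" "integrable (lebesgue_on \<Omega>) (\<lambda>x. (norm (g x))\<^sup>2)"
    using assms unfolding L2_space_def by auto
  have "(L2_norm \<Omega> (\<lambda>x. f x + g x))\<^sup>2 \<le> integral\<^sup>L (lebesgue_on \<Omega>) (\<lambda>x. 2 * (norm (f x))\<^sup>2 + 2 * (norm (g x))\<^sup>2)"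
    unfolding L2_norm_sq
    by (rule integral_mono) (use L2_space_add[OF assms] i norm_add_sq_le in \<open>auto simp: L2_space_def\<close>)
  also have "\<dots> = 2 * (L2_norm \<Omega> f)\<^sup>2 + 2 * (L2_norm \<Omega> g)\<^sup>2"
    unfolding L2_norm_sq using i by simp
  also have "\<dots> \<le> (2 * (L2_norm \<Omega> f + L2_norm \<Omega> g))\<^sup>2"
    by (simp add: power2_eq_square algebra_simps)
  finally show "(L2_norm \<Omega> (\<lambda>x. f x + g x))\<^sup>2 \<le> (2 * (L2_norm \<Omega> f + L2_norm \<Omega> g))\<^sup>2" .
qed simp

lemma L2_norm_diff_le:
  assumes "f \<in> L2_space \<Omega>" "g \<in> L2_space \<Omega>"
  shows "L2_norm \<Omega> (\<lambda>x. f x - g x) \<le> 2 * (L2_norm \<Omega> f + L2_norm \<Omega> g)"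
  using L2_norm_add_le[OF assms(1) L2_space_scaleR[OF assms(2), of "-1"]] L2_norm_scaleR[of \<Omega> "-1" g] by simp

text \<open>Cauchy-Schwarz against the constant 1: the integral of \<open>(t - w x)\<^sup>2\<close>
  is a nonnegative quadratic polynomial in \<open>t\<close>, evaluated at its minimiser
  \<open>I / m\<close>. Measure zero is a separate case, as the polynomial is then linear.\<close>

lemma integral_le_sqrt_measure:
  fixes w :: "'a::euclidean_space \<Rightarrow> real"
  assumes E: "E \<in> lmeasurable" and w: "w \<in> borel_measurable (lebesgue_on E)"
    and w2: "integrable (lebesgue_on E) (\<lambda>x. (w x)\<^sup>2)"
  shows "integrable (lebesgue_on E) w"
    and "\<bar>integral\<^sup>L (lebesgue_on E) w\<bar> \<le> sqrt (measure lebesgue E) * sqrt (integral\<^sup>L (lebesgue_on E) (\<lambda>x. (w x)\<^sup>2))"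
proof -
  have c: "integrable (lebesgue_on E) (\<lambda>_. c)" for c :: real
    by (rule bounded_integrable_lebesgue_on[OF _ E, where M="\<bar>c\<bar>"]) auto
  show iw: "integrable (lebesgue_on E) w"
  proof (rule Bochner_Integration.integrable_bound[OF _ w])
    show "integrable (lebesgue_on E) (\<lambda>x. 1 + (w x)\<^sup>2)" using c w2 by simp
    have "\<bar>t\<bar> \<le> \<bar>1 + t\<^sup>2\<bar>" for t :: real
      using zero_le_power2[of "\<bar>t\<bar> - 1"] by (simp add: power2_eq_square algebra_simps)
    then show "AE x in lebesgue_on E. norm (w x) \<le> norm (1 + (w x)\<^sup>2)" by simp
  qed
  define m where "m = measure lebesgue E"
  define I where "I = integral\<^sup>L (lebesgue_on E) w"
  define J where "J = integral\<^sup>L (lebesgue_on E) (\<lambda>x. (w x)\<^sup>2)"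
  have m0: "m \<ge> 0" by (simp add: m_def)
  have mE: "integral\<^sup>L (lebesgue_on E) (\<lambda>_. c) = c * m" for c :: real
    using fmeasurableD[OF E] by (simp add: m_def measure_restrict_space)
  have *: "0 \<le> t\<^sup>2 * m - 2 * t * I + J" for t
  proof -
    have "0 \<le> integral\<^sup>L (lebesgue_on E) (\<lambda>x. (t - w x)\<^sup>2)"
      by (rule Bochner_Integration.integral_nonneg) simp
    also have "\<dots> = integral\<^sup>L (lebesgue_on E) (\<lambda>x. (t\<^sup>2 - 2 * t * w x) + (w x)\<^sup>2)"
      by (simp add: power2_diff algebra_simps)
    also have "\<dots> = t\<^sup>2 * m - 2 * t * I + J"
      using c iw w2 by (simp add: mE I_def J_def del: lebesgue_integral_const)
    finally show ?thesis .
  qed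
  have "I\<^sup>2 \<le> m * J"
  proof (cases "m = 0")
    case True
    have "I = 0"
    proof (rule ccontr)
      assume "I \<noteq> 0"
      \<comment> \<open>For \<open>m = 0\<close> this \<open>t\<close> gives the linear polynomial
        the value -1.\<close>
      then show False using *[of "(J + 1) / (2 * I)"] True by simp
    qed
    with True show ?thesis by simp
  next
    case False
    then show ?thesis using *[of "I / m"] m0 by (simp add: field_simps power2_eq_square)
  qed
  then have "\<bar>I\<bar> \<le> sqrt (m * J)" by (simp add: real_le_rsqrt)
  then show "\<bar>integral\<^sup>L (lebesgue_on E) w\<bar> \<le> sqrt (measure lebesgue E) * sqrt (integral\<^sup>L (lebesgue_on E) (\<lambda>x. (w x)\<^sup>2))"
    by (simp add: I_def J_def m_def real_sqrt_mult)
qed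

text \<open>Translation invariance of Lebesgue measure makes the bound independent of
  \<open>c\<close>. This uniformity is essential later, when the translation is an unknown
  intermediate point of the mean value theorem.\<close>

lemma shifted_integral_bound:
  fixes F :: "'a::euclidean_space \<Rightarrow> real"
  assumes E: "E \<in> lmeasurable" and F: "F \<in> borel_measurable borel" and F2: "integrable lborel (\<lambda>x. (F x)\<^sup>2)"
  shows "integrable (lebesgue_on E) (\<lambda>x. F (x + c))"
    and "\<bar>integral\<^sup>L (lebesgue_on E) (\<lambda>x. F (x + c))\<bar> \<le> sqrt (measure lebesgue E) * sqrt (integral\<^sup>L lborel (\<lambda>x. (F x)\<^sup>2))"
proof -
  have m: "(\<lambda>x. (F (x + c))\<^sup>2) \<in> borel_measurable borel"
    using borel_shift[OF F] by measurable
  have d: "distr lborel borel (\<lambda>x. x + c) = lborel"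
    using lborel_distr_plus[of c] unfolding add.commute[of c] .
  have m': "(\<lambda>x. (F x)\<^sup>2) \<in> borel_measurable borel" using F by measurable
  have i1: "integrable lborel (\<lambda>x. (F (x + c))\<^sup>2)"
    using F2 integrable_distr_eq[of "\<lambda>x. x + c" lborel borel "\<lambda>x. (F x)\<^sup>2"] m' d by simp
  have e1: "integral\<^sup>L lborel (\<lambda>x. (F (x + c))\<^sup>2) = integral\<^sup>L lborel (\<lambda>x. (F x)\<^sup>2)"
    using integral_distr[of "\<lambda>x. x + c" lborel borel "\<lambda>x. (F x)\<^sup>2"] m' d by simp
  have i2: "integrable lebesgue (\<lambda>x. (F (x + c))\<^sup>2)" using i1 m by (simp add: integrable_completion)
  have ES: "E \<in> sets lebesgue" using E by (rule fmeasurableD)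
  have i3: "integrable (lebesgue_on E) (\<lambda>x. (F (x + c))\<^sup>2)"
    using integrable_mult_indicator[OF ES i2] ES by (simp add: integrable_restrict_space)
  have le: "integral\<^sup>L (lebesgue_on E) (\<lambda>x. (F (x + c))\<^sup>2) \<le> integral\<^sup>L lborel (\<lambda>x. (F x)\<^sup>2)"
  proof -
    have "integral\<^sup>L (lebesgue_on E) (\<lambda>x. (F (x + c))\<^sup>2) \<le> integral\<^sup>L (lebesgue_on UNIV) (\<lambda>x. (F (x + c))\<^sup>2)"
      by (rule integral_mono_lebesgue_on_AE) (use i2 ES in \<open>auto simp: lebesgue_on_UNIV_eq\<close>)
    also have "\<dots> = integral\<^sup>L lborel (\<lambda>x. (F (x + c))\<^sup>2)"
      using m by (simp add: lebesgue_on_UNIV_eq integral_completion)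
    finally show ?thesis using e1 by simp
  qed
  note mw = borel_imp_lebesgue_on[OF borel_shift[OF F]]
  show "integrable (lebesgue_on E) (\<lambda>x. F (x + c))" by (rule integral_le_sqrt_measure(1)[OF E mw i3])
  show "\<bar>integral\<^sup>L (lebesgue_on E) (\<lambda>x. F (x + c))\<bar> \<le> sqrt (measure lebesgue E) * sqrt (integral\<^sup>L lborel (\<lambda>x. (F x)\<^sup>2))"
    using integral_le_sqrt_measure(2)[OF E mw i3] le
    by (meson mult_left_mono order_trans real_sqrt_ge_zero real_sqrt_le_mono measure_nonneg)
qed


section \<open>Functions in \<open>H\<^sup>1\<^sub>0\<close> along translations\<close>

lemma integral_zero_outside:
  fixes F :: "'a::euclidean_space \<Rightarrow> real"
  assumes "\<Omega> \<in> sets lebesgue" "F \<in> borel_measurable borel" "\<And>x. x \<notin> \<Omega> \<Longrightarrow> F x = 0"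
  shows "integrable lborel F \<longleftrightarrow> integrable (lebesgue_on \<Omega>) F"
    and "integral\<^sup>L lborel F = integral\<^sup>L (lebesgue_on \<Omega>) F"
proof -
  have "(\<lambda>x. indicator \<Omega> x *\<^sub>R F x) = F" using assms(3) by (auto simp: indicator_def fun_eq_iff)
  then show "integrable lborel F \<longleftrightarrow> integrable (lebesgue_on \<Omega>) F"
    "integral\<^sup>L lborel F = integral\<^sup>L (lebesgue_on \<Omega>) F"
    using assms(1,2) by (simp_all add: integrable_restrict_space integral_restrict_space
        integrable_completion integral_completion)
qed

lemma inner_sq_le: "norm e \<le> 1 \<Longrightarrow> (inner a e)\<^sup>2 \<le> (norm (a::'b::real_inner))\<^sup>2"
proof -
  assume "norm e \<le> 1"
  then have "\<bar>inner a e\<bar> \<le> norm a"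
    using Cauchy_Schwarz_ineq2[of a e] mult_left_le[of "norm e" "norm a"] by auto
  then show ?thesis using power_mono[of "\<bar>inner a e\<bar>" "norm a" 2] by simp
qed

text \<open>A translate of \<open>E\<close> may stick out of \<open>\<Omega>\<close>, so
  \<open>F\<close> has to be extended by zero. Real-valued functions are covered by the direction
  \<open>e = 1\<close>.\<close>

lemma shifted_L2_bound:
  fixes F :: "'a::euclidean_space \<Rightarrow> 'b::euclidean_space"
  assumes \<Omega>: "\<Omega> \<in> sets lebesgue" and F: "F \<in> borel_measurable borel" "\<And>x. x \<notin> \<Omega> \<Longrightarrow> F x = 0" "F \<in> L2_space \<Omega>"
    and E: "E \<in> lmeasurable" and e: "norm e \<le> 1"
  shows "integrable (lebesgue_on E) (\<lambda>x. inner (F (x + c)) e)"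
    and "\<bar>integral\<^sup>L (lebesgue_on E) (\<lambda>x. inner (F (x + c)) e)\<bar> \<le> sqrt (measure lebesgue E) * L2_norm \<Omega> F"
proof -
  have m: "(\<lambda>x. inner (F x) e) \<in> borel_measurable borel" using F(1) by measurable
  have mn: "(\<lambda>x. (norm (F x))\<^sup>2) \<in> borel_measurable borel" using F(1) by measurable
  have in2: "integrable lborel (\<lambda>x. (norm (F x))\<^sup>2)"
    using integral_zero_outside(1)[OF \<Omega> mn] F(2,3) by (simp add: L2_space_def)
  have ii: "integrable lborel (\<lambda>x. (inner (F x) e)\<^sup>2)"
  proof (rule Bochner_Integration.integrable_bound[OF in2])
    show "(\<lambda>x. (inner (F x) e)\<^sup>2) \<in> borel_measurable lborel" using m by measurable
    show "AE x in lborel. norm ((inner (F x) e)\<^sup>2) \<le> norm ((norm (F x))\<^sup>2)"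
      using inner_sq_le[OF e] by simp
  qed
  have "integral\<^sup>L lborel (\<lambda>x. (inner (F x) e)\<^sup>2) \<le> integral\<^sup>L lborel (\<lambda>x. (norm (F x))\<^sup>2)"
    by (rule integral_mono[OF ii in2]) (rule inner_sq_le[OF e])
  also have "\<dots> = (L2_norm \<Omega> F)\<^sup>2"
    unfolding L2_norm_sq by (rule integral_zero_outside(2)[OF \<Omega> mn]) (simp add: F(2))
  finally have le: "sqrt (integral\<^sup>L lborel (\<lambda>x. (inner (F x) e)\<^sup>2)) \<le> L2_norm \<Omega> F"
    by (simp add: real_le_lsqrt)
  show "integrable (lebesgue_on E) (\<lambda>x. inner (F (x + c)) e)"
    by (rule shifted_integral_bound(1)[OF E m ii])
  show "\<bar>integral\<^sup>L (lebesgue_on E) (\<lambda>x. inner (F (x + c)) e)\<bar> \<le> sqrt (measure lebesgue E) * L2_norm \<Omega> F"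
    using shifted_integral_bound(2)[OF E m ii, of c] mult_left_mono[OF le, of "sqrt (measure lebesgue E)"] by simp
qed

lemma test_L2:
  assumes "\<phi> \<in> test_functions \<Omega>" "\<Omega> \<in> sets lebesgue"
  shows "\<phi> \<in> L2_space \<Omega>" "grad \<phi> \<in> L2_space \<Omega>"
proof -
  note b = test_borel[OF assms(1)]
  have m: "(\<lambda>x. (norm (\<phi> x))\<^sup>2) \<in> borel_measurable borel" "(\<lambda>x. (norm (grad \<phi> x))\<^sup>2) \<in> borel_measurable borel"
    using b by measurable
  show "\<phi> \<in> L2_space \<Omega>" "grad \<phi> \<in> L2_space \<Omega>"
    unfolding L2_space_def
    using integral_zero_outside(1)[OF assms(2) m(1)] integral_zero_outside(1)[OF assms(2) m(2)]
      test_zero_outside[OF assms(1)] test_integrable[OF assms(1)] b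
    by (auto simp: borel_imp_lebesgue_on)
qed

section \<open>Gradients of limits of test functions\<close>

context
  fixes \<Omega> :: "'a::euclidean_space set" and v :: "'a \<Rightarrow> real" and G :: "'a \<Rightarrow> 'a"
  assumes H: "has_H10_gradient \<Omega> v G" and \<Omega>: "open \<Omega>"
    and v: "v \<in> borel_measurable borel" "\<And>x. x \<notin> \<Omega> \<Longrightarrow> v x = 0"
begin

lemma \<Omega>_lebesgue: "\<Omega> \<in> sets lebesgue" using \<Omega> by simp

lemma H10_approx:
  "\<exists>\<phi>. (\<forall>n. \<phi> n \<in> test_functions \<Omega>) \<and> (\<lambda>n. L2_norm \<Omega> (\<lambda>x. \<phi> n x - v x)) \<longlonglongrightarrow> 0 \<and>
          (\<lambda>n. L2_norm \<Omega> (\<lambda>x. grad (\<phi> n) x - G x)) \<longlonglongrightarrow> 0"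
  using H unfolding has_H10_gradient_def by blast

lemma vG_L2: "v \<in> L2_space \<Omega>" "G \<in> L2_space \<Omega>"
  using H unfolding has_H10_gradient_def by auto

lemma v_shift_integrable: "E \<in> lmeasurable \<Longrightarrow> integrable (lebesgue_on E) (\<lambda>x. v (x + c))"
  using shifted_L2_bound(1)[OF \<Omega>_lebesgue v vG_L2(1), of E 1 c] by simp

lemma approx_shift:
  assumes \<phi>: "\<phi> \<in> test_functions \<Omega>" and E: "E \<in> lmeasurable"
  shows "\<bar>integral\<^sup>L (lebesgue_on E) (\<lambda>x. \<phi> (x + c)) - integral\<^sup>L (lebesgue_on E) (\<lambda>x. v (x + c))\<bar>
     \<le> sqrt (measure lebesgue E) * L2_norm \<Omega> (\<lambda>x. \<phi> x - v x)"
proof -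
  let ?F = "\<lambda>x. \<phi> x - v x"
  have b: "?F \<in> borel_measurable borel" using test_borel[OF \<phi>] v by measurable
  have z: "\<And>x. x \<notin> \<Omega> \<Longrightarrow> ?F x = 0" using test_zero_outside[OF \<phi>] v by simp
  note L = L2_space_diff[OF test_L2(1)[OF \<phi> \<Omega>_lebesgue] vG_L2(1)]
  have i: "integrable (lebesgue_on E) (\<lambda>x. \<phi> (x + c))"
    using shifted_L2_bound(1)[OF \<Omega>_lebesgue test_borel(1)[OF \<phi>] _ test_L2(1)[OF \<phi> \<Omega>_lebesgue] E, of 1 c]
      test_zero_outside[OF \<phi>] by simp
  show ?thesis
    using shifted_L2_bound(2)[OF \<Omega>_lebesgue b z L E, of 1 c] i v_shift_integrable[OF E, of c] by simp
qed

text \<open>\<open>G\<close> is uncontrolled outside \<open>\<Omega>\<close> and cannot be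
  translated, hence the free comparison function \<open>F\<close>. It is instantiated with the
  gradient of another test function and with a Borel version of \<open>G\<close> that is zero
  outside.\<close>

lemma approx_shift_grad:
  assumes \<phi>: "\<phi> \<in> test_functions \<Omega>" and E: "E \<in> lmeasurable" and e: "norm e = 1"
    and F: "F \<in> borel_measurable borel" "\<And>x. x \<notin> \<Omega> \<Longrightarrow> F x = 0" "F \<in> L2_space \<Omega>"
  shows "\<bar>integral\<^sup>L (lebesgue_on E) (\<lambda>x. inner (grad \<phi> (x + c)) e) - integral\<^sup>L (lebesgue_on E) (\<lambda>x. inner (F (x + c)) e)\<bar>
     \<le> sqrt (measure lebesgue E) * L2_norm \<Omega> (\<lambda>x. grad \<phi> x - F x)"
proof -
  let ?F = "\<lambda>x. grad \<phi> x - F x"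
  have b: "?F \<in> borel_measurable borel" using test_borel[OF \<phi>] F by measurable
  have z: "\<And>x. x \<notin> \<Omega> \<Longrightarrow> ?F x = 0" using test_zero_outside[OF \<phi>] F by simp
  note L = L2_space_diff[OF test_L2(2)[OF \<phi> \<Omega>_lebesgue] F(3)]
  have e': "norm e \<le> 1" using e by simp
  have i: "integrable (lebesgue_on E) (\<lambda>x. inner (grad \<phi> (x + c)) e)"
    using shifted_L2_bound(1)[OF \<Omega>_lebesgue test_borel(2)[OF \<phi>] _ test_L2(2)[OF \<phi> \<Omega>_lebesgue] E e', of c]
      test_zero_outside[OF \<phi>] by simp
  have j: "integrable (lebesgue_on E) (\<lambda>x. inner (F (x + c)) e)"
    by (rule shifted_L2_bound(1)[OF \<Omega>_lebesgue F E e'])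
  show ?thesis
    using shifted_L2_bound(2)[OF \<Omega>_lebesgue b z L E e', of c] i j by (simp add: inner_diff_left)
qed

text \<open>The counterpart for \<open>G\<close> itself, at translation zero: \<open>E\<close> lies
  in \<open>\<Omega>\<close>, where \<open>G\<close> is square integrable.\<close>

lemma approx_grad_subset:
  assumes \<phi>: "\<phi> \<in> test_functions \<Omega>" and E: "E \<in> lmeasurable" "E \<subseteq> \<Omega>" and e: "norm e = 1"
  shows "integrable (lebesgue_on E) (\<lambda>x. inner (G x) e)"
    "\<bar>integral\<^sup>L (lebesgue_on E) (\<lambda>x. inner (grad \<phi> x) e) - integral\<^sup>L (lebesgue_on E) (\<lambda>x. inner (G x) e)\<bar>
     \<le> sqrt (measure lebesgue E) * L2_norm \<Omega> (\<lambda>x. grad \<phi> x - G x)"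
proof -
  have e': "norm e \<le> 1" using e by simp
  have ES: "E \<in> sets lebesgue" using E by (simp add: fmeasurableD)
  have *: "integrable (lebesgue_on E) (\<lambda>x. inner (F x) e) \<and>
     \<bar>integral\<^sup>L (lebesgue_on E) (\<lambda>x. inner (F x) e)\<bar> \<le> sqrt (measure lebesgue E) * L2_norm \<Omega> F"
    if F: "F \<in> L2_space \<Omega>" for F :: "'a \<Rightarrow> 'a"
  proof -
    have Fm: "F \<in> borel_measurable (lebesgue_on \<Omega>)" and F2: "integrable (lebesgue_on \<Omega>) (\<lambda>x. (norm (F x))\<^sup>2)"
      using F by (auto simp: L2_space_def)
    have sp: "lebesgue_on E = restrict_space (lebesgue_on \<Omega>) E"
      using E(2) by (simp add: restrict_restrict_space Int_absorb1 \<Omega>_lebesgue ES)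
    have FmE: "F \<in> borel_measurable (lebesgue_on E)"
      unfolding sp by (rule measurable_restrict_space1[OF Fm])
    have m: "(\<lambda>x. inner (F x) e) \<in> borel_measurable (lebesgue_on E)" using FmE by measurable
    have F2E: "integrable (lebesgue_on E) (\<lambda>x. (norm (F x))\<^sup>2)"
    proof -
      have "E \<in> sets (lebesgue_on \<Omega>)" using ES E(2) by (simp add: sets_restrict_space_iff \<Omega>_lebesgue)
      from integrable_mult_indicator[OF this F2] this show ?thesis
        unfolding sp using E(2) by (simp add: integrable_restrict_space Int_absorb2)
    qed
    have i: "integrable (lebesgue_on E) (\<lambda>x. (inner (F x) e)\<^sup>2)"
    proof (rule Bochner_Integration.integrable_bound[OF F2E])
      show "(\<lambda>x. (inner (F x) e)\<^sup>2) \<in> borel_measurable (lebesgue_on E)" using m by measurable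
      show "AE x in lebesgue_on E. norm ((inner (F x) e)\<^sup>2) \<le> norm ((norm (F x))\<^sup>2)"
        using inner_sq_le[OF e'] by simp
    qed
    have "integral\<^sup>L (lebesgue_on E) (\<lambda>x. (inner (F x) e)\<^sup>2) \<le> integral\<^sup>L (lebesgue_on \<Omega>) (\<lambda>x. (norm (F x))\<^sup>2)"
      by (rule integral_mono_lebesgue_on_AE[OF F2 _ _ E(2) ES \<Omega>_lebesgue]) (simp_all add: inner_sq_le[OF e'])
    also have "\<dots> = (L2_norm \<Omega> F)\<^sup>2" by (simp add: L2_norm_sq)
    finally have le: "sqrt (integral\<^sup>L (lebesgue_on E) (\<lambda>x. (inner (F x) e)\<^sup>2)) \<le> L2_norm \<Omega> F"
      by (simp add: real_le_lsqrt)
    then show ?thesis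
      using integral_le_sqrt_measure[OF E(1) m i] mult_left_mono[OF le, of "sqrt (measure lebesgue E)"] by simp
  qed
  show i: "integrable (lebesgue_on E) (\<lambda>x. inner (G x) e)" using *[OF vG_L2(2)] by simp
  have j: "integrable (lebesgue_on E) (\<lambda>x. inner (grad \<phi> x) e)" using *[OF test_L2(2)[OF \<phi> \<Omega>_lebesgue]] by simp
  show "\<bar>integral\<^sup>L (lebesgue_on E) (\<lambda>x. inner (grad \<phi> x) e) - integral\<^sup>L (lebesgue_on E) (\<lambda>x. inner (G x) e)\<bar>
     \<le> sqrt (measure lebesgue E) * L2_norm \<Omega> (\<lambda>x. grad \<phi> x - G x)"
    using *[OF L2_space_diff[OF test_L2(2)[OF \<phi> \<Omega>_lebesgue] vG_L2(2)]] i j by (simp add: inner_diff_left)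
qed

text \<open>The slope of a late approximant \<open>k\<close> at an intermediate translation
  \<open>\<xi>\<close> equals its difference quotient, which is close to that of \<open>v\<close>
  and so to the right-hand side. It is also close to the slope of a fixed approximant
  \<open>m\<close> at \<open>\<xi>\<close>, then at 0, and so to the integral of \<open>G\<close>.
  The order of choice matters: \<open>m\<close>, then \<open>h\<close>, then
  \<open>k\<close>.\<close>

lemma affine_integral_gradient:
  assumes W: "\<And>x. x \<in> W \<Longrightarrow> v x = inner a x + c" and E: "E \<in> lmeasurable" "E \<subseteq> W" "W \<subseteq> \<Omega>" and e: "norm e = 1"
    and r: "r > 0" "\<And>x h. x \<in> E \<Longrightarrow> 0 \<le> h \<Longrightarrow> h \<le> r \<Longrightarrow> x + h *\<^sub>R e \<in> W"
  shows "integral\<^sup>L (lebesgue_on E) (\<lambda>x. inner (G x) e) = measure lebesgue E * inner a e"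
proof (rule ccontr)
  let ?I = "integral\<^sup>L (lebesgue_on E) (\<lambda>x. inner (G x) e)"
  let ?A = "measure lebesgue E * inner a e"
  assume neq: "?I \<noteq> ?A"
  \<comment> \<open>Four errors of at most \<open>\<epsilon>\<close> each are added at the end; a
    sixth leaves slack.\<close>
  define \<epsilon> where "\<epsilon> = \<bar>?I - ?A\<bar> / 6"
  have \<epsilon>: "\<epsilon> > 0" using neq by (simp add: \<epsilon>_def)
  obtain \<phi> where \<phi>: "\<And>n. \<phi> n \<in> test_functions \<Omega>" and d: "(\<lambda>n. L2_norm \<Omega> (\<lambda>x. \<phi> n x - v x)) \<longlonglongrightarrow> 0"
    and g: "(\<lambda>n. L2_norm \<Omega> (\<lambda>x. grad (\<phi> n) x - G x)) \<longlonglongrightarrow> 0"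
    using H10_approx by blast
  define S where "S = sqrt (measure lebesgue E)"
  have S0: "S \<ge> 0" by (simp add: S_def)
  let ?d = "\<lambda>n. L2_norm \<Omega> (\<lambda>x. \<phi> n x - v x)"
  let ?g = "\<lambda>n. L2_norm \<Omega> (\<lambda>x. grad (\<phi> n) x - G x)"
  let ?shift_integral = "\<lambda>n. shift_integral (\<phi> n) E e" and ?shift_slope = "\<lambda>n. shift_slope (\<phi> n) E e"
  let ?V = "\<lambda>h. integral\<^sup>L (lebesgue_on E) (\<lambda>x. v (x + h *\<^sub>R e))"
  have ES: "E \<subseteq> \<Omega>" using E by auto
  have eE: "?V h - ?V 0 = h * ?A" if "0 \<le> h" "h \<le> r" for h
  proof -
    have "?V h - ?V 0 = integral\<^sup>L (lebesgue_on E) (\<lambda>x. v (x + h *\<^sub>R e) - v (x + 0 *\<^sub>R e))"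
      using v_shift_integrable[OF E(1), of "h *\<^sub>R e"] v_shift_integrable[OF E(1), of "0 *\<^sub>R e"]
      by (subst Bochner_Integration.integral_diff) auto
    also have "\<dots> = integral\<^sup>L (lebesgue_on E) (\<lambda>x. h * inner a e)"
    proof (rule Bochner_Integration.integral_cong[OF refl])
      fix x assume "x \<in> space (lebesgue_on E)"
      then have x: "x \<in> E" by simp
      have "x \<in> W" "x + h *\<^sub>R e \<in> W" using r(2)[OF x that] E(2) x by auto
      then show "v (x + h *\<^sub>R e) - v (x + 0 *\<^sub>R e) = h * inner a e"
        by (simp add: W inner_add_right)
    qed
    also have "\<dots> = h * ?A" using fmeasurableD[OF E(1)] by (simp add: measure_restrict_space)
    finally show "?V h - ?V 0 = h * ?A" .
  qed
  \<comment> \<open>The bound does not depend on \<open>\<xi>\<close>, which is only known after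
    \<open>k\<close> has been chosen.\<close>
  have cau: "\<bar>?shift_slope k \<xi> - ?shift_slope m \<xi>\<bar> \<le> S * (2 * (?g k + ?g m))" for k m \<xi>
  proof -
    have z: "\<And>x. x \<notin> \<Omega> \<Longrightarrow> grad (\<phi> m) x = 0" by (rule test_zero_outside(2)[OF \<phi>])
    have 1: "\<bar>?shift_slope k \<xi> - ?shift_slope m \<xi>\<bar> \<le> S * L2_norm \<Omega> (\<lambda>x. grad (\<phi> k) x - grad (\<phi> m) x)"
      unfolding shift_slope_def[OF \<phi> E(1) e] S_def
      by (rule approx_shift_grad[OF \<phi> E(1) e test_borel(2)[OF \<phi>] z test_L2(2)[OF \<phi> \<Omega>_lebesgue]])
    have "L2_norm \<Omega> (\<lambda>x. (grad (\<phi> k) x - G x) - (grad (\<phi> m) x - G x)) \<le> 2 * (?g k + ?g m)"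
      by (rule L2_norm_diff_le; rule L2_space_diff[OF test_L2(2)[OF \<phi> \<Omega>_lebesgue] vG_L2(2)])
    then have "L2_norm \<Omega> (\<lambda>x. grad (\<phi> k) x - grad (\<phi> m) x) \<le> 2 * (?g k + ?g m)" by simp
    from mult_left_mono[OF this S0] 1 show ?thesis by linarith
  qed
  have "(\<lambda>n. S * (2 * (?g n + ?g n))) \<longlonglongrightarrow> S * (2 * (0 + 0))" by (intro tendsto_intros g)
  then have "(\<lambda>n. S * (2 * (?g n + ?g n))) \<longlonglongrightarrow> 0" by simp
  from order_tendstoD(2)[OF this \<epsilon>] obtain m where m: "\<And>n. n \<ge> m \<Longrightarrow> S * (2 * (?g n + ?g n)) < \<epsilon>"
    unfolding eventually_sequentially by blast
  have Q0: "\<bar>?shift_slope m 0 - ?I\<bar> \<le> \<epsilon>"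
  proof -
    have "\<bar>?shift_slope m 0 - ?I\<bar> \<le> S * ?g m"
      using approx_grad_subset(2)[OF \<phi> E(1) ES e, of m] unfolding shift_slope_def[OF \<phi> E(1) e] S_def by simp
    also have "\<dots> \<le> S * (2 * (?g m + ?g m))" by (intro mult_left_mono S0) (simp)
    finally show ?thesis using m[of m] by simp
  qed
  obtain \<delta> where \<delta>: "\<delta> > 0" "\<And>\<xi>. \<bar>\<xi>\<bar> < \<delta> \<Longrightarrow> \<bar>?shift_slope m \<xi> - ?shift_slope m 0\<bar> < \<epsilon>"
  proof -
    obtain \<delta> where \<delta>: "\<delta> > 0" "\<And>\<xi>. \<xi> \<noteq> 0 \<Longrightarrow> \<bar>\<xi>\<bar> < \<delta> \<Longrightarrow> \<bar>?shift_slope m \<xi> - ?shift_slope m 0\<bar> < \<epsilon>"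
      using LIM_D[OF shift_slope_cont[OF \<phi>[of m] E(1) e, of 0, unfolded isCont_def] \<epsilon>] by auto
    have "\<bar>?shift_slope m \<xi> - ?shift_slope m 0\<bar> < \<epsilon>" if "\<bar>\<xi>\<bar> < \<delta>" for \<xi>
      using \<delta>(2)[OF _ that] \<epsilon> by (cases "\<xi> = 0") auto
    with \<delta>(1) show thesis by (rule that)
  qed
  \<comment> \<open>Half the minimum keeps \<open>h\<close> at most \<open>r\<close>, where
    \<open>v\<close> is exactly affine, and strictly below \<open>\<delta>\<close>, where the slope
    of \<open>m\<close> is nearly constant.\<close>
  define h where "h = min r \<delta> / 2"
  have h: "h > 0" "h \<le> r" "h < \<delta>" using r(1) \<delta>(1) by (auto simp: h_def)
  have "(\<lambda>n. S * ?d n) \<longlonglongrightarrow> S * 0" by (intro tendsto_intros d)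
  then have Sd: "(\<lambda>n. S * ?d n) \<longlonglongrightarrow> 0" by simp
  have "h * \<epsilon> / 2 > 0" using h \<epsilon> by simp
  from order_tendstoD(2)[OF Sd this] obtain n0 where n0: "\<And>n. n \<ge> n0 \<Longrightarrow> S * ?d n < h * \<epsilon> / 2"
    unfolding eventually_sequentially by blast
  define k where "k = max m n0"
  obtain \<xi> where \<xi>: "0 < \<xi>" "\<xi> < h" "?shift_integral k h - ?shift_integral k 0 = h * ?shift_slope k \<xi>"
    using shift_integral_mvt[OF \<phi> E(1) e h(1), of k] by blast
  have PV: "\<bar>?shift_integral k t - ?V t\<bar> < h * \<epsilon> / 2" for t
    using approx_shift[OF \<phi> E(1), of k "t *\<^sub>R e"] n0[of k] unfolding shift_integral_def[OF \<phi> E(1) e] S_def k_def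
    by simp
  have "\<bar>h * ?shift_slope k \<xi> - h * ?A\<bar> < h * \<epsilon>"
    using PV[of h] PV[of 0] eE[OF less_imp_le[OF h(1)] h(2)] \<xi>(3) by linarith
  then have 1: "\<bar>?shift_slope k \<xi> - ?A\<bar> < \<epsilon>"
    using h(1) by (simp add: right_diff_distrib[symmetric] abs_mult)
  have 2: "\<bar>?shift_slope k \<xi> - ?shift_slope m \<xi>\<bar> \<le> \<epsilon>"
  proof -
    have "k \<ge> m" by (simp add: k_def)
    \<comment> \<open>The mixed bound is the mean of the bounds for the pairs \<open>(k, k)\<close>
      and \<open>(m, m)\<close>, both of which are below \<open>\<epsilon>\<close>.\<close>
    have "S * (2 * (?g k + ?g m)) = (S * (2 * (?g k + ?g k)) + S * (2 * (?g m + ?g m))) / 2"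
      by (simp add: algebra_simps)
    then show ?thesis using cau[of k \<xi> m] m[OF \<open>k \<ge> m\<close>] m[of m] by simp
  qed
  have 3: "\<bar>?shift_slope m \<xi> - ?shift_slope m 0\<bar> < \<epsilon>" using \<delta>(2)[of \<xi>] \<xi> h by simp
  have "\<bar>?I - ?A\<bar> < 6 * \<epsilon>" using 1 2 3 Q0 \<epsilon> by linarith
  then show False by (simp add: \<epsilon>_def)
qed

end

context
  fixes \<Omega> :: "'a::euclidean_space set" and v :: "'a \<Rightarrow> real" and G :: "'a \<Rightarrow> 'a"
  assumes H: "has_H10_gradient \<Omega> v G" and \<Omega>: "open \<Omega>"
    and v: "v \<in> borel_measurable borel" "\<And>x. x \<notin> \<Omega> \<Longrightarrow> v x = 0"
begin

text \<open>Each component of \<open>G - a\<close> integrates to zero over every measurable subset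
  of the ball, hence vanishes almost everywhere. The doubled radius leaves room for translations of
  length up to \<open>r\<close>.\<close>

lemma H10_gradient_affine_ball:
  assumes W: "\<And>x. x \<in> ball p (2 * r) \<Longrightarrow> v x = inner a x + c" "ball p (2 * r) \<subseteq> \<Omega>" and r: "r > 0"
  shows "AE x in lebesgue_on (ball p r). G x = a"
proof -
  have sub: "ball p r \<subseteq> \<Omega>" using W(2) r subset_ball[of r "2 * r" p] by auto
  have "AE x in lebesgue_on (ball p r). inner (G x) e - inner a e = 0" if "e \<in> Basis" for e
  proof (rule sigma_finite_measure.density_zero)
    have "finite_measure (lebesgue_on (ball p r))"
      by (rule finite_measure_lebesgue_on) simp
    then show "sigma_finite_measure (lebesgue_on (ball p r))" by (simp add: finite_measure_def)
    have e: "norm e = 1" using that by simp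
    obtain \<phi> where \<phi>: "\<phi> \<in> test_functions \<Omega>" using H10_approx[OF H \<Omega> v] by blast
    have int: "integrable (lebesgue_on E) (\<lambda>x. inner (G x) e)" if "E \<in> lmeasurable" "E \<subseteq> \<Omega>" for E
      by (rule approx_grad_subset(1)[OF H \<Omega> v \<phi> that e])
    have ci: "integrable (lebesgue_on E) (\<lambda>x. inner a e)" if "E \<in> lmeasurable" for E
      by (rule bounded_integrable_lebesgue_on[OF _ that, where M="\<bar>inner a e\<bar>"]) auto
    show "integrable (lebesgue_on (ball p r)) (\<lambda>x. inner (G x) e - inner a e)"
      by (rule Bochner_Integration.integrable_diff[OF int[OF lmeasurable_ball sub] ci[OF lmeasurable_ball]])
    fix A assume A0: "A \<in> sets (lebesgue_on (ball p r))"
    then have A: "A \<in> sets lebesgue" "A \<subseteq> ball p r"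
      by (simp_all add: sets_restrict_space_iff)
    have Am: "A \<in> lmeasurable"
      by (rule fmeasurableI2[OF lmeasurable_ball A(2) A(1)])
    have eq: "integral\<^sup>L (lebesgue_on A) (\<lambda>x. inner (G x) e) = measure lebesgue A * inner a e"
    proof (rule affine_integral_gradient[OF H \<Omega> v _ Am _ W(2) e r])
      show "A \<subseteq> ball p (2 * r)" using A(2) r subset_ball[of r "2 * r" p] by auto
      show "x + h *\<^sub>R e \<in> ball p (2 * r)" if "x \<in> A" "0 \<le> h" "h \<le> r" for x h
      proof -
        have "dist p x < r" using that A by auto
        moreover have "dist x (x + h *\<^sub>R e) \<le> r"
          using \<open>0 \<le> h\<close> \<open>h \<le> r\<close> e unfolding dist_norm by simp
        ultimately have "dist p (x + h *\<^sub>R e) < 2 * r"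
          using dist_triangle[of p "x + h *\<^sub>R e" x] by linarith
        then show ?thesis by (simp only: mem_ball)
      qed
    qed (use W(1) v in simp_all)
    have sp: "lebesgue_on A = restrict_space (lebesgue_on (ball p r)) A"
      using A(2) by (simp add: restrict_restrict_space Int_absorb1 A)
    have "set_lebesgue_integral (lebesgue_on (ball p r)) A (\<lambda>x. inner (G x) e - inner a e)
      = integral\<^sup>L (lebesgue_on A) (\<lambda>x. inner (G x) e - inner a e)"
      unfolding sp set_lebesgue_integral_def
      by (rule integral_restrict_space[symmetric]) (simp only: space_lebesgue_on Int_absorb2[OF A(2)] A0)
    also have "\<dots> = 0"
    proof -
      have "A \<subseteq> \<Omega>" by (rule order_trans[OF A(2) sub])
      then have "integral\<^sup>L (lebesgue_on A) (\<lambda>x. inner (G x) e - inner a e)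
        = integral\<^sup>L (lebesgue_on A) (\<lambda>x. inner (G x) e) - integral\<^sup>L (lebesgue_on A) (\<lambda>x. inner a e)"
        by (intro Bochner_Integration.integral_diff int[OF Am] ci[OF Am])
      also have "integral\<^sup>L (lebesgue_on A) (\<lambda>x. inner a e) = measure lebesgue A * inner a e"
        using A(1) by (simp add: measure_restrict_space)
      finally show ?thesis by (simp add: eq)
    qed
    finally show "set_lebesgue_integral (lebesgue_on (ball p r)) A (\<lambda>x. inner (G x) e - inner a e) = 0" .
  qed
  then have "AE x in lebesgue_on (ball p r). \<forall>e\<in>Basis. inner (G x) e - inner a e = 0"
    by (intro AE_finite_allI) auto
  then show ?thesis
  proof (rule lebesgue_on_mono)
    fix x assume *: "\<forall>e\<in>Basis. inner (G x) e - inner a e = 0"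
    show "G x = a"
    proof (rule euclidean_eqI)
      fix e :: 'a assume "e \<in> Basis"
      with * have "inner (G x) e - inner a e = 0" by (rule bspec)
      then show "inner (G x) e = inner a e" by simp
    qed
  qed
qed

text \<open>The balls whose doubles lie in \<open>W\<close> cover \<open>W\<close>. By Lindelof
  countably many suffice, so the exceptional null sets add up to a null set.\<close>

lemma H10_gradient_affine:
  assumes W: "open W" "W \<subseteq> \<Omega>" "\<And>x. x \<in> W \<Longrightarrow> v x = inner a x + c"
  shows "AE x in lebesgue. x \<in> W \<longrightarrow> G x = a"
proof -
  define F where "F = {ball p r |p r. r > 0 \<and> ball p (2 * r) \<subseteq> W}"
  have "\<And>S. S \<in> F \<Longrightarrow> openin (top_of_set UNIV) S" by (auto simp: F_def)
  then obtain F' where F': "F' \<subseteq> F" "countable F'" "\<Union>F' = \<Union>F" by (rule Lindelof_openin)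
  have WF: "W \<subseteq> \<Union>F"
  proof
    fix x assume "x \<in> W"
    then obtain r where "r > 0" "ball x r \<subseteq> W" using W(1) open_contains_ball by blast
    then have "ball x (r/2) \<in> F" unfolding F_def by (intro CollectI exI[of _ x] exI[of _ "r/2"]) auto
    then show "x \<in> \<Union>F" using \<open>r > 0\<close> by (intro UnionI[of "ball x (r/2)"]) auto
  qed
  have "AE x in lebesgue. x \<in> S \<longrightarrow> G x = a" if S: "S \<in> F'" for S
  proof -
    obtain p r where pr: "S = ball p r" "r > 0" "ball p (2 * r) \<subseteq> W" using S F'(1) unfolding F_def by blast
    have "AE x in lebesgue_on (ball p r). G x = a"
      by (rule H10_gradient_affine_ball) (use pr W in auto)
    then show ?thesis by (simp add: AE_restrict_space_iff pr(1))
  qed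
  then have "AE x in lebesgue. \<forall>S\<in>F'. x \<in> S \<longrightarrow> G x = a"
    using AE_ball_countable[OF F'(2), of "\<lambda>x S. x \<in> S \<longrightarrow> G x = a" lebesgue] by blast
  then show ?thesis
  proof (rule eventually_mono)
    fix x assume "\<forall>S\<in>F'. x \<in> S \<longrightarrow> G x = a"
    then show "x \<in> W \<longrightarrow> G x = a" using WF F'(3) by auto
  qed
qed

text \<open>\<open>b\<close> is a bounded Borel version of \<open>G\<close>, extended by zero, so
  \<open>x\<close> and \<open>y\<close> may lie anywhere and the segment between them may cross the
  boundary. Averages of \<open>v\<close> over a ball at \<open>x\<close> and its translate at
  \<open>y\<close> differ, per unit of measure, by at most \<open>K * h\<close>; shrinking the ball
  recovers the values at points of continuity.\<close>

lemma H10_lipschitz: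
  assumes b: "b \<in> borel_measurable borel" "\<And>x. x \<notin> \<Omega> \<Longrightarrow> b x = 0" "AE x in lebesgue_on \<Omega>. G x = b x"
    "\<And>x. norm (b x) \<le> K"
    and x: "isCont v x" and y: "isCont v y"
  shows "\<bar>v y - v x\<bar> \<le> K * norm (y - x)"
proof (cases "y = x")
  case True
  have "K \<ge> 0" using b(4)[of undefined] norm_ge_zero order_trans by blast
  then show ?thesis using True by simp
next
  case False
  define h where "h = norm (y - x)"
  define e where "e = (y - x) /\<^sub>R h"
  have h: "h > 0" using False by (simp add: h_def)
  have e: "norm e = 1" using h by (simp add: e_def h_def)
  have yx: "y = x + h *\<^sub>R e" using h by (simp add: e_def)
  obtain \<phi> where \<phi>: "\<And>n. \<phi> n \<in> test_functions \<Omega>" and d: "(\<lambda>n. L2_norm \<Omega> (\<lambda>x. \<phi> n x - v x)) \<longlonglongrightarrow> 0"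
    and g: "(\<lambda>n. L2_norm \<Omega> (\<lambda>x. grad (\<phi> n) x - G x)) \<longlonglongrightarrow> 0"
    using H10_approx[OF H \<Omega> v] by blast
  have \<Omega>l: "\<Omega> \<in> sets lebesgue" using \<Omega> by simp
  have Gb: "L2_norm \<Omega> (\<lambda>x. grad (\<phi> n) x - G x) = L2_norm \<Omega> (\<lambda>x. grad (\<phi> n) x - b x)" for n
  proof -
    have m: "grad (\<phi> n) \<in> borel_measurable (lebesgue_on \<Omega>)" "b \<in> borel_measurable (lebesgue_on \<Omega>)"
      "G \<in> borel_measurable (lebesgue_on \<Omega>)"
      using borel_imp_lebesgue_on[OF test_borel(2)[OF \<phi>[of n]]] borel_imp_lebesgue_on[OF b(1)] vG_L2(2)[OF H \<Omega> v]
      by (simp_all add: L2_space_def)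
    have "(\<lambda>x. inner (grad (\<phi> n) x - G x) (grad (\<phi> n) x - G x)) \<in> borel_measurable (lebesgue_on \<Omega>)"
      "(\<lambda>x. inner (grad (\<phi> n) x - b x) (grad (\<phi> n) x - b x)) \<in> borel_measurable (lebesgue_on \<Omega>)"
      using m by measurable
    moreover have "AE x in lebesgue_on \<Omega>. inner (grad (\<phi> n) x - G x) (grad (\<phi> n) x - G x) =
        inner (grad (\<phi> n) x - b x) (grad (\<phi> n) x - b x)"
      by (rule lebesgue_on_mono[OF b(3)]) simp
    ultimately show ?thesis unfolding L2_norm_def L2_inner_def
      by (simp only: Bochner_Integration.integral_cong_AE)
  qed
  have bL2: "b \<in> L2_space \<Omega>"
  proof -
    have m: "b \<in> borel_measurable (lebesgue_on \<Omega>)" using b(1) by (rule borel_imp_lebesgue_on)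
    have mG: "G \<in> borel_measurable (lebesgue_on \<Omega>)" "integrable (lebesgue_on \<Omega>) (\<lambda>x. (norm (G x))\<^sup>2)"
      using vG_L2(2)[OF H \<Omega> v] by (auto simp: L2_space_def)
    have "integrable (lebesgue_on \<Omega>) (\<lambda>x. (norm (b x))\<^sup>2)"
    proof (rule integrable_cong_AE_imp[OF mG(2)])
      show "(\<lambda>x. (norm (b x))\<^sup>2) \<in> borel_measurable (lebesgue_on \<Omega>)" using m by measurable
      show "AE x in lebesgue_on \<Omega>. (norm (G x))\<^sup>2 = (norm (b x))\<^sup>2" by (rule lebesgue_on_mono[OF b(3)]) simp
    qed
    with m show ?thesis by (simp add: L2_space_def)
  qed
  have main: "\<bar>integral\<^sup>L (lebesgue_on E) (\<lambda>z. v (z + h *\<^sub>R e)) - integral\<^sup>L (lebesgue_on E) v\<bar> \<le> h * (K * measure lebesgue E)"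
    if E: "E \<in> lmeasurable" for E
  proof -
    define S where "S = sqrt (measure lebesgue E)"
    let ?V = "\<lambda>t. integral\<^sup>L (lebesgue_on E) (\<lambda>z. v (z + t *\<^sub>R e))"
    let ?d = "\<lambda>n. L2_norm \<Omega> (\<lambda>x. \<phi> n x - v x)" and ?g = "\<lambda>n. L2_norm \<Omega> (\<lambda>x. grad (\<phi> n) x - G x)"
    have le: "\<bar>?V h - ?V 0\<bar> \<le> h * (K * measure lebesgue E) + (h * (S * ?g n) + 2 * (S * ?d n))" for n
    proof -
      obtain \<xi> where \<xi>: "0 < \<xi>" "\<xi> < h" "shift_integral (\<phi> n) E e h - shift_integral (\<phi> n) E e 0 = h * shift_slope (\<phi> n) E e \<xi>"
        using shift_integral_mvt[OF \<phi> E e h, of n] by blast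
      have PV: "\<bar>shift_integral (\<phi> n) E e t - ?V t\<bar> \<le> S * ?d n" for t
        using approx_shift[OF H \<Omega> v \<phi> E, of n "t *\<^sub>R e"] unfolding shift_integral_def[OF \<phi> E e] S_def by simp
      have Qb: "\<bar>shift_slope (\<phi> n) E e \<xi> - integral\<^sup>L (lebesgue_on E) (\<lambda>z. inner (b (z + \<xi> *\<^sub>R e)) e)\<bar> \<le> S * ?g n"
        using approx_shift_grad[OF H \<Omega> v \<phi> E e b(1,2) bL2, of n "\<xi> *\<^sub>R e"]
        unfolding shift_slope_def[OF \<phi> E e] S_def Gb by simp
      have bb: "\<bar>inner (b z) e\<bar> \<le> K" for z
        using Cauchy_Schwarz_ineq2[of "b z" e] b(4)[of z] e by simp
      have mb: "(\<lambda>z. inner (b (z + \<xi> *\<^sub>R e)) e) \<in> borel_measurable borel" using borel_shift[OF b(1)] by measurable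
      have bi: "integrable (lebesgue_on E) (\<lambda>z. inner (b (z + \<xi> *\<^sub>R e)) e)"
        by (rule bounded_integrable_lebesgue_on[OF mb E, where M=K]) (simp add: bb)
      have ci: "integrable (lebesgue_on E) (\<lambda>z. K)"
        by (rule bounded_integrable_lebesgue_on[OF _ E, where M="\<bar>K\<bar>"]) auto
      have "\<bar>integral\<^sup>L (lebesgue_on E) (\<lambda>z. inner (b (z + \<xi> *\<^sub>R e)) e)\<bar> \<le> integral\<^sup>L (lebesgue_on E) (\<lambda>z. \<bar>inner (b (z + \<xi> *\<^sub>R e)) e\<bar>)"
        by (rule integral_abs_bound)
      also have "\<dots> \<le> integral\<^sup>L (lebesgue_on E) (\<lambda>z. K)"
        by (rule integral_mono[OF integrable_abs[OF bi] ci]) (rule bb)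
      also have "\<dots> = K * measure lebesgue E"
        using fmeasurableD[OF E] by (simp add: measure_restrict_space)
      finally have "\<bar>shift_slope (\<phi> n) E e \<xi>\<bar> \<le> K * measure lebesgue E + S * ?g n" using Qb by linarith
      then have "h * \<bar>shift_slope (\<phi> n) E e \<xi>\<bar> \<le> h * (K * measure lebesgue E + S * ?g n)" using h by (intro mult_left_mono) auto
      then have "\<bar>h * shift_slope (\<phi> n) E e \<xi>\<bar> \<le> h * (K * measure lebesgue E) + h * (S * ?g n)" using h by (simp add: abs_mult distrib_left)
      then show ?thesis using PV[of h] PV[of 0] \<xi>(3) by linarith
    qed
    have "(\<lambda>n. h * (K * measure lebesgue E) + (h * (S * ?g n) + 2 * (S * ?d n)))
       \<longlonglongrightarrow> h * (K * measure lebesgue E) + (h * (S * 0) + 2 * (S * 0))"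
      by (intro tendsto_intros d g)
    then have "\<bar>?V h - ?V 0\<bar> \<le> h * (K * measure lebesgue E) + (h * (S * 0) + 2 * (S * 0))"
      by (rule LIMSEQ_le_const) (use le in blast)
    then show ?thesis by simp
  qed
  have "\<bar>v y - v x\<bar> \<le> K * h + \<epsilon>" if \<epsilon>: "\<epsilon> > 0" for \<epsilon>
  proof -
    obtain r1 where r1: "r1 > 0" "\<And>z. dist z x < r1 \<Longrightarrow> \<bar>v z - v x\<bar> < \<epsilon> / 2"
      using x[unfolded continuous_at_eps_delta, rule_format, of "\<epsilon>/2"] \<epsilon> by (auto simp: dist_real_def)
    obtain r2 where r2: "r2 > 0" "\<And>z. dist z y < r2 \<Longrightarrow> \<bar>v z - v y\<bar> < \<epsilon> / 2"
      using y[unfolded continuous_at_eps_delta, rule_format, of "\<epsilon>/2"] \<epsilon> by (auto simp: dist_real_def)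
    \<comment> \<open>Translation by \<open>h *\<^sub>R e\<close>, which is \<open>y - x\<close>,
      carries this ball to the ball of the same radius at \<open>y\<close>; thus one radius serves
      continuity at both points.\<close>
    define E where "E = ball x (min r1 r2)"
    have E: "E \<in> lmeasurable" by (simp add: E_def)
    define m where "m = measure lebesgue E"
    have m: "m > 0" unfolding m_def E_def using r1 r2 content_ball_pos[of "min r1 r2" x] by simp
    have ci: "integrable (lebesgue_on E) (\<lambda>z. k)" for k :: real
      by (rule bounded_integrable_lebesgue_on[OF _ E, where M="\<bar>k\<bar>"]) auto
    have i: "integrable (lebesgue_on E) (\<lambda>z. v (z + h *\<^sub>R e))" "integrable (lebesgue_on E) (\<lambda>z. v z)"
      using v_shift_integrable[OF H \<Omega> v E, of "h *\<^sub>R e"] v_shift_integrable[OF H \<Omega> v E, of 0] by auto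
    define f where "f = (\<lambda>z. (v (z + h *\<^sub>R e) - v z) - (v y - v x))"
    have fi: "integrable (lebesgue_on E) f" unfolding f_def using i ci by auto
    have fb: "\<bar>f z\<bar> \<le> \<epsilon>" if "z \<in> E" for z
    proof -
      have "dist z x < r1" "dist (z + h *\<^sub>R e) y < r2"
        using that by (auto simp: E_def yx dist_norm norm_minus_commute)
      from r1(2)[OF this(1)] r2(2)[OF this(2)] show ?thesis unfolding f_def by linarith
    qed
    have "\<bar>integral\<^sup>L (lebesgue_on E) f\<bar> \<le> integral\<^sup>L (lebesgue_on E) (\<lambda>z. \<bar>f z\<bar>)" by (rule integral_abs_bound)
    also have "\<dots> \<le> integral\<^sup>L (lebesgue_on E) (\<lambda>z. \<epsilon>)"
      by (rule integral_mono[OF integrable_abs[OF fi] ci]) (simp add: fb)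
    also have "\<dots> = \<epsilon> * m" using fmeasurableD[OF E] by (simp add: measure_restrict_space m_def)
    finally have 1: "\<bar>integral\<^sup>L (lebesgue_on E) f\<bar> \<le> \<epsilon> * m" .
    have 2: "integral\<^sup>L (lebesgue_on E) f = (integral\<^sup>L (lebesgue_on E) (\<lambda>z. v (z + h *\<^sub>R e)) - integral\<^sup>L (lebesgue_on E) v) - (v y - v x) * m"
      unfolding f_def using i ci fmeasurableD[OF E] by (simp add: measure_restrict_space m_def)
    have "\<bar>(v y - v x) * m\<bar> \<le> h * (K * m) + \<epsilon> * m"
      using 1 2 main[OF E, folded m_def] by linarith
    moreover have "\<bar>(v y - v x) * m\<bar> = \<bar>v y - v x\<bar> * m" using m by (simp only: abs_mult abs_of_pos)
    ultimately have "\<bar>v y - v x\<bar> * m \<le> (K * h + \<epsilon>) * m" by (simp add: algebra_simps)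
    then show ?thesis using m by simp
  qed
  then show ?thesis unfolding h_def[symmetric] by (rule field_le_epsilon)
qed

end

section \<open>The linear structure of the space of H10 functions\<close>

lemma L2_scaleR_integrable:
  fixes f :: "'a::euclidean_space \<Rightarrow> real" and g :: "'a \<Rightarrow> 'b::euclidean_space"
  assumes "f \<in> L2_space \<Omega>" "g \<in> L2_space \<Omega>"
  shows "integrable (lebesgue_on \<Omega>) (\<lambda>x. f x *\<^sub>R g x)"
proof (rule Bochner_Integration.integrable_bound)
  show "integrable (lebesgue_on \<Omega>) (\<lambda>x. (norm (f x))\<^sup>2 + (norm (g x))\<^sup>2)"
    using assms unfolding L2_space_def by auto
  have m: "f \<in> borel_measurable (lebesgue_on \<Omega>)" "g \<in> borel_measurable (lebesgue_on \<Omega>)"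
    using assms unfolding L2_space_def by auto
  then show "(\<lambda>x. f x *\<^sub>R g x) \<in> borel_measurable (lebesgue_on \<Omega>)" by measurable
  have "\<bar>s * t\<bar> \<le> s\<^sup>2 + t\<^sup>2" for s t :: real
    using sum_squares_bound[of "\<bar>s\<bar>" "\<bar>t\<bar>"] zero_le_power2[of s] zero_le_power2[of t] abs_ge_zero[of "s * t"]
    unfolding abs_mult power2_abs by linarith
  from this[of "\<bar>f x\<bar>" "norm (g x)" for x] 
  show "AE x in lebesgue_on \<Omega>. norm (f x *\<^sub>R g x) \<le> norm ((norm (f x))\<^sup>2 + (norm (g x))\<^sup>2)"
    by (intro AE_I2) (simp add: abs_mult)
qed

text \<open>Here and below, linearity is expressed by the single operation
  \<open>c * f x + g x\<close>: one closure lemma per space then covers both sums and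
  multiples.\<close>

lemma grad_lincomb:
  fixes f g :: "'a::euclidean_space \<Rightarrow> real"
  assumes "(f has_derivative (\<lambda>h. inner h (grad f x))) (at x)" "(g has_derivative (\<lambda>h. inner h (grad g x))) (at x)"
  shows "grad (\<lambda>x. c * f x + g x) x = c *\<^sub>R grad f x + grad g x"
proof (rule grad_eqI)
  have "((\<lambda>x. c * f x + g x) has_derivative (\<lambda>h. c * inner h (grad f x) + inner h (grad g x))) (at x)"
    by (intro has_derivative_add has_derivative_mult_right assms)
  then show "((\<lambda>x. c * f x + g x) has_derivative (\<lambda>h. inner h (c *\<^sub>R grad f x + grad g x))) (at x)"
    by (simp add: inner_add_right)
qed

text \<open>Induction must be general in \<open>f\<close> and \<open>g\<close>, since the step
  applies it to components of their gradients.\<close>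

lemma Ck_lincomb:
  fixes f g :: "'a::euclidean_space \<Rightarrow> real"
  shows "Ck_function k f \<Longrightarrow> Ck_function k g \<Longrightarrow> Ck_function k (\<lambda>x. c * f x + g x)"
proof (induction k arbitrary: f g)
  case 0 then show ?case by (simp add: continuous_intros)
next
  case (Suc k)
  have d: "f differentiable (at x)" "g differentiable (at x)" for x using Suc.prems by auto
  have gr: "grad (\<lambda>x. c * f x + g x) x = c *\<^sub>R grad f x + grad g x" for x
    by (rule grad_lincomb[OF gderiv_grad[OF d(1)] gderiv_grad[OF d(2)]])
  have "Ck_function k (\<lambda>x. inner (grad (\<lambda>x. c * f x + g x) x) b)" if b: "b \<in> Basis" for b
  proof -
    have "Ck_function k (\<lambda>x. c * inner (grad f x) b + inner (grad g x) b)"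
      by (rule Suc.IH) (use Suc.prems b in auto)
    then show ?thesis by (simp add: gr inner_add_left)
  qed
  moreover have "(\<lambda>x. c * f x + g x) differentiable (at x)" for x
    using d by (intro differentiable_add differentiable_mult differentiable_const)
  ultimately show ?case by simp
qed

lemma test_lincomb:
  assumes "\<phi> \<in> test_functions \<Omega>" "\<psi> \<in> test_functions \<Omega>"
  shows "(\<lambda>x. c * \<phi> x + \<psi> x) \<in> test_functions \<Omega>"
proof -
  let ?A = "closure {x. \<phi> x \<noteq> 0}" and ?B = "closure {x. \<psi> x \<noteq> 0}" and ?C = "closure {x. c * \<phi> x + \<psi> x \<noteq> 0}"
  have f: "\<forall>k. Ck_function k \<phi>" "compact ?A" "?A \<subseteq> \<Omega>" using assms(1) unfolding test_functions_def by blast+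
  have g: "\<forall>k. Ck_function k \<psi>" "compact ?B" "?B \<subseteq> \<Omega>" using assms(2) unfolding test_functions_def by blast+
  have sub: "{x. c * \<phi> x + \<psi> x \<noteq> 0} \<subseteq> {x. \<phi> x \<noteq> 0} \<union> {x. \<psi> x \<noteq> 0}" by auto
  have "?C \<subseteq> ?A \<union> ?B" using closure_mono[OF sub] by (simp add: closure_Un)
  moreover from this have "compact ?C"
    using compact_Un[OF f(2) g(2)] by (meson closed_closure compact_Int_closed compact_eq_bounded_closed bounded_subset)
  ultimately have "compact ?C" "?C \<subseteq> \<Omega>" using f(3) g(3) by auto
  moreover have "\<forall>k. Ck_function k (\<lambda>x. c * \<phi> x + \<psi> x)" using Ck_lincomb f(1) g(1) by blast
  ultimately show ?thesis unfolding test_functions_def by blast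
qed

lemma L2_norm_lincomb_tendsto_0:
  fixes f g :: "nat \<Rightarrow> 'a::euclidean_space \<Rightarrow> 'b::euclidean_space"
  assumes L2: "\<And>n. f n \<in> L2_space \<Omega>" "\<And>n. g n \<in> L2_space \<Omega>"
    and lim: "(\<lambda>n. L2_norm \<Omega> (f n)) \<longlonglongrightarrow> 0" "(\<lambda>n. L2_norm \<Omega> (g n)) \<longlonglongrightarrow> 0"
  shows "(\<lambda>n. L2_norm \<Omega> (\<lambda>x. c *\<^sub>R f n x + g n x)) \<longlonglongrightarrow> 0"
proof (rule tendsto_sandwich[where f="\<lambda>_. 0" and h="\<lambda>n. 2 * (\<bar>c\<bar> * L2_norm \<Omega> (f n) + L2_norm \<Omega> (g n))"])
  have "(\<lambda>n. 2 * (\<bar>c\<bar> * L2_norm \<Omega> (f n) + L2_norm \<Omega> (g n))) \<longlonglongrightarrow> 2 * (\<bar>c\<bar> * 0 + 0)"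
    by (intro tendsto_intros lim)
  then show "(\<lambda>n. 2 * (\<bar>c\<bar> * L2_norm \<Omega> (f n) + L2_norm \<Omega> (g n))) \<longlonglongrightarrow> 0" by simp
  have "L2_norm \<Omega> (\<lambda>x. c *\<^sub>R f n x + g n x) \<le> 2 * (\<bar>c\<bar> * L2_norm \<Omega> (f n) + L2_norm \<Omega> (g n))" for n
    using L2_norm_add_le[OF L2_space_scaleR[OF L2(1), of c] L2(2), of n n] by (simp only: L2_norm_scaleR)
  then show "\<forall>\<^sub>F n in sequentially. L2_norm \<Omega> (\<lambda>x. c *\<^sub>R f n x + g n x) \<le> 2 * (\<bar>c\<bar> * L2_norm \<Omega> (f n) + L2_norm \<Omega> (g n))"
    by (rule always_eventually[OF allI])
qed simp_all

lemma H10_gradient_lincomb: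
  fixes v w :: "'a::euclidean_space \<Rightarrow> real"
  assumes \<Omega>: "open \<Omega>" and v: "has_H10_gradient \<Omega> v G" and w: "has_H10_gradient \<Omega> w H"
  shows "has_H10_gradient \<Omega> (\<lambda>x. c * v x + w x) (\<lambda>x. c *\<^sub>R G x + H x)"
proof -
  have \<Omega>l: "\<Omega> \<in> sets lebesgue" using \<Omega> by simp
  have L: "v \<in> L2_space \<Omega>" "G \<in> L2_space \<Omega>" "w \<in> L2_space \<Omega>" "H \<in> L2_space \<Omega>"
    using v w unfolding has_H10_gradient_def by auto
  have cv: "(\<lambda>x. c * v x) \<in> L2_space \<Omega>" using L2_space_scaleR[OF L(1), of c] by simp
  have 1: "(\<lambda>x. c * v x + w x) \<in> L2_space \<Omega>" by (rule L2_space_add[OF cv L(3)])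
  have 2: "(\<lambda>x. c *\<^sub>R G x + H x) \<in> L2_space \<Omega>" by (rule L2_space_add[OF L2_space_scaleR[OF L(2)] L(4)])
  have 3: "has_weak_gradient \<Omega> (\<lambda>x. c * v x + w x) (\<lambda>x. c *\<^sub>R G x + H x)"
    unfolding has_weak_gradient_def
  proof
    fix \<phi> assume \<phi>: "\<phi> \<in> test_functions \<Omega>"
    note T = test_L2[OF \<phi> \<Omega>l]
    have e: "integral\<^sup>L (lebesgue_on \<Omega>) (\<lambda>x. v x *\<^sub>R grad \<phi> x) = - integral\<^sup>L (lebesgue_on \<Omega>) (\<lambda>x. \<phi> x *\<^sub>R G x)"
      "integral\<^sup>L (lebesgue_on \<Omega>) (\<lambda>x. w x *\<^sub>R grad \<phi> x) = - integral\<^sup>L (lebesgue_on \<Omega>) (\<lambda>x. \<phi> x *\<^sub>R H x)"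
      using v w \<phi> unfolding has_H10_gradient_def has_weak_gradient_def by auto
    have i: "integrable (lebesgue_on \<Omega>) (\<lambda>x. c *\<^sub>R (v x *\<^sub>R grad \<phi> x))" "integrable (lebesgue_on \<Omega>) (\<lambda>x. w x *\<^sub>R grad \<phi> x)"
      "integrable (lebesgue_on \<Omega>) (\<lambda>x. c *\<^sub>R (\<phi> x *\<^sub>R G x))" "integrable (lebesgue_on \<Omega>) (\<lambda>x. \<phi> x *\<^sub>R H x)"
      by (intro integrable_scaleR_right L2_scaleR_integrable L T)+
    have "integral\<^sup>L (lebesgue_on \<Omega>) (\<lambda>x. (c * v x + w x) *\<^sub>R grad \<phi> x)
      = integral\<^sup>L (lebesgue_on \<Omega>) (\<lambda>x. c *\<^sub>R (v x *\<^sub>R grad \<phi> x) + w x *\<^sub>R grad \<phi> x)"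
      by (simp add: scaleR_add_left)
    also have "\<dots> = c *\<^sub>R integral\<^sup>L (lebesgue_on \<Omega>) (\<lambda>x. v x *\<^sub>R grad \<phi> x) + integral\<^sup>L (lebesgue_on \<Omega>) (\<lambda>x. w x *\<^sub>R grad \<phi> x)"
      unfolding Bochner_Integration.integral_add[OF i(1,2)] Bochner_Integration.integral_scaleR_right ..
    also have "\<dots> = - (c *\<^sub>R integral\<^sup>L (lebesgue_on \<Omega>) (\<lambda>x. \<phi> x *\<^sub>R G x) + integral\<^sup>L (lebesgue_on \<Omega>) (\<lambda>x. \<phi> x *\<^sub>R H x))"
      unfolding e by simp
    also have "\<dots> = - integral\<^sup>L (lebesgue_on \<Omega>) (\<lambda>x. c *\<^sub>R (\<phi> x *\<^sub>R G x) + \<phi> x *\<^sub>R H x)"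
      unfolding Bochner_Integration.integral_add[OF i(3,4)] Bochner_Integration.integral_scaleR_right ..
    also have "\<dots> = - integral\<^sup>L (lebesgue_on \<Omega>) (\<lambda>x. \<phi> x *\<^sub>R (c *\<^sub>R G x + H x))"
      by (simp add: scaleR_add_right mult.commute)
    finally show "integral\<^sup>L (lebesgue_on \<Omega>) (\<lambda>x. (c * v x + w x) *\<^sub>R grad \<phi> x)
       = - integral\<^sup>L (lebesgue_on \<Omega>) (\<lambda>x. \<phi> x *\<^sub>R (c *\<^sub>R G x + H x))" .
  qed
  obtain \<phi> where \<phi>: "\<And>n. \<phi> n \<in> test_functions \<Omega>" "(\<lambda>n. L2_norm \<Omega> (\<lambda>x. \<phi> n x - v x)) \<longlonglongrightarrow> 0"
    "(\<lambda>n. L2_norm \<Omega> (\<lambda>x. grad (\<phi> n) x - G x)) \<longlonglongrightarrow> 0"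
    using v unfolding has_H10_gradient_def by blast
  obtain \<psi> where \<psi>: "\<And>n. \<psi> n \<in> test_functions \<Omega>" "(\<lambda>n. L2_norm \<Omega> (\<lambda>x. \<psi> n x - w x)) \<longlonglongrightarrow> 0"
    "(\<lambda>n. L2_norm \<Omega> (\<lambda>x. grad (\<psi> n) x - H x)) \<longlonglongrightarrow> 0"
    using w unfolding has_H10_gradient_def by blast
  let ?\<theta> = "\<lambda>n x. c * \<phi> n x + \<psi> n x"
  have 4: "(\<lambda>n. L2_norm \<Omega> (\<lambda>x. ?\<theta> n x - (c * v x + w x))) \<longlonglongrightarrow> 0"
    using L2_norm_lincomb_tendsto_0[OF L2_space_diff[OF test_L2(1)[OF \<phi>(1) \<Omega>l] L(1)]
        L2_space_diff[OF test_L2(1)[OF \<psi>(1) \<Omega>l] L(3)] \<phi>(2) \<psi>(2), of c]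
    by (simp add: algebra_simps)
  have gr: "grad (?\<theta> n) x = c *\<^sub>R grad (\<phi> n) x + grad (\<psi> n) x" for n x
    by (rule grad_lincomb[OF test_deriv[OF \<phi>(1)] test_deriv[OF \<psi>(1)]])
  have 5: "(\<lambda>n. L2_norm \<Omega> (\<lambda>x. grad (?\<theta> n) x - (c *\<^sub>R G x + H x))) \<longlonglongrightarrow> 0"
    using L2_norm_lincomb_tendsto_0[OF L2_space_diff[OF test_L2(2)[OF \<phi>(1) \<Omega>l] L(2)]
        L2_space_diff[OF test_L2(2)[OF \<psi>(1) \<Omega>l] L(4)] \<phi>(3) \<psi>(3), of c]
    unfolding gr by (simp add: algebra_simps)
  have "\<forall>n. ?\<theta> n \<in> test_functions \<Omega>" using test_lincomb[OF \<phi>(1) \<psi>(1)] by blast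
  then show ?thesis unfolding has_H10_gradient_def using 1 2 3 4 5 by (intro conjI exI[of _ ?\<theta>])
qed


section \<open>Polyhedral geometry\<close>

text \<open>Moving up from \<open>p\<close> by \<open>t\<close> along \<open>e\<close> leaves the
  closure: a nearby point of \<open>\<Omega>\<close> would have to lie below the graph of
  \<open>\<gamma>\<close>, which rises by at most a multiple of the distance. This excludes slits,
  where the domain lies on both sides of its boundary.\<close>

lemma lipschitz_boundary_exterior:
  fixes \<Omega> :: "'a::euclidean_space set"
  assumes op: "open \<Omega>" and lip: "lipschitz_boundary \<Omega>" and p: "p \<in> frontier \<Omega>"
  shows "p \<in> closure (- closure \<Omega>)"
proof -
  obtain e r L \<gamma> where e: "norm e = 1" and r: "r > 0" and L: "lipschitz_on L {y. inner y e = 0} \<gamma>"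
    and sub: "\<forall>x \<in> ball p r. x \<in> \<Omega> \<longleftrightarrow> inner x e < \<gamma> (x - inner x e *\<^sub>R e)"
    using lip p unfolding lipschitz_boundary_def by blast
  have L0: "L \<ge> 0" using L by (simp add: lipschitz_on_def)
  have ee: "inner e e = 1" using e by (simp add: norm_eq_1)
  let ?\<pi> = "\<lambda>x. x - inner x e *\<^sub>R e"
  have hyp: "inner (?\<pi> x) e = 0" for x by (simp add: inner_diff_left ee)
  have "p \<notin> \<Omega>" using p op by (simp add: frontier_def interior_open)
  then have pe: "inner p e \<ge> \<gamma> (?\<pi> p)" using sub r by force
  show ?thesis
  proof (rule closure_approachable[THEN iffD2], intro allI impI)
    fix \<epsilon> :: real assume \<epsilon>: "\<epsilon> > 0"
    define t where "t = min \<epsilon> r / 2"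
    have t: "t > 0" "t < \<epsilon>" "t < r" using \<epsilon> r by (auto simp: t_def)
    define y where "y = p + t *\<^sub>R e"
    have dy: "dist y p = t" using t e by (simp add: y_def dist_norm)
    have "y \<notin> closure \<Omega>"
    proof
      assume "y \<in> closure \<Omega>"
      \<comment> \<open>The first entry keeps \<open>x\<close> in the ball in which the graph
        describes \<open>\<Omega>\<close>. The second contradicts
        \<open>t < (1 + 2 * L) * dist x y\<close>, in which the 2 comes from bounding the projection
        by the triangle inequality.\<close>
      define \<delta> where "\<delta> = min (r - t) (t / (1 + 2 * L))"
      have \<delta>: "\<delta> > 0" using t L0 by (simp add: \<delta>_def)
      obtain x where x: "x \<in> \<Omega>" "dist x y < \<delta>"
        using \<open>y \<in> closure \<Omega>\<close> \<delta> closure_approachable by blast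
      have "dist x p < r" using dist_triangle[of x p y] x(2) dy by (simp add: \<delta>_def)
      then have "x \<in> ball p r" by (simp add: dist_commute)
      then have xe: "inner x e < \<gamma> (?\<pi> x)" using sub x(1) by blast
      have "dist (\<gamma> (?\<pi> x)) (\<gamma> (?\<pi> p)) \<le> L * dist (?\<pi> x) (?\<pi> p)"
        using L hyp unfolding lipschitz_on_def by blast
      moreover have "dist (?\<pi> x) (?\<pi> p) \<le> 2 * dist x y"
      proof -
        have *: "?\<pi> x - ?\<pi> p = (x - y) - inner (x - y) e *\<^sub>R e"
          by (simp add: y_def inner_diff_left inner_add_left ee algebra_simps)
        have "norm ((x - y) - inner (x - y) e *\<^sub>R e) \<le> norm (x - y) + \<bar>inner (x - y) e\<bar>"
          using norm_triangle_ineq4[of "x - y" "inner (x - y) e *\<^sub>R e"] e by simp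
        moreover have "\<bar>inner (x - y) e\<bar> \<le> norm (x - y)"
          using Cauchy_Schwarz_ineq2[of "x - y" e] e by simp
        ultimately show ?thesis unfolding dist_norm * by linarith
      qed
      then have "L * dist (?\<pi> x) (?\<pi> p) \<le> L * (2 * dist x y)" using L0 by (rule mult_left_mono)
      ultimately have g: "\<gamma> (?\<pi> x) \<le> \<gamma> (?\<pi> p) + 2 * L * dist x y" unfolding dist_real_def by linarith
      have "inner y e = inner p e + t" by (simp add: y_def inner_add_left ee)
      moreover have "\<bar>inner (x - y) e\<bar> \<le> dist x y"
        using Cauchy_Schwarz_ineq2[of "x - y" e] e by (simp add: dist_norm)
      ultimately have "t < (1 + 2 * L) * dist x y"
        using g xe pe by (simp add: inner_diff_left algebra_simps abs_le_iff)
      moreover have "(1 + 2 * L) * dist x y < (1 + 2 * L) * (t / (1 + 2 * L))"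
        using x(2) L0 by (intro mult_strict_left_mono) (auto simp: \<delta>_def)
      moreover have "(1 + 2 * L) * (t / (1 + 2 * L)) = t" using L0 by simp
      ultimately show False by linarith
    qed
    then show "\<exists>y\<in>- closure \<Omega>. dist y p < \<epsilon>" using dy t by (intro bexI[of _ y]) auto
  qed
qed

text \<open>A convex set fills a half ball at a relative interior point of a flat piece of
  codimension one, on the side of \<open>c\<close>. The map \<open>f\<close> in the proof is the
  central projection from \<open>c\<close> onto the hyperplane; it is continuous at \<open>p\<close>
  and fixes \<open>p\<close>.\<close>

lemma half_ball_subset:
  fixes K :: "'a::euclidean_space set"
  assumes K: "convex K" "F \<subseteq> K" "c \<in> K" and p: "p \<in> rel_interior F"
    and aff: "affine hull F = {x. inner a x = b}" and c: "inner a c \<noteq> b"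
  shows "\<exists>\<delta>>0. \<forall>q\<in>ball p \<delta>. (inner a q - b) * (inner a c - b) \<ge> 0 \<longrightarrow> q \<in> K"
proof -
  obtain \<rho> where \<rho>: "\<rho> > 0" "ball p \<rho> \<inter> affine hull F \<subseteq> F" "p \<in> F"
    using p unfolding mem_rel_interior_ball by blast
  have ap: "inner a p = b" using \<rho>(3) aff hull_inc[of p F affine] by blast
  \<comment> \<open>A point \<open>q\<close> near \<open>p\<close> on the side of \<open>c\<close> lies between \<open>c\<close> and a point \<open>f q\<close> of \<open>F\<close> near \<open>p\<close>.\<close>
  define t where "t = (\<lambda>q. (inner a q - b) / (inner a c - b))"
  define f where "f = (\<lambda>q. (q - t q *\<^sub>R c) /\<^sub>R (1 - t q))"
  have tp: "t p = 0" by (simp add: t_def ap)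
  have fp: "f p = p" by (simp add: f_def tp)
  have ct: "isCont t p" unfolding t_def using c by (intro continuous_intros) auto
  have cf: "isCont f p" unfolding f_def by (intro continuous_intros ct) (simp add: tp)
  obtain d1 where d1: "d1 > 0" "\<And>q. dist q p < d1 \<Longrightarrow> \<bar>t q\<bar> < 1/2"
    using ct[unfolded continuous_at_eps_delta, rule_format, of "1/2"] by (auto simp: tp dist_real_def)
  obtain d2 where d2: "d2 > 0" "\<And>q. dist q p < d2 \<Longrightarrow> dist (f q) p < \<rho>"
    using cf[unfolded continuous_at_eps_delta, rule_format, of \<rho>] \<rho>(1) by (auto simp: fp)
  have "q \<in> K" if q: "q \<in> ball p (min d1 d2)" and pos: "(inner a q - b) * (inner a c - b) \<ge> 0" for q
  proof -
    have dq: "dist q p < d1" "dist q p < d2" using q by (auto simp: dist_commute)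
    have t0: "t q \<ge> 0" using pos unfolding t_def by (simp add: zero_le_divide_iff zero_le_mult_iff)
    have t1: "t q < 1/2" using d1(2)[OF dq(1)] by simp
    have aq: "inner a q = b + t q * (inner a c - b)" using c by (simp add: t_def)
    have af: "inner a (f q) = (inner a q - t q * inner a c) / (1 - t q)"
      by (simp add: f_def inner_diff_right divide_inverse mult.commute)
    also have "\<dots> = b" using t1 aq by (simp add: field_simps)
    finally have "f q \<in> affine hull F" by (simp add: aff)
    moreover have "f q \<in> ball p \<rho>" using d2(2)[OF dq(2)] by (simp add: dist_commute)
    ultimately have fK: "f q \<in> K" using \<rho>(2) K(2) by blast
    have "q = (1 - t q) *\<^sub>R f q + t q *\<^sub>R c" using t1 by (simp add: f_def)
    also have "\<dots> \<in> K" using K(1) fK K(3) t0 t1 unfolding convex_def by simp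
    finally show ?thesis .
  qed
  then show ?thesis using d1(1) d2(1) by (intro exI[of _ "min d1 d2"]) auto
qed

text \<open>Each of \<open>T\<close> and \<open>T'\<close> fills a half ball at \<open>p\<close>.
  The halves are opposite, since on a common side there would be points of
  \<open>T \<inter> T'\<close> off the hyperplane of \<open>F\<close>; together they fill a
  ball.\<close>

lemma common_facet_interior:
  fixes T :: "'a::euclidean_space set"
  assumes T: "convex T" "F face_of T" "interior T \<noteq> {}" and T': "convex T'" "F face_of T'" "interior T' \<noteq> {}"
    and F: "aff_dim F = int DIM('a) - 1" and int: "T \<inter> T' = F" and p: "p \<in> rel_interior F"
  shows "p \<in> interior (T \<union> T')"
proof -
  obtain a b where a: "a \<noteq> 0" and aff: "affine hull F = {x. inner a x = b}"
    using F aff_dim_eq_hyperplane[of F] by auto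
  have off: "\<exists>c\<in>K. inner a c \<noteq> b" if K: "convex K" "F face_of K" "interior K \<noteq> {}" for K
  proof (rule ccontr)
    assume "\<not> ?thesis"
    then have "K \<subseteq> {x. inner a x = b}" by auto
    then have "interior K \<subseteq> interior {x. inner a x = b}" by (rule interior_mono)
    then show False using K(3) a interior_hyperplane[of a b] by auto
  qed
  obtain c where c: "c \<in> T" "inner a c \<noteq> b" using off[OF T] by blast
  obtain c' where c': "c' \<in> T'" "inner a c' \<noteq> b" using off[OF T'] by blast
  note FT = face_of_imp_subset[OF T(2)] and FT' = face_of_imp_subset[OF T'(2)]
  obtain d where d: "d > 0" "\<And>q. q \<in> ball p d \<Longrightarrow> (inner a q - b) * (inner a c - b) \<ge> 0 \<Longrightarrow> q \<in> T"
    using half_ball_subset[OF T(1) FT c(1) p aff c(2)] by blast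
  obtain d' where d': "d' > 0" "\<And>q. q \<in> ball p d' \<Longrightarrow> (inner a q - b) * (inner a c' - b) \<ge> 0 \<Longrightarrow> q \<in> T'"
    using half_ball_subset[OF T'(1) FT' c'(1) p aff c'(2)] by blast
  have pF: "p \<in> F" using p rel_interior_subset by blast
  have ap: "inner a p = b" using pF aff hull_inc[of p F affine] by blast
  have opp: "(inner a c - b) * (inner a c' - b) < 0"
  proof (rule ccontr)
    assume "\<not> ?thesis"
    then have same: "(inner a c - b) * (inner a c' - b) > 0" using c c' by (simp add: not_less less_le)
    \<comment> \<open>Small enough for \<open>p + s *\<^sub>R (c - p)\<close> to lie in both balls;
      the added 1 keeps the denominator positive.\<close>
    define s where "s = min d d' / (2 * (norm (c - p) + 1))"
    have n1: "norm (c - p) + 1 > 0" using norm_ge_zero[of "c - p"] by linarith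
    then have s: "s > 0" using d(1) d'(1) by (simp add: s_def)
    define q where "q = p + s *\<^sub>R (c - p)"
    have "dist p q = s * norm (c - p)" using s by (simp add: q_def dist_norm)
    also have "\<dots> < s * (2 * (norm (c - p) + 1))" using s n1 by (intro mult_strict_left_mono) auto
    also have "\<dots> = min d d'" using n1 unfolding s_def by simp
    finally have qb: "q \<in> ball p d" "q \<in> ball p d'" by auto
    have aq: "inner a q - b = s * (inner a c - b)" by (simp add: q_def inner_add_right inner_diff_right ap algebra_simps)
    have "q \<in> T" by (rule d(2)[OF qb(1)]) (use s in \<open>simp add: aq mult.assoc\<close>)
    moreover have "q \<in> T'" by (rule d'(2)[OF qb(2)]) (use s same in \<open>simp add: aq mult.assoc\<close>)
    ultimately have "q \<in> F" using int by blast
    then have "inner a q = b" using aff hull_inc[of q F affine] by blast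
    then show False using aq s c(2) by simp
  qed
  have "ball p (min d d') \<subseteq> T \<union> T'"
  proof
    fix q assume "q \<in> ball p (min d d')"
    then have q: "q \<in> ball p d" "q \<in> ball p d'" by auto
    show "q \<in> T \<union> T'"
    proof (cases "(inner a q - b) * (inner a c - b) \<ge> 0")
      case True then show ?thesis using d(2)[OF q(1)] by blast
    next
      case False
      then have "(inner a q - b) * (inner a c' - b) \<ge> 0"
        using opp by (auto simp: mult_less_0_iff zero_le_mult_iff not_le)
      then show ?thesis using d'(2)[OF q(2)] by blast
    qed
  qed
  then show ?thesis using d(1) d'(1) by (meson mem_interior min_less_iff_conj)
qed

text \<open>Seen from \<open>x\<close>, a set of codimension two casts a shadow inside a proper
  affine subspace; finitely many of these null sets cannot cover a nonempty open set.\<close>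

lemma generic_segment:
  fixes x :: "'a::euclidean_space"
  assumes fin: "finite \<S>" and dim: "\<And>A. A \<in> \<S> \<Longrightarrow> aff_dim A \<le> int DIM('a) - 2" and x: "x \<notin> \<Union>\<S>"
    and V: "open V" "V \<noteq> {}"
  obtains y where "y \<in> V" "closed_segment x y \<inter> \<Union>\<S> = {}"
proof -
  \<comment> \<open>If the segment from \<open>x\<close> to \<open>y\<close> meets \<open>A\<close>, then \<open>y\<close> lies in the affine hull of \<open>insert x A\<close>.\<close>
  have "negligible (\<Union>A\<in>\<S>. affine hull (insert x A))"
  proof (rule negligible_Union, goal_cases)
    case (2 B)
    then obtain A where "A \<in> \<S>" and B: "B = affine hull (insert x A)" by blast
    have "aff_dim (insert x A) < int DIM('a)" using dim[OF \<open>A \<in> \<S>\<close>] by (simp add: aff_dim_insert)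
    then have "aff_dim (affine hull (insert x A)) < int DIM('a)" by simp
    then have i: "interior (affine hull (insert x A)) = {}" by (intro low_dim_interior) auto
    have "affine hull (insert x A) \<subseteq> frontier (affine hull (insert x A))"
      unfolding frontier_def i using closure_subset by blast
    then show ?case unfolding B
      by (rule negligible_subset[OF negligible_convex_frontier[OF affine_imp_convex[OF affine_affine_hull]]])
  qed (simp add: fin)
  then have "\<not> V \<subseteq> (\<Union>A\<in>\<S>. affine hull (insert x A))"
    using open_not_negligible[OF V] negligible_subset by blast
  then obtain y where y: "y \<in> V" "\<And>A. A \<in> \<S> \<Longrightarrow> y \<notin> affine hull (insert x A)" by blast
  have "closed_segment x y \<inter> \<Union>\<S> = {}"
  proof (rule ccontr)
    assume "\<not> ?thesis"
    then obtain z A where z: "z \<in> closed_segment x y" and A: "A \<in> \<S>" "z \<in> A" by auto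
    obtain t where t: "0 \<le> t" "z = (1 - t) *\<^sub>R x + t *\<^sub>R y" using z unfolding in_segment by blast
    have "t \<noteq> 0" using t A x by auto
    then have "y = (1 - 1/t) *\<^sub>R x + (1/t) *\<^sub>R z"
      unfolding t(2) by (simp add: algebra_simps)
    also have "\<dots> \<in> affine hull (insert x A)"
      by (rule mem_affine[OF affine_affine_hull]) (use A in \<open>auto intro: hull_inc\<close>)
    finally show False using y(2)[OF A(1)] by blast
  qed
  with y(1) show thesis by (rule that)
qed


section \<open>Meshes\<close>

locale mesh =
  fixes \<Omega> :: "'a::euclidean_space set" and \<T> :: "'a set set"
  assumes bnd: "bounded \<Omega>" and dom: "polyhedral_lipschitz_domain \<Omega>" and conf: "conforming_mesh \<T> \<Omega>"
begin

lemma open_domain: "open \<Omega>" and domain_nonempty: "\<Omega> \<noteq> {}" and lipschitz_domain: "lipschitz_boundary \<Omega>"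
  using dom by (auto simp: polyhedral_lipschitz_domain_def)

lemma finite_mesh: "finite \<T>" and mesh_simplex: "T \<in> \<T> \<Longrightarrow> int DIM('a) simplex T"
  and Union_mesh: "\<Union>\<T> = closure \<Omega>"
  using conf by (auto simp: conforming_mesh_def triangulation_def)

lemma mesh_face:
  assumes "T \<in> \<T>" "T' \<in> \<T>" shows "T \<inter> T' face_of T" "T \<inter> T' face_of T'"
  using conf assms unfolding conforming_mesh_def triangulation_def by (metis Int_commute)+

context fixes T assumes T: "T \<in> \<T>" begin

lemma element_convex: "convex T" and element_compact: "compact T" and element_closed: "closed T"
  and element_polyhedron: "polyhedron T" and element_polytope: "polytope T" and element_aff_dim: "aff_dim T = int DIM('a)"
  using mesh_simplex[OF T] convex_simplex compact_simplex closed_simplex simplex_imp_polyhedron simplex_imp_polytope aff_dim_simplex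
  by blast+

lemma element_hull: "affine hull T = UNIV"
  using element_aff_dim aff_dim_eq_full by blast

lemma element_rel_interior: "rel_interior T = interior T"
  by (rule rel_interior_interior[OF element_hull])

lemma element_nonempty: "T \<noteq> {}" using element_aff_dim by auto

lemma element_interior_nonempty: "interior T \<noteq> {}"
  using rel_interior_eq_empty[OF element_convex] element_nonempty element_rel_interior by simp

lemma element_closure_interior: "closure (interior T) = T"
  using convex_closure_interior[OF element_convex element_interior_nonempty] element_closed by simp

lemma element_subset: "T \<subseteq> closure \<Omega>" using T Union_mesh by blast

lemma facet_aff_dim: "F facet_of T \<Longrightarrow> aff_dim F = int DIM('a) - 1"
  using element_aff_dim by (simp add: facet_of_def)

end

lemma distinct_element_face:
  assumes "T \<in> \<T>" "T' \<in> \<T>" "T \<noteq> T'" shows "T \<inter> T' \<noteq> T"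
proof
  assume eq: "T \<inter> T' = T"
  then have "T face_of T'" using mesh_face(2)[OF assms(1,2)] by simp
  then have "aff_dim T < aff_dim T'" using face_of_aff_dim_lt[OF element_convex[OF assms(2)]] assms(3) by blast
  then show False using element_aff_dim assms by simp
qed

lemma interior_disjoint:
  assumes "T \<in> \<T>" "T' \<in> \<T>" "T \<noteq> T'" shows "interior T \<inter> T' = {}"
  using face_of_disjoint_interior[OF mesh_face(1)[OF assms(1,2)] distinct_element_face[OF assms]] interior_subset[of T] by blast

lemma frontier_exterior: "p \<in> frontier \<Omega> \<Longrightarrow> p \<in> closure (- closure \<Omega>)"
  by (rule lipschitz_boundary_exterior[OF open_domain lipschitz_domain])

text \<open>Each boundary point is a limit of exterior points, so none is interior to the closure.
  Consequently the open elements lie in \<open>\<Omega>\<close> itself and not merely in its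
  closure.\<close>

lemma interior_closure_domain: "interior (closure \<Omega>) = \<Omega>"
proof
  show "interior (closure \<Omega>) \<subseteq> \<Omega>"
  proof
    fix p assume p: "p \<in> interior (closure \<Omega>)"
    then have "p \<notin> closure (- closure \<Omega>)" by (simp add: closure_complement)
    then have "p \<notin> frontier \<Omega>" using frontier_exterior by blast
    moreover have "p \<in> closure \<Omega>" using p interior_subset by blast
    ultimately show "p \<in> \<Omega>" using open_domain by (simp add: frontier_def interior_open)
  qed
  show "\<Omega> \<subseteq> interior (closure \<Omega>)" using open_domain by (simp add: closure_subset interior_maximal)
qed

lemma interior_element_subset: "T \<in> \<T> \<Longrightarrow> interior T \<subseteq> \<Omega>"
  using interior_mono[OF element_subset] interior_closure_domain by blast

text \<open>Near a point \<open>z\<close> of \<open>\<Omega>\<close> in the relative interior of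
  \<open>F\<close> there are points outside \<open>T\<close>; the other elements are closed and
  finitely many, so one of them, \<open>T'\<close>, contains \<open>z\<close>. The face
  \<open>T \<inter> T'\<close> meets the relative interior of \<open>F\<close>, hence contains
  \<open>F\<close>, and a dimension count gives equality.\<close>

lemma interior_facet_shared:
  assumes T: "T \<in> \<T>" and F: "F facet_of T" and nb: "\<not> F \<subseteq> frontier \<Omega>"
  obtains T' where "T' \<in> \<T>" "T' \<noteq> T" "F facet_of T'" "T \<inter> T' = F"
proof -
  have Fc: "convex F" using F element_convex[OF T] by (auto simp: facet_of_def intro: face_of_imp_convex)
  have Fcl: "F \<subseteq> closure \<Omega>" using F facet_of_imp_subset element_subset[OF T] by blast
  then obtain z0 where z0: "z0 \<in> F" "z0 \<in> \<Omega>" using nb open_domain by (auto simp: frontier_def interior_open)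
  have Fclosed: "closed F" using F element_closed[OF T] element_convex[OF T] by (auto simp: facet_of_def intro: face_of_imp_closed)
  have "closure (rel_interior F) = F" using convex_closure_rel_interior[OF Fc] Fclosed by simp
  then have "\<Omega> \<inter> rel_interior F \<noteq> {}"
    using z0 open_domain open_Int_closure_eq_empty by (metis IntI empty_iff)
  then obtain z where z: "z \<in> \<Omega>" "z \<in> rel_interior F" by blast
  have zF: "z \<in> F" using z(2) rel_interior_subset by blast
  have FT: "F \<noteq> T" using F facet_of_irrefl by blast
  have znint: "z \<notin> interior T"
    using face_of_disjoint_interior[OF facet_of_imp_face_of[OF F] FT] zF by blast
  have "z \<in> closure (\<Union>(\<T> - {T}))"
  proof (rule closure_approachable[THEN iffD2], intro allI impI)
    fix \<epsilon> :: real assume "\<epsilon> > 0"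
    obtain r where r: "r > 0" "ball z r \<subseteq> \<Omega>" using z(1) open_domain open_contains_ball by blast
    have "\<not> ball z (min r \<epsilon>) \<subseteq> T" using znint r(1) \<open>\<epsilon> > 0\<close> by (meson mem_interior min_less_iff_conj)
    then obtain y where "y \<in> ball z (min r \<epsilon>)" "y \<notin> T" by blast
    then have y: "dist z y < r" "dist z y < \<epsilon>" "y \<notin> T" by simp_all
    then have "y \<in> \<Union>\<T>" using r(2) closure_subset[of \<Omega>] Union_mesh by auto
    then show "\<exists>y\<in>\<Union> (\<T> - {T}). dist y z < \<epsilon>" using y by (auto simp: dist_commute)
  qed
  moreover have "closed (\<Union>(\<T> - {T}))" using finite_mesh element_closed by (intro closed_Union) auto
  ultimately obtain T' where T': "T' \<in> \<T>" "T' \<noteq> T" "z \<in> T'" by (auto simp: closure_closed)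
  have fT: "T \<inter> T' face_of T" and fT': "T \<inter> T' face_of T'" by (rule mesh_face[OF T T'(1)])+
  have "F \<subseteq> T \<inter> T'"
    by (rule subset_of_face_of[OF fT facet_of_imp_subset[OF F]])
       (use z(2) zF T'(3) facet_of_imp_subset[OF F] in blast)
  have "aff_dim (T \<inter> T') < aff_dim T"
    by (rule face_of_aff_dim_lt[OF element_convex[OF T] fT distinct_element_face[OF T T'(1)]]) (use T' in blast)
  then have ad: "aff_dim (T \<inter> T') \<le> aff_dim F" using F by (simp add: facet_of_def)
  have "F face_of T \<inter> T'"
    by (rule face_of_subset[OF facet_of_imp_face_of[OF F] \<open>F \<subseteq> T \<inter> T'\<close>]) blast
  then have eq: "F = T \<inter> T'"
    using face_of_aff_dim_lt[of "T \<inter> T'" F] ad convex_Int[OF element_convex[OF T] element_convex[OF T'(1)]] by force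
  have "F facet_of T'"
    using fT' F element_aff_dim[OF T] element_aff_dim[OF T'(1)] unfolding eq[symmetric] facet_of_def by simp
  then show thesis using T' eq that by blast
qed

text \<open>Away from the faces of codimension two the local picture is simple: two elements through
  a point share a facet, and an element touching the exterior has a boundary facet there. The
  hypotheses on \<open>k\<close> then determine one value at each such point, and this value is
  locally constant along the segment.\<close>

lemma piecewise_constant_zero:
  fixes k :: "'a set \<Rightarrow> real"
  assumes shared: "\<And>T T' F. T \<in> \<T> \<Longrightarrow> T' \<in> \<T> \<Longrightarrow> T \<noteq> T' \<Longrightarrow> F facet_of T \<Longrightarrow> F facet_of T' \<Longrightarrow> k T = k T'"
    and bdry: "\<And>T F. T \<in> \<T> \<Longrightarrow> F facet_of T \<Longrightarrow> F \<subseteq> frontier \<Omega> \<Longrightarrow> k T = 0"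
    and T0: "T0 \<in> \<T>"
  shows "k T0 = 0"
proof -
  define \<S> where "\<S> = {F. (\<exists>T\<in>\<T>. F face_of T) \<and> aff_dim F \<le> int DIM('a) - 2}"
  have "\<S> \<subseteq> (\<Union>T\<in>\<T>. {F. F face_of T})" by (auto simp: \<S>_def)
  then have fin: "finite \<S>"
    using finite_mesh finite_polytope_faces[OF element_polytope] by (meson finite_UN_I finite_subset)
  obtain x where x: "x \<in> interior T0" using element_interior_nonempty[OF T0] by blast
  have xS: "x \<notin> \<Union>\<S>"
  proof
    assume "x \<in> \<Union>\<S>"
    then obtain F T where F: "x \<in> F" "T \<in> \<T>" "F face_of T" "aff_dim F \<le> int DIM('a) - 2" by (auto simp: \<S>_def)
    have "x \<in> T" using F face_of_imp_subset by blast
    then have "T = T0" using interior_disjoint[OF T0 F(2)] x by blast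
    then have "F = T0" using face_of_disjoint_interior[of F T0] F x by blast
    then show False using F(4) element_aff_dim[OF T0] by simp
  qed
  have "closure \<Omega> \<noteq> UNIV" using bounded_closure[OF bnd] not_bounded_UNIV[where 'a='a] by metis
  then have V: "open (- closure \<Omega>)" "- closure \<Omega> \<noteq> {}" by auto
  obtain y where y: "y \<in> - closure \<Omega>" and seg: "closed_segment x y \<inter> \<Union>\<S> = {}"
    using generic_segment[OF fin _ xS V] unfolding \<S>_def by blast
  \<comment> \<open>Off \<open>\<S>\<close> all elements at a point, and the exterior with value \<open>0\<close>, carry the same value \<open>c\<close>.\<close>
  define good where "good = (\<lambda>p c. (\<forall>T\<in>\<T>. p \<in> T \<longrightarrow> k T = c) \<and> (p \<in> closure (- closure \<Omega>) \<longrightarrow> c = 0))"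
  have common: "T \<inter> T' facet_of T \<and> T \<inter> T' facet_of T'"
    if T: "T \<in> \<T>" "T' \<in> \<T>" "T \<noteq> T'" "p \<in> T" "p \<in> T'" "p \<notin> \<Union>\<S>" for p T T'
  proof -
    note f = mesh_face[OF T(1,2)]
    have "aff_dim (T \<inter> T') < int DIM('a)"
      using face_of_aff_dim_lt[OF element_convex[OF T(1)] f(1) distinct_element_face[OF T(1,2,3)]] element_aff_dim[OF T(1)] by simp
    moreover have "\<not> aff_dim (T \<inter> T') \<le> int DIM('a) - 2" using T f(1) unfolding \<S>_def by blast
    ultimately have "aff_dim (T \<inter> T') = int DIM('a) - 1" by simp
    then show ?thesis using f T(4,5) element_aff_dim[OF T(1)] element_aff_dim[OF T(2)] by (auto simp: facet_of_def)
  qed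
  \<comment> \<open>\<open>p\<close> lies on a facet \<open>F\<close> of \<open>T\<close>, and in
    its relative interior, since otherwise it would lie on a face of codimension two. If
    \<open>F\<close> were not on the boundary, it would be shared and \<open>p\<close> would be
    interior to the closure.\<close>
  have bd: "k T = 0" if T: "T \<in> \<T>" "p \<in> T" and p: "p \<in> closure (- closure \<Omega>)" "p \<notin> \<Union>\<S>" for T p
  proof -
    have pi: "p \<notin> interior (closure \<Omega>)" using p(1) by (simp add: closure_complement)
    then have "p \<notin> interior T" using interior_mono[OF element_subset[OF T(1)]] by blast
    then have "p \<in> rel_frontier T"
      using T(2) element_closed[OF T(1)] by (simp add: rel_frontier_def element_rel_interior[OF T(1)])
    then obtain F where F: "F facet_of T" "p \<in> F"
      using rel_frontier_of_polyhedron[OF element_polyhedron[OF T(1)]] by blast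
    have FT: "F face_of T" by (rule facet_of_imp_face_of[OF F(1)])
    have Fp: "polyhedron F" using face_of_polyhedron_polyhedron[OF element_polyhedron[OF T(1)] FT] .
    have pr: "p \<in> rel_interior F"
    proof (rule ccontr)
      assume "p \<notin> rel_interior F"
      then have "p \<in> rel_frontier F" using F(2) polyhedron_imp_closed[OF Fp] by (simp add: rel_frontier_def)
      then obtain E where E: "E facet_of F" "p \<in> E" using rel_frontier_of_polyhedron[OF Fp] by blast
      have "E face_of T" using face_of_trans[OF facet_of_imp_face_of[OF E(1)] FT] .
      moreover have "aff_dim E = int DIM('a) - 2"
        using E(1) facet_aff_dim[OF T(1) F(1)] by (simp add: facet_of_def)
      ultimately have "E \<in> \<S>" using T(1) by (auto simp: \<S>_def)
      then show False using E(2) p(2) by blast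
    qed
    have "F \<subseteq> frontier \<Omega>"
    proof (rule ccontr)
      assume "\<not> F \<subseteq> frontier \<Omega>"
      then obtain T' where T': "T' \<in> \<T>" "T' \<noteq> T" "F facet_of T'" "T \<inter> T' = F"
        using interior_facet_shared[OF T(1) F(1)] by blast
      have "p \<in> interior (T \<union> T')"
        by (rule common_facet_interior[OF element_convex[OF T(1)] FT element_interior_nonempty[OF T(1)]
            element_convex[OF T'(1)] facet_of_imp_face_of[OF T'(3)] element_interior_nonempty[OF T'(1)]
            facet_aff_dim[OF T(1) F(1)] T'(4) pr])
      moreover have "T \<union> T' \<subseteq> closure \<Omega>" using element_subset T(1) T'(1) by blast
      ultimately show False using pi interior_mono by blast
    qed
    then show ?thesis by (rule bdry[OF T(1) F(1)])
  qed
  have ex: "\<exists>c. good p c" if p: "p \<notin> \<Union>\<S>" for p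
  proof (cases "\<exists>T\<in>\<T>. p \<in> T")
    case True
    then obtain T where T: "T \<in> \<T>" "p \<in> T" by blast
    have "good p (k T)"
      unfolding good_def
    proof (intro conjI ballI impI)
      fix T' assume T': "T' \<in> \<T>" "p \<in> T'"
      show "k T' = k T"
      proof (cases "T' = T")
        case False
        then show ?thesis using common[OF T'(1) T(1) False T'(2) T(2) p] shared[OF T'(1) T(1) False] by blast
      qed simp
    qed (use bd[OF T] p in blast)
    then show ?thesis by blast
  next
    case False
    then show ?thesis unfolding good_def by blast
  qed
  have uniq: "c = c'" if "good p c" "good p c'" for p c c'
  proof (cases "p \<in> closure (- closure \<Omega>)")
    case True then show ?thesis using that by (simp add: good_def)
  next
    case False
    then have "p \<in> closure \<Omega>" using closure_subset[of "- closure \<Omega>"] by blast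
    then obtain T where "T \<in> \<T>" "p \<in> T" using Union_mesh by blast
    then show ?thesis using that unfolding good_def by metis
  qed
  define val where "val = (\<lambda>p. SOME c. good p c)"
  have gv: "good p (val p)" if "p \<notin> \<Union>\<S>" for p using ex[OF that] unfolding val_def by (rule someI_ex)
  have "val constant_on closed_segment x y"
  proof (rule locally_constant_imp_constant)
    fix p assume p: "p \<in> closed_segment x y"
    then have pS: "p \<notin> \<Union>\<S>" using seg by blast
    \<comment> \<open>Removing every closed element that misses \<open>p\<close>, and the exterior
      if its closure misses \<open>p\<close>, leaves a neighbourhood in which no new condition can
      appear: the value at \<open>p\<close> is admissible at every \<open>q\<close> in it.\<close>
    define N where "N = - (\<Union>{T\<in>\<T>. p \<notin> T} \<union> (if p \<in> closure (- closure \<Omega>) then {} else closure (- closure \<Omega>)))"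
    have "closed (\<Union>{T\<in>\<T>. p \<notin> T})" using finite_mesh element_closed by (intro closed_Union) auto
    then have N: "open N" unfolding N_def by (intro open_Compl closed_Un) auto
    have pN: "p \<in> N" unfolding N_def by auto
    have "val q = val p" if q: "q \<in> closed_segment x y \<inter> N" for q
    proof (rule uniq)
      show "good q (val q)" using gv q seg by blast
      show "good q (val p)" using gv[OF pS] q unfolding good_def N_def by (auto split: if_splits)
    qed
    then have "\<forall>q\<in>closed_segment x y \<inter> N. val q = val p" by blast
    moreover have "openin (top_of_set (closed_segment x y)) (closed_segment x y \<inter> N)" using N by (rule openin_open_Int)
    ultimately show "\<exists>N. openin (top_of_set (closed_segment x y)) N \<and> p \<in> N \<and> (\<forall>q\<in>N. val q = val p)"
      using pN p by blast
  qed simp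
  then have "val x = val y" unfolding constant_on_def by auto
  moreover have "val x = k T0" using gv[OF xS] x T0 interior_subset[of T0] unfolding good_def by auto
  moreover have "val y = 0"
  proof -
    have "y \<notin> \<Union>\<S>" using seg by auto
    then show ?thesis using gv[of y] y closure_subset[of "- closure \<Omega>"] unfolding good_def by auto
  qed
  ultimately show ?thesis by simp
qed

end


section \<open>Face integrals and the Crouzeix--Raviart space\<close>

lemma face_integral_cong:
  assumes "\<And>x. x \<in> F \<Longrightarrow> f x = g x"
  shows "face_integral F f = face_integral F g"
  unfolding face_integral_def Let_def
  by (rule Bochner_Integration.integral_cong[OF refl]) (simp add: assms)

lemma face_integral_zero: "(\<And>x. x \<in> F \<Longrightarrow> f x = 0) \<Longrightarrow> face_integral F f = 0"
  unfolding face_integral_def Let_def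
  by (rule integral_eq_zero_AE) (rule AE_I2, simp)

lemma continuous_integrable_lebesgue_on:
  fixes f :: "'a::euclidean_space \<Rightarrow> 'b::euclidean_space"
  assumes "compact S" "continuous_on S f"
  shows "integrable (lebesgue_on S) f"
proof -
  have S: "S \<in> sets lebesgue" using compact_imp_closed[OF assms(1)] by simp
  have i: "integrable lborel (\<lambda>x. indicator S x *\<^sub>R f x)" by (rule borel_integrable_compact[OF assms])
  then have "integrable lebesgue (\<lambda>x. indicator S x *\<^sub>R f x)" 
    using integrable_completion[of "\<lambda>x. indicator S x *\<^sub>R f x" lborel] borel_measurable_integrable[OF i] by blast
  then show ?thesis using S by (simp add: integrable_restrict_space)
qed

context
  fixes F :: "'a::euclidean_space set"
  assumes F: "compact F" "aff_dim F = int DIM('a) - 1" "F \<noteq> {}"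
begin

text \<open>Names for the ingredients of \<open>face_integral\<close>; \<open>face_foot\<close> is
  the orthogonal projection onto the hyperplane of \<open>F\<close>.\<close>

definition "face_level = (THE b. \<forall>x\<in>F. inner (unit_normal F) x = b)"
definition "face_foot x = x - (inner (unit_normal F) x - face_level) *\<^sub>R unit_normal F"
definition "face_prism = {x. face_foot x \<in> F \<and> inner (unit_normal F) x - face_level \<in> {0..1}}"

lemma face_integral_prism: "face_integral F f = integral\<^sup>L (lebesgue_on face_prism) (\<lambda>x. f (face_foot x))"
  unfolding face_integral_def Let_def face_prism_def face_foot_def face_level_def ..

text \<open>Dimension \<open>DIM('a) - 1\<close> makes the affine hull a hyperplane, so the choice
  of a normal has a witness; non-emptiness makes the level unique.\<close>

lemma unit_normal_props: "norm (unit_normal F) = 1" "x \<in> F \<Longrightarrow> inner (unit_normal F) x = face_level"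
proof -
  obtain a b where a: "a \<noteq> 0" and aff: "affine hull F = {x. inner a x = b}"
    using F(2) aff_dim_eq_hyperplane[of F] by auto
  have "\<forall>x\<in>F. inner (a /\<^sub>R norm a) x = b / norm a"
    using aff hull_subset[of F affine] by (auto simp: divide_inverse mult.commute)
  moreover have "norm (a /\<^sub>R norm a) = 1" using a by simp
  ultimately have "\<exists>n. norm n = 1 \<and> (\<exists>b. \<forall>x\<in>F. inner n x = b)" by blast
  then have *: "norm (unit_normal F) = 1 \<and> (\<exists>b. \<forall>x\<in>F. inner (unit_normal F) x = b)"
    unfolding unit_normal_def by (rule someI_ex)
  then show "norm (unit_normal F) = 1" by blast
  have "\<exists>!b. \<forall>x\<in>F. inner (unit_normal F) x = b" using * F(3) by (metis ex_in_conv)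
  from theI'[OF this] show "x \<in> F \<Longrightarrow> inner (unit_normal F) x = face_level"
    unfolding face_level_def by blast
qed

lemma face_foot_continuous: "continuous_on S face_foot"
  unfolding face_foot_def by (intro continuous_intros)

text \<open>Compactness makes continuous integrands integrable, without which the integral over the
  face could not be split.\<close>

lemma face_prism_compact: "compact face_prism"
proof -
  have "closed ((\<lambda>x. face_foot x) -` F \<inter> (\<lambda>x. inner (unit_normal F) x - face_level) -` {0..1})"
    by (intro closed_Int closed_vimage compact_imp_closed F(1) face_foot_continuous continuous_intros closed_atLeastAtMost)
  moreover have "(\<lambda>x. face_foot x) -` F \<inter> (\<lambda>x. inner (unit_normal F) x - face_level) -` {0..1} = face_prism"
    unfolding face_prism_def by blast
  ultimately have cl: "closed face_prism" by simp
  obtain B where B: "\<And>x. x \<in> F \<Longrightarrow> norm x \<le> B" using compact_imp_bounded[OF F(1)] unfolding bounded_iff by blast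
  have "norm x \<le> B + 1" if x: "x \<in> face_prism" for x
  proof -
    have "x = face_foot x + (inner (unit_normal F) x - face_level) *\<^sub>R unit_normal F" by (simp add: face_foot_def)
    then have "norm x \<le> norm (face_foot x) + norm ((inner (unit_normal F) x - face_level) *\<^sub>R unit_normal F)"
      by (metis norm_triangle_ineq)
    moreover have "norm ((inner (unit_normal F) x - face_level) *\<^sub>R unit_normal F) \<le> 1"
      using x unit_normal_props(1) by (simp add: face_prism_def)
    moreover have "norm (face_foot x) \<le> B" using x B by (simp add: face_prism_def)
    ultimately show ?thesis by linarith
  qed
  then have "bounded face_prism" unfolding bounded_iff by blast
  with cl show ?thesis by (simp add: compact_eq_bounded_closed)
qed

lemma face_integral_lincomb:
  assumes f: "continuous_on F f" and g: "continuous_on F g"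
  shows "face_integral F (\<lambda>x. c * f x + g x) = c * face_integral F f + face_integral F g"
proof -
  have i: "integrable (lebesgue_on face_prism) (\<lambda>x. h (face_foot x))" if h: "continuous_on F h" for h :: "'a \<Rightarrow> real"
    by (rule continuous_integrable_lebesgue_on[OF face_prism_compact])
       (rule continuous_on_compose2[OF h face_foot_continuous], auto simp: face_prism_def)
  show ?thesis unfolding face_integral_prism using i[OF f] i[OF g] by simp
qed

text \<open>The prism has positive measure, as it contains a nonempty open set: the points strictly
  between its two ends whose foot is near a relative interior point of \<open>F\<close>.\<close>

lemma face_integral_const_eq_0:
  assumes conv: "convex F" and z: "face_integral F (\<lambda>_. c) = 0"
  shows "c = 0"
proof -
  let ?n = "unit_normal F"
  have "rel_interior F \<noteq> {}" using rel_interior_eq_empty[OF conv] F(3) by simp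
  then obtain p where "p \<in> rel_interior F" by blast
  then obtain \<rho> where \<rho>: "p \<in> F" "\<rho> > 0" "ball p \<rho> \<inter> affine hull F \<subseteq> F"
    unfolding mem_rel_interior_ball by blast
  have n0: "?n \<noteq> 0" using unit_normal_props(1) by auto
  have nn: "inner ?n ?n = 1" using unit_normal_props(1) by (simp add: norm_eq_1)
  have sub: "affine hull F \<subseteq> {x. inner ?n x = face_level}"
    by (rule hull_minimal) (use unit_normal_props(2) affine_hyperplane in auto)
  have hull: "affine hull F = {x. inner ?n x = face_level}"
  proof -
    have "aff_dim {x. inner ?n x = face_level} = int DIM('a) - 1" using aff_dim_hyperplane[OF n0, of face_level] by (simp add: of_nat_diff Suc_leI)
    then show ?thesis by (intro affine_dim_equal affine_affine_hull affine_hyperplane sub) (use F in simp_all)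
  qed
  have foot_hull: "face_foot x \<in> affine hull F" for x
    unfolding hull by (simp add: face_foot_def inner_diff_right nn)
  define W where "W = face_foot -` ball p \<rho> \<inter> (\<lambda>x. inner ?n x - face_level) -` {0<..<1}"
  have W: "open W" unfolding W_def
    by (intro open_Int open_vimage open_ball face_foot_continuous continuous_intros open_greaterThanLessThan)
  have WF: "W \<subseteq> face_prism"
  proof
    fix x assume x: "x \<in> W"
    then have "face_foot x \<in> F" using foot_hull[of x] \<rho>(3) unfolding W_def by blast
    then show "x \<in> face_prism" using x unfolding W_def face_prism_def by simp
  qed
  have "p + (1/2) *\<^sub>R ?n \<in> W"
    using unit_normal_props(2)[OF \<rho>(1)] \<rho>(2) unfolding W_def by (simp add: face_foot_def inner_add_right nn)
  then have "\<not> negligible W" using open_not_negligible[OF W] by blast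
  then have "\<not> negligible face_prism" using WF negligible_subset by blast
  then have m: "measure lebesgue face_prism \<noteq> 0"
    using face_prism_compact by (simp add: negligible_iff_measure lmeasurable_compact)
  have "face_integral F (\<lambda>_. c) = c * measure lebesgue face_prism"
    unfolding face_integral_prism using lmeasurable_compact[OF face_prism_compact]
    by (simp add: measure_restrict_space fmeasurableD)
  then show ?thesis using z m by simp
qed

end

text \<open>\<open>Lim\<close> returns the expected value only where the limit is nontrivial, which
  holds at every point of the closure of the open set.\<close>

lemma trace_from_affine:
  fixes T :: "'a::euclidean_space set"
  assumes v: "\<And>x. x \<in> interior T \<Longrightarrow> v x = inner a x + c" and x: "x \<in> closure (interior T)"
  shows "trace_from T v x = inner a x + c"
  unfolding trace_from_def
proof (rule tendsto_Lim)
  have "x islimpt interior T"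
  proof (cases "x \<in> interior T")
    case True then show ?thesis by (metis interior_interior interior_limit_point)
  next
    case False then show ?thesis using x by (simp add: closure_def)
  qed
  then show "\<not> trivial_limit (at x within interior T)" by (simp add: trivial_limit_within)
  have "((\<lambda>y. inner a y + c) \<longlongrightarrow> inner a x + c) (at x within interior T)" by (intro tendsto_intros)
  then show "(v \<longlongrightarrow> inner a x + c) (at x within interior T)"
    by (rule Lim_transform_within[where d=1]) (use v in auto)
qed

lemma grad_locally_affine:
  fixes v :: "'a::euclidean_space \<Rightarrow> real"
  assumes "open W" "x \<in> W" "\<And>y. y \<in> W \<Longrightarrow> v y = inner a y + c"
  shows "grad v x = a" "isCont v x"
proof -
  have "((\<lambda>y. inner a y + c) has_derivative (\<lambda>h. inner h a)) (at x)"
    by (auto intro!: derivative_eq_intros simp: inner_commute)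
  then have d: "(v has_derivative (\<lambda>h. inner h a)) (at x)"
    by (rule has_derivative_transform_within_open[OF _ assms(1,2)]) (use assms(3) in simp)
  show "grad v x = a" by (rule grad_eqI[OF d])
  show "isCont v x" using d by (rule has_derivative_continuous)
qed

text \<open>A total choice of gradient and constant term. On a mesh element the coefficients are
  unique, because the interior is nonempty, and so depend linearly on \<open>v\<close>.\<close>

definition affine_coeffs :: "'a::euclidean_space set \<Rightarrow> ('a \<Rightarrow> real) \<Rightarrow> 'a \<times> real" where
  "affine_coeffs T v = (SOME p. \<forall>x\<in>interior T. v x = inner (fst p) x + snd p)"

definition "slope T v = fst (affine_coeffs T v)"
definition "offset T v = snd (affine_coeffs T v)"

context mesh begin

lemma pw_affine_eq:
  assumes "v \<in> pw_affine_space \<T>" "T \<in> \<T>" "x \<in> interior T"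
  shows "v x = inner (slope T v) x + offset T v"
proof -
  have "\<exists>p. \<forall>x\<in>interior T. v x = inner (fst p) x + snd p"
    using assms unfolding pw_affine_space_def by auto
  from someI_ex[OF this] show ?thesis using assms(3) unfolding slope_def offset_def affine_coeffs_def by blast
qed

lemma pw_affine_outside: "v \<in> pw_affine_space \<T> \<Longrightarrow> x \<notin> (\<Union>T\<in>\<T>. interior T) \<Longrightarrow> v x = 0"
  unfolding pw_affine_space_def by blast

lemma affine_coeffs_unique:
  assumes T: "T \<in> \<T>" and v: "\<And>x. x \<in> interior T \<Longrightarrow> v x = inner a x + c"
  shows "slope T v = a" "offset T v = c"
proof -
  have "\<forall>x\<in>interior T. v x = inner (fst (a, c)) x + snd (a, c)" unfolding fst_conv snd_conv using v by blast
  then have "\<exists>p. \<forall>x\<in>interior T. v x = inner (fst p) x + snd p"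
    by (rule exI[of "\<lambda>p. \<forall>x\<in>interior T. v x = inner (fst p) x + snd p" "(a, c)"])
  from someI_ex[OF this] have 1: "\<And>x. x \<in> interior T \<Longrightarrow> v x = inner (slope T v) x + offset T v"
    unfolding slope_def offset_def affine_coeffs_def by blast
  obtain x where x: "x \<in> interior T" using element_interior_nonempty[OF T] by blast
  show s: "slope T v = a"
    using grad_locally_affine(1)[OF open_interior x 1] grad_locally_affine(1)[OF open_interior x v] by simp
  show "offset T v = c" using 1[OF x] v[OF x] s by simp
qed

lemma pw_affine_grad:
  assumes "v \<in> pw_affine_space \<T>" "T \<in> \<T>" "x \<in> interior T"
  shows "grad v x = slope T v" "isCont v x" "broken_grad \<T> v x = slope T v"
proof -
  show g: "grad v x = slope T v" "isCont v x"
    by (rule grad_locally_affine[OF open_interior assms(3) pw_affine_eq[OF assms(1,2)]], assumption)+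
  show "broken_grad \<T> v x = slope T v" using g assms unfolding broken_grad_def by auto
qed

lemma pw_affine_lincomb:
  assumes "v \<in> pw_affine_space \<T>" "w \<in> pw_affine_space \<T>"
  shows "(\<lambda>x. c * v x + w x) \<in> pw_affine_space \<T>"
    and "T \<in> \<T> \<Longrightarrow> slope T (\<lambda>x. c * v x + w x) = c *\<^sub>R slope T v + slope T w"
    and "T \<in> \<T> \<Longrightarrow> offset T (\<lambda>x. c * v x + w x) = c * offset T v + offset T w"
proof -
  have *: "c * v x + w x = inner (c *\<^sub>R slope T v + slope T w) x + (c * offset T v + offset T w)"
    if "T \<in> \<T>" "x \<in> interior T" for T x
    using pw_affine_eq[OF assms(1) that] pw_affine_eq[OF assms(2) that] by (simp add: inner_add_left algebra_simps)
  show "(\<lambda>x. c * v x + w x) \<in> pw_affine_space \<T>"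
    unfolding pw_affine_space_def mem_Collect_eq
  proof (intro conjI ballI allI impI)
    fix T assume "T \<in> \<T>"
    then show "\<exists>a k. \<forall>x\<in>interior T. c * v x + w x = inner a x + k" using * by blast
  next
    fix x assume "x \<notin> (\<Union>T\<in>\<T>. interior T)"
    then show "c * v x + w x = 0"
      using pw_affine_outside[OF assms(1), of x] pw_affine_outside[OF assms(2), of x] by simp
  qed
  show "slope T (\<lambda>x. c * v x + w x) = c *\<^sub>R slope T v + slope T w" if T: "T \<in> \<T>"
    by (rule affine_coeffs_unique(1)[OF T *[OF T]])
  show "offset T (\<lambda>x. c * v x + w x) = c * offset T v + offset T w" if T: "T \<in> \<T>"
    by (rule affine_coeffs_unique(2)[OF T *[OF T]])
qed

lemma facet_props:
  assumes "T \<in> \<T>" "F facet_of T"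
  shows "compact F" "aff_dim F = int DIM('a) - 1" "F \<noteq> {}" "convex F" "F \<subseteq> T"
proof -
  note f = facet_of_imp_face_of[OF assms(2)]
  show "compact F" by (rule face_of_imp_compact[OF element_convex[OF assms(1)] element_compact[OF assms(1)] f])
  show "aff_dim F = int DIM('a) - 1" by (rule facet_aff_dim[OF assms])
  show "F \<noteq> {}" using assms(2) by (simp add: facet_of_def)
  show "convex F" by (rule face_of_imp_convex[OF f])
  show "F \<subseteq> T" by (rule facet_of_imp_subset[OF assms(2)])
qed

lemma pw_affine_trace:
  assumes "v \<in> pw_affine_space \<T>" "T \<in> \<T>" "x \<in> T"
  shows "trace_from T v x = inner (slope T v) x + offset T v"
  by (rule trace_from_affine) (use pw_affine_eq[OF assms(1,2)] element_closure_interior[OF assms(2)] assms(3) in auto)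

lemma trace_continuous:
  assumes "v \<in> pw_affine_space \<T>" "T \<in> \<T>" "S \<subseteq> T"
  shows "continuous_on S (trace_from T v)"
proof -
  have "continuous_on S (\<lambda>x. inner (slope T v) x + offset T v)" by (intro continuous_intros)
  then show ?thesis
    by (rule continuous_on_eq) (use pw_affine_trace[OF assms(1,2)] assms(3) in auto)
qed

lemma trace_lincomb:
  assumes "v \<in> pw_affine_space \<T>" "w \<in> pw_affine_space \<T>" "T \<in> \<T>" "x \<in> T"
  shows "trace_from T (\<lambda>x. c * v x + w x) x = c * trace_from T v x + trace_from T w x"
  using pw_affine_trace[OF _ assms(3,4)] pw_affine_lincomb[OF assms(1,2)] assms
  by (simp add: inner_add_left algebra_simps)

lemma CR_pw_affine: "v \<in> CR_space \<T> \<Omega> \<Longrightarrow> v \<in> pw_affine_space \<T>"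
  by (simp add: CR_space_def)

lemma CR_jump:
  "v \<in> CR_space \<T> \<Omega> \<Longrightarrow> T \<in> \<T> \<Longrightarrow> T' \<in> \<T> \<Longrightarrow> T \<noteq> T' \<Longrightarrow> F facet_of T \<Longrightarrow> F facet_of T' \<Longrightarrow>
     face_integral F (\<lambda>x. trace_from T v x - trace_from T' v x) = 0"
  "v \<in> CR_space \<T> \<Omega> \<Longrightarrow> T \<in> \<T> \<Longrightarrow> F facet_of T \<Longrightarrow> F \<subseteq> frontier \<Omega> \<Longrightarrow> face_integral F (trace_from T v) = 0"
  unfolding CR_space_def by blast+

lemma CR_lincomb:
  assumes v: "v \<in> CR_space \<T> \<Omega>" and w: "w \<in> CR_space \<T> \<Omega>"
  shows "(\<lambda>x. c * v x + w x) \<in> CR_space \<T> \<Omega>"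
proof -
  note pv = CR_pw_affine[OF v] and pw = CR_pw_affine[OF w]
  show ?thesis unfolding CR_space_def mem_Collect_eq
  proof (intro conjI ballI allI impI)
    show "(\<lambda>x. c * v x + w x) \<in> pw_affine_space \<T>" by (rule pw_affine_lincomb[OF pv pw])
  next
    fix T T' F assume T: "T \<in> \<T>" "T' \<in> \<T>" and F': "T \<noteq> T' \<and> F facet_of T \<and> F facet_of T'"
    then have F: "T \<noteq> T'" "F facet_of T" "F facet_of T'" by blast+
    note f = facet_props[OF T(1) F(2)] and f' = facet_props[OF T(2) F(3)]
    have "face_integral F (\<lambda>x. trace_from T (\<lambda>x. c * v x + w x) x - trace_from T' (\<lambda>x. c * v x + w x) x)
      = face_integral F (\<lambda>x. c * (trace_from T v x - trace_from T' v x) + (trace_from T w x - trace_from T' w x))"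
    proof (rule face_integral_cong)
      fix x assume "x \<in> F"
      then have "x \<in> T" "x \<in> T'" using f(5) f'(5) by blast+
      then show "trace_from T (\<lambda>x. c * v x + w x) x - trace_from T' (\<lambda>x. c * v x + w x) x
        = c * (trace_from T v x - trace_from T' v x) + (trace_from T w x - trace_from T' w x)"
        unfolding trace_lincomb[OF pv pw T(1) \<open>x \<in> T\<close>] trace_lincomb[OF pv pw T(2) \<open>x \<in> T'\<close>]
        by (simp add: algebra_simps)
    qed
    also have "\<dots> = c * face_integral F (\<lambda>x. trace_from T v x - trace_from T' v x) + face_integral F (\<lambda>x. trace_from T w x - trace_from T' w x)"
      by (rule face_integral_lincomb[OF f(1-3)]) (intro continuous_on_diff trace_continuous pv pw T f(5) f'(5))+
    finally show "face_integral F (\<lambda>x. trace_from T (\<lambda>x. c * v x + w x) x - trace_from T' (\<lambda>x. c * v x + w x) x) = 0"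
      by (simp only: CR_jump(1)[OF v T F] CR_jump(1)[OF w T F] mult_zero_right add_0)
  next
    fix T F assume T: "T \<in> \<T>" and F': "F facet_of T \<and> F \<subseteq> frontier \<Omega>"
    then have F: "F facet_of T" "F \<subseteq> frontier \<Omega>" by blast+
    note f = facet_props[OF T F(1)]
    have "face_integral F (trace_from T (\<lambda>x. c * v x + w x)) = face_integral F (\<lambda>x. c * trace_from T v x + trace_from T w x)"
    proof (rule face_integral_cong)
      fix x assume "x \<in> F"
      then have "x \<in> T" using f(5) by blast
      then show "trace_from T (\<lambda>x. c * v x + w x) x = c * trace_from T v x + trace_from T w x"
        by (rule trace_lincomb[OF pv pw T])
    qed
    also have "\<dots> = c * face_integral F (trace_from T v) + face_integral F (trace_from T w)"
      by (rule face_integral_lincomb[OF f(1-3)]) (intro trace_continuous pv pw T f(5))+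
    finally show "face_integral F (trace_from T (\<lambda>x. c * v x + w x)) = 0"
      by (simp only: CR_jump(2)[OF v T F] CR_jump(2)[OF w T F] mult_zero_right add_0)
  qed
qed

text \<open>With zero slopes the traces are constants, so a vanishing face integral says that the
  constants agree across a shared facet and are zero at a boundary facet.\<close>

lemma CR_definite:
  assumes v: "v \<in> CR_space \<T> \<Omega>" and s: "\<And>T. T \<in> \<T> \<Longrightarrow> slope T v = 0"
  shows "v = (\<lambda>_. 0)"
proof -
  note pv = CR_pw_affine[OF v]
  have tr: "trace_from T v x = offset T v" if "T \<in> \<T>" "x \<in> T" for T x
    using pw_affine_trace[OF pv that] s[OF that(1)] by simp
  have off: "offset T v = 0" if T: "T \<in> \<T>" for T
  proof (rule piecewise_constant_zero[OF _ _ T])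
    fix T T' F assume T: "T \<in> \<T>" "T' \<in> \<T>" "T \<noteq> T'" "F facet_of T" "F facet_of T'"
    note f = facet_props[OF T(1,4)] and f' = facet_props[OF T(2,5)]
    have "face_integral F (\<lambda>x. offset T v - offset T' v) = face_integral F (\<lambda>x. trace_from T v x - trace_from T' v x)"
    proof (rule face_integral_cong)
      fix x assume "x \<in> F"
      then have "x \<in> T" "x \<in> T'" using f(5) f'(5) by blast+
      then show "offset T v - offset T' v = trace_from T v x - trace_from T' v x"
        by (simp only: tr[OF T(1)] tr[OF T(2)])
    qed
    also have "\<dots> = 0" by (rule CR_jump(1)[OF v T])
    finally have "offset T v - offset T' v = 0" by (rule face_integral_const_eq_0[OF f(1-3) f(4)])
    then show "offset T v = offset T' v" by simp
  next
    fix T F assume T: "T \<in> \<T>" "F facet_of T" "F \<subseteq> frontier \<Omega>"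
    note f = facet_props[OF T(1,2)]
    have "face_integral F (\<lambda>x. offset T v) = face_integral F (trace_from T v)"
    proof (rule face_integral_cong)
      fix x assume "x \<in> F"
      then have "x \<in> T" using f(5) by blast
      then show "offset T v = trace_from T v x" by (simp only: tr[OF T(1)])
    qed
    also have "\<dots> = 0" by (rule CR_jump(2)[OF v T])
    finally show "offset T v = 0" by (rule face_integral_const_eq_0[OF f(1-3) f(4)])
  qed
  show ?thesis
  proof
    fix x show "v x = 0"
    proof (cases "\<exists>T\<in>\<T>. x \<in> interior T")
      case True
      then obtain T where "T \<in> \<T>" "x \<in> interior T" by blast
      then show ?thesis using pw_affine_eq[OF pv] s off by simp
    next
      case False then show ?thesis using pw_affine_outside[OF pv] by blast
    qed
  qed
qed

end


section \<open>The centroid of a simplex\<close>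

text \<open>Uniqueness of Haar measure by Fubini: \<open>\<integral>f d\<lambda> \<integral>g d\<nu> = \<integral>f d\<nu> \<integral>g(-x) d\<lambda>\<close> for translation invariant
  \<open>\<lambda>\<close>, \<open>\<nu>\<close>; here \<open>\<nu>\<close> is the image of Lebesgue measure under \<open>\<tau>\<close>. (The change of variables formulas of
  HOL-Analysis need a well-ordered index type.)\<close>

lemma affine_involution_nn_integral:
  fixes L :: "'a::euclidean_space \<Rightarrow> 'a"
  assumes L: "linear L" and \<tau>: "\<tau> = (\<lambda>x. L x + c)" and inv: "\<And>x. \<tau> (\<tau> x) = x"
    and f: "f \<in> borel_measurable borel" and g: "g \<in> borel_measurable borel"
  shows "(\<integral>\<^sup>+x. f x \<partial>lborel) * (\<integral>\<^sup>+y. g (\<tau> y) \<partial>lborel) = (\<integral>\<^sup>+x. f (\<tau> x) \<partial>lborel) * (\<integral>\<^sup>+y. g (- y) \<partial>lborel)"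
proof -
  have cL: "continuous_on UNIV L" using L linear_continuous_on linear_conv_bounded_linear by blast
  have mt [measurable]: "\<tau> \<in> borel_measurable borel"
    unfolding \<tau> by (intro borel_measurable_continuous_onI continuous_intros cL)
  note [measurable] = f g
  have tr: "(\<integral>\<^sup>+x. h (x + y) \<partial>lborel) = (\<integral>\<^sup>+x. h x \<partial>lborel)" if [measurable]: "h \<in> borel_measurable borel" for h y
  proof -
    have "(\<integral>\<^sup>+x. h x \<partial>lborel) = (\<integral>\<^sup>+x. h x \<partial>distr lborel borel ((+) y))" by (simp only: lborel_distr_plus)
    also have "\<dots> = (\<integral>\<^sup>+x. h (y + x) \<partial>lborel)" by (rule nn_integral_distr) auto
    finally show ?thesis by (simp add: add.commute)
  qed
  have LL: "L (L x) = x" for x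
  proof -
    have "\<tau> (\<tau> x) - \<tau> (\<tau> 0) = L (L x)" unfolding \<tau> by (simp add: linear_add[OF L] linear_0[OF L])
    then show ?thesis by (simp add: inv)
  qed
  have shift: "\<tau> (y + L x) = \<tau> y + x" for x y unfolding \<tau> by (simp add: linear_add[OF L] LL algebra_simps)
  have "(\<integral>\<^sup>+x. f x \<partial>lborel) * (\<integral>\<^sup>+y. g (\<tau> y) \<partial>lborel) = (\<integral>\<^sup>+y. (\<integral>\<^sup>+x. f x \<partial>lborel) * g (\<tau> y) \<partial>lborel)"
    by (simp add: nn_integral_cmult)
  also have "\<dots> = (\<integral>\<^sup>+y. (\<integral>\<^sup>+x. f (x + \<tau> y) * g (\<tau> y) \<partial>lborel) \<partial>lborel)"
  proof (rule nn_integral_cong)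
    fix y
    have "(\<integral>\<^sup>+x. f (x + \<tau> y) * g (\<tau> y) \<partial>lborel) = (\<integral>\<^sup>+x. f (x + \<tau> y) \<partial>lborel) * g (\<tau> y)"
      by (rule nn_integral_multc) measurable
    then show "(\<integral>\<^sup>+x. f x \<partial>lborel) * g (\<tau> y) = (\<integral>\<^sup>+x. f (x + \<tau> y) * g (\<tau> y) \<partial>lborel)" by (simp add: tr)
  qed
  also have "\<dots> = (\<integral>\<^sup>+x. (\<integral>\<^sup>+y. f (x + \<tau> y) * g (\<tau> y) \<partial>lborel) \<partial>lborel)"
    by (rule lborel_pair.Fubini') measurable
  also have "\<dots> = (\<integral>\<^sup>+x. (\<integral>\<^sup>+y. f (\<tau> y) * g (\<tau> y - x) \<partial>lborel) \<partial>lborel)"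
  proof (rule nn_integral_cong)
    fix x
    have "(\<integral>\<^sup>+y. f (x + \<tau> y) * g (\<tau> y) \<partial>lborel) = (\<integral>\<^sup>+y. f (\<tau> (y + L x)) * g (\<tau> (y + L x) - x) \<partial>lborel)"
      by (simp add: shift add.commute)
    also have "\<dots> = (\<integral>\<^sup>+y. f (\<tau> y) * g (\<tau> y - x) \<partial>lborel)"
      by (rule tr[of "\<lambda>y. f (\<tau> y) * g (\<tau> y - x)"]) measurable
    finally show "(\<integral>\<^sup>+y. f (x + \<tau> y) * g (\<tau> y) \<partial>lborel) = (\<integral>\<^sup>+y. f (\<tau> y) * g (\<tau> y - x) \<partial>lborel)" .
  qed
  also have "\<dots> = (\<integral>\<^sup>+y. (\<integral>\<^sup>+x. f (\<tau> y) * g (\<tau> y - x) \<partial>lborel) \<partial>lborel)"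
    by (rule lborel_pair.Fubini'[symmetric]) measurable
  also have "\<dots> = (\<integral>\<^sup>+y. f (\<tau> y) * (\<integral>\<^sup>+x. g (- x) \<partial>lborel) \<partial>lborel)"
  proof (rule nn_integral_cong)
    fix y
    have "(\<integral>\<^sup>+x. f (\<tau> y) * g (\<tau> y - x) \<partial>lborel) = f (\<tau> y) * (\<integral>\<^sup>+x. g (\<tau> y - x) \<partial>lborel)"
      by (rule nn_integral_cmult) measurable
    also have "(\<integral>\<^sup>+x. g (\<tau> y - x) \<partial>lborel) = (\<integral>\<^sup>+x. g (- (x + - \<tau> y)) \<partial>lborel)" by simp
    also have "\<dots> = (\<integral>\<^sup>+x. g (- x) \<partial>lborel)" by (rule tr[of "\<lambda>x. g (- x)"]) measurable
    finally show "(\<integral>\<^sup>+x. f (\<tau> y) * g (\<tau> y - x) \<partial>lborel) = f (\<tau> y) * (\<integral>\<^sup>+x. g (- x) \<partial>lborel)" .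
  qed
  also have "\<dots> = (\<integral>\<^sup>+x. f (\<tau> x) \<partial>lborel) * (\<integral>\<^sup>+y. g (- y) \<partial>lborel)"
    by (rule nn_integral_multc) measurable
  finally show ?thesis .
qed

text \<open>The image measure is a constant multiple of Lebesgue measure. The constant is 1, because
  \<open>T\<close> is invariant and has positive finite measure; no determinant enters.\<close>

lemma affine_involution_distr:
  fixes L :: "'a::euclidean_space \<Rightarrow> 'a"
  assumes L: "linear L" and \<tau>: "\<tau> = (\<lambda>x. L x + c)" and inv: "\<And>x. \<tau> (\<tau> x) = x"
    and T: "compact T" "interior T \<noteq> {}" "\<tau> ` T = T"
  shows "distr lborel borel \<tau> = lborel"
proof -
  have cL: "continuous_on UNIV L" using L linear_continuous_on linear_conv_bounded_linear by blast
  have mt: "\<tau> \<in> borel_measurable borel"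
    unfolding \<tau> by (intro borel_measurable_continuous_onI continuous_intros cL)
  have mem: "\<tau> x \<in> T \<longleftrightarrow> x \<in> T" for x using T(3) inv by (metis image_iff)
  have Tb: "T \<in> sets borel" using compact_imp_closed[OF T(1)] by (rule borel_closed)
  \<comment> \<open>The reference function for the uniqueness argument: the unit ball is symmetric
    under negation and has positive finite measure, so it can be cancelled.\<close>
  let ?B = "indicator (ball 0 1) :: 'a \<Rightarrow> ennreal"
  let ?b = "emeasure lborel (ball (0::'a) 1)"
  define A where "A = (\<integral>\<^sup>+y. ?B (\<tau> y) \<partial>lborel)"
  have sym: "(\<integral>\<^sup>+y. ?B (- y) \<partial>lborel) = ?b"
  proof -
    have "(\<lambda>y. ?B (- y)) = ?B" by (simp add: fun_eq_iff indicator_def)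
    then show ?thesis by simp
  qed
  have mB: "?B \<in> borel_measurable borel" by (intro borel_measurable_indicator) simp
  have key: "(\<integral>\<^sup>+x. f x \<partial>lborel) * A = (\<integral>\<^sup>+x. f (\<tau> x) \<partial>lborel) * ?b" if "f \<in> borel_measurable borel" for f
    using affine_involution_nn_integral[OF L \<tau> inv that mB] unfolding A_def sym .
  have bb: "?b \<noteq> 0" "?b \<noteq> \<infinity>"
  proof -
    have "0 < measure lborel (ball (0::'a) 1)" by (rule content_ball_pos) simp
    then show "?b \<noteq> 0" by (auto simp: measure_def)
    show "?b \<noteq> \<infinity>" using emeasure_bounded_finite[OF bounded_ball, of 0 1] by (simp add: less_top)
  qed
  have "emeasure lborel T * A = emeasure lborel T * ?b"
  proof -
    have "(\<lambda>x. indicator T (\<tau> x)) = (indicator T :: 'a \<Rightarrow> ennreal)" by (simp add: fun_eq_iff indicator_def mem)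
    then show ?thesis using key[of "indicator T"] Tb by simp
  qed
  moreover have "emeasure lborel T \<noteq> \<infinity>"
    using emeasure_bounded_finite[OF compact_imp_bounded[OF T(1)]] by (simp add: less_top)
  moreover have "emeasure lborel T \<noteq> 0"
  proof
    assume "emeasure lborel T = 0"
    then have "T \<in> null_sets lborel" using Tb by auto
    then have "negligible T" by (simp add: negligible_iff_null_sets null_sets_completionI)
    then show False using T(2) open_not_negligible[OF open_interior] negligible_subset[OF _ interior_subset] by blast
  qed
  ultimately have A: "A = ?b" by (simp add: ennreal_mult_cancel_left)
  show ?thesis
  proof (rule measure_eqI)
    fix E assume "E \<in> sets (distr lborel borel \<tau>)"
    then have E: "E \<in> sets borel" by simp
    have "(\<integral>\<^sup>+x. indicator E (\<tau> x) \<partial>lborel) * ?b = emeasure lborel E * ?b"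
      using key[of "indicator E"] E A by simp
    then have e: "(\<integral>\<^sup>+x. indicator E (\<tau> x) \<partial>lborel) = emeasure lborel E"
      using bb by (simp add: mult.commute[of _ ?b] ennreal_mult_cancel_left)
    have "emeasure (distr lborel borel \<tau>) E = (\<integral>\<^sup>+x. indicator E x \<partial>distr lborel borel \<tau>)" using E by simp
    also have "\<dots> = (\<integral>\<^sup>+x. indicator E (\<tau> x) \<partial>lborel)" by (rule nn_integral_distr) (use mt E in auto)
    finally show "emeasure (distr lborel borel \<tau>) E = emeasure lborel E" by (simp add: e)
  qed simp
qed

lemma barycentre_simplex:
  fixes C :: "'a::euclidean_space set"
  assumes "\<not> affine_dependent C"
  shows "barycentre (convex hull C) = (\<Sum>v\<in>C. v) /\<^sub>R (real DIM('a) + 1)"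
  using extreme_point_of_convex_hull_affine_independent[OF assms] by (simp add: barycentre_def)

text \<open>\<open>h + k\<close> is the barycentric coordinate at \<open>p\<close> minus the one at
  \<open>q\<close>. It is built from the independent edge vectors \<open>v - q\<close> by
  prescribing 2 on \<open>p - q\<close> and 1 on all others; \<open>k\<close> then shifts the value
  at \<open>q\<close> to -1.\<close>

lemma simplex_swap_functional:
  fixes C :: "'a::euclidean_space set"
  assumes ind: "\<not> affine_dependent C" and p: "p \<in> C" and q: "q \<in> C" "p \<noteq> q"
  obtains h k where "linear h" "h p + k = (1::real)" "h q + k = -1" "\<And>v. v \<in> C - {p, q} \<Longrightarrow> h v + k = 0"
proof -
  have "independent ((\<lambda>x. x - q) ` (C - {q}))"
    using ind q(1) by (simp add: affine_dependent_iff_dependent2 dependent_def)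
  from linear_independent_extend[OF this, of "\<lambda>z. if z = p - q then 2 else 1 :: real"]
  obtain h where h0: "linear h" "\<forall>z \<in> (\<lambda>x. x - q) ` (C - {q}). h z = (if z = p - q then 2 else 1 :: real)" by blast
  note h = h0(1) h0(2)[rule_format]
  have hv: "h v - h q = (if v = p then 2 else 1)" if "v \<in> C - {q}" for v
    using h(2)[of "v - q"] that by (auto simp: linear_diff[OF h(1)])
  show thesis
  proof (rule that[OF h(1), of "- h q - 1"])
    show "h p + (- h q - 1) = 1" using hv[of p] p q by simp
    show "h v + (- h q - 1) = 0" if "v \<in> C - {p, q}" for v using hv[of v] that by simp
  qed simp
qed

text \<open>For vertices \<open>p\<close>, \<open>q\<close> the oblique reflection that swaps them and fixes the other vertices maps \<open>T\<close> to
  itself, so the mean point of \<open>T\<close> has equal barycentric coordinates at \<open>p\<close> and \<open>q\<close>.\<close>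

lemma simplex_centroid:
  fixes C :: "'a::euclidean_space set"
  assumes ind: "\<not> affine_dependent C" and card: "card C = DIM('a) + 1" and T: "T = convex hull C"
  shows "integral\<^sup>L lborel (\<lambda>x. indicator T x *\<^sub>R (x - barycentre T)) = 0"
proof -
  have fC: "finite C" using card card.infinite by fastforce
  have cT: "compact T" unfolding T by (rule compact_convex_hull[OF finite_imp_compact[OF fC]])
  have aff: "affine hull C = UNIV"
    using aff_dim_affine_independent[OF ind] card aff_dim_eq_full[of C] by simp
  then have hullT: "affine hull T = UNIV" by (simp add: T)
  have intT: "interior T \<noteq> {}"
  proof -
    have "T \<noteq> {}" using hullT by auto
    then have "rel_interior T \<noteq> {}" using rel_interior_eq_empty[of T] by (simp add: T)
    then show ?thesis using rel_interior_interior[OF hullT] by simp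
  qed
  define \<mu> where "\<mu> = measure lborel T"
  define M where "M = integral\<^sup>L lborel (\<lambda>x. indicator T x *\<^sub>R x)"
  have Tb: "T \<in> sets borel" using compact_imp_closed[OF cT] by (rule borel_closed)
  have i: "integrable lborel (\<lambda>x. indicator T x *\<^sub>R f x)" if "continuous_on UNIV f" for f :: "'a \<Rightarrow> 'b::euclidean_space"
    by (rule borel_integrable_compact[OF cT]) (rule continuous_on_subset[OF that], simp)
  have ic: "integral\<^sup>L lborel (\<lambda>x. indicator T x *\<^sub>R z) = \<mu> *\<^sub>R z" for z :: "'b::euclidean_space"
    using emeasure_bounded_finite[OF compact_imp_bounded[OF cT]] Tb by (simp add: \<mu>_def)
  have \<mu>0: "\<mu> > 0"
  proof -
    have "\<not> negligible T" using intT open_not_negligible[OF open_interior] negligible_subset[OF _ interior_subset] by blast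
    then have "measure lebesgue T \<noteq> 0" using lmeasurable_compact[OF cT] by (simp add: negligible_iff_measure)
    then show ?thesis using Tb by (simp add: \<mu>_def less_le)
  qed
  define m where "m = M /\<^sub>R \<mu>"
  have balance: "h m + k = 0"
    if pq: "p \<in> C" "q \<in> C" "p \<noteq> q" and h: "linear h" "h p + k = (1::real)" "h q + k = -1" "\<And>v. v \<in> C - {p, q} \<Longrightarrow> h v + k = 0"
    for p q h k
  proof -
    let ?w = "p - q"
    \<comment> \<open>Linear part of the oblique reflection along \<open>p - q\<close> in the
      hyperplane \<open>h x + k = 0\<close>. As \<open>h\<close> is 2 on \<open>p - q\<close>, the
      reflection reverses the sign of \<open>h + k\<close> and is an involution.\<close>
    define L where "L = (\<lambda>x. x - h x *\<^sub>R ?w)"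
    define c where "c = - k *\<^sub>R ?w"
    define \<tau> where "\<tau> = (\<lambda>x. L x + c)"
    have \<tau>_eq: "\<tau> x = x - (h x + k) *\<^sub>R ?w" for x by (simp add: \<tau>_def L_def c_def algebra_simps)
    have hw: "h ?w = 2" using h(2,3) by (simp add: linear_diff[OF h(1)])
    have L: "linear L" unfolding L_def
      by (intro linear_compose_sub linear_ident linearI) (simp_all add: linear_add[OF h(1)] linear_cmul[OF h(1)] algebra_simps)
    have h\<tau>: "h (\<tau> x) + k = - (h x + k)" for x
    proof -
      have "h (\<tau> x) = h x - (h x + k) * h ?w" by (simp only: \<tau>_eq linear_diff[OF h(1)] linear_cmul[OF h(1)] real_scaleR_def)
      then show ?thesis by (simp add: hw)
    qed
    have inv: "\<tau> (\<tau> x) = x" for x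
    proof -
      have "\<tau> (\<tau> x) = \<tau> x - (h (\<tau> x) + k) *\<^sub>R ?w" by (rule \<tau>_eq)
      also have "\<dots> = \<tau> x + (h x + k) *\<^sub>R ?w" unfolding h\<tau> by (simp only: scaleR_minus_left diff_minus_eq_add)
      also have "\<dots> = x" by (simp add: \<tau>_eq)
      finally show ?thesis .
    qed
    have \<tau>C: "\<tau> ` C = C"
    proof -
      have "\<tau> p = q" "\<tau> q = p" using h(2,3) by (simp_all add: \<tau>_eq)
      moreover have "\<tau> v = v" if "v \<in> C - {p, q}" for v using h(4)[OF that] by (simp add: \<tau>_eq)
      ultimately have "\<tau> ` C \<subseteq> C" using pq by (metis DiffI image_subsetI insert_iff singletonD)
      then show ?thesis using inv by (metis image_iff subsetI subset_antisym subset_iff)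
    qed
    have \<tau>T: "\<tau> ` T = T"
    proof -
      have "\<tau> ` T = (\<lambda>x. c + x) ` (L ` (convex hull C))" unfolding T \<tau>_def by (auto simp: image_image add.commute)
      also have "\<dots> = convex hull ((\<lambda>x. c + x) ` (L ` C))"
        by (simp only: convex_hull_linear_image[OF L] convex_hull_translation)
      also have "(\<lambda>x. c + x) ` (L ` C) = \<tau> ` C" unfolding \<tau>_def by (auto simp: image_image add.commute)
      finally show ?thesis by (simp add: \<tau>C T)
    qed
    have mem: "\<tau> x \<in> T \<longleftrightarrow> x \<in> T" for x using \<tau>T inv by (metis image_iff)
    have d: "distr lborel borel \<tau> = lborel" by (rule affine_involution_distr[OF L \<tau>_def inv cT intT \<tau>T])
    have ch: "continuous_on UNIV h" using h(1) linear_continuous_on linear_conv_bounded_linear by blast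
    have mt: "\<tau> \<in> borel_measurable lborel"
      unfolding measurable_lborel2 measurable_lborel1 \<tau>_eq[abs_def] by (intro borel_measurable_continuous_onI continuous_intros ch)
    \<comment> \<open>\<open>?g\<close> is odd under the measure-preserving \<open>\<tau>\<close>,
      so its integral vanishes; that integral is \<open>\<mu>\<close> times the value of
      \<open>h + k\<close> at the mean point \<open>m\<close>.\<close>
    let ?g = "\<lambda>x. indicator T x *\<^sub>R (h x + k)"
    have gb: "?g \<in> borel_measurable borel"
      using borel_measurable_integrable[OF i[of "\<lambda>x. h x + k"]] by (simp add: continuous_intros ch)
    have "integral\<^sup>L lborel ?g = integral\<^sup>L (distr lborel borel \<tau>) ?g" by (simp only: d)
    also have "\<dots> = integral\<^sup>L lborel (\<lambda>x. ?g (\<tau> x))" by (rule integral_distr) (use mt gb in auto)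
    also have "\<dots> = integral\<^sup>L lborel (\<lambda>x. - ?g x)"
    proof (rule Bochner_Integration.integral_cong[OF refl])
      fix x
      show "?g (\<tau> x) = - ?g x" unfolding h\<tau> by (simp add: indicator_def mem)
    qed
    also have "\<dots> = - integral\<^sup>L lborel ?g" by simp
    finally have "integral\<^sup>L lborel ?g = 0" by simp
    moreover have "integral\<^sup>L lborel ?g = h M + \<mu> * k"
    proof -
      have bl: "bounded_linear h" using h(1) by (simp add: linear_conv_bounded_linear)
      have "h M = integral\<^sup>L lborel (\<lambda>x. h (indicator T x *\<^sub>R x))"
        unfolding M_def by (rule integral_bounded_linear[OF bl i, symmetric]) (rule continuous_on_id)
      then have "h M = integral\<^sup>L lborel (\<lambda>x. indicator T x *\<^sub>R h x)" by (simp add: linear_cmul[OF h(1)])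
      moreover have "integral\<^sup>L lborel (\<lambda>x. indicator T x *\<^sub>R k) = \<mu> * k" using ic[of k] by simp
      moreover have "integral\<^sup>L lborel ?g = integral\<^sup>L lborel (\<lambda>x. indicator T x *\<^sub>R h x) + integral\<^sup>L lborel (\<lambda>x. indicator T x *\<^sub>R k)"
        unfolding scaleR_add_right by (rule Bochner_Integration.integral_add[OF i[OF ch] i]) (rule continuous_on_const)
      ultimately show ?thesis by simp
    qed
    ultimately have "h M + \<mu> * k = 0" by simp
    moreover have "h m = h M / \<mu>" by (simp add: m_def linear_cmul[OF h(1)] divide_inverse mult.commute)
    ultimately have "\<mu> * (h m + k) = 0" using \<mu>0 by (simp add: distrib_left)
    then show ?thesis using \<mu>0 by simp
  qed
  have "m \<in> affine hull C" by (simp add: aff)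
  \<comment> \<open>Barycentric coordinates of the mean point. By the swap functionals any two of
    them agree, so all equal \<open>1 / (real DIM('a) + 1)\<close>.\<close>
  then obtain u where u: "sum u C = 1" "(\<Sum>v\<in>C. u v *\<^sub>R v) = m" using affine_hull_finite[OF fC] by auto
  have eq: "u p = u q" if pq: "p \<in> C" "q \<in> C" "p \<noteq> q" for p q
  proof -
    obtain h k where h: "linear h" "h p + k = (1::real)" "h q + k = -1" "\<And>v. v \<in> C - {p, q} \<Longrightarrow> h v + k = 0"
      using simplex_swap_functional[OF ind pq] by blast
    have "0 = h m + k" using balance[OF pq h] by simp
    also have "\<dots> = (\<Sum>v\<in>C. u v * h v) + (\<Sum>v\<in>C. u v) * k"
      by (simp add: u(2)[symmetric] u(1) linear_sum[OF h(1)] linear_cmul[OF h(1)])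
    also have "\<dots> = (\<Sum>v\<in>C. u v * (h v + k))" by (simp add: sum.distrib distrib_left sum_distrib_right)
    also have "\<dots> = (\<Sum>v\<in>{p, q}. u v * (h v + k))"
      by (rule sum.mono_neutral_right) (use fC pq h(4) in auto)
    also have "\<dots> = u p - u q" using pq h(2,3) by simp
    finally show ?thesis by simp
  qed
  obtain q where q: "q \<in> C" using card by fastforce
  have uq: "u v = u q" if "v \<in> C" for v using eq[OF that q] by (cases "v = q") auto
  have "sum u C = (real DIM('a) + 1) * u q" using uq card by (simp add: algebra_simps)
  then have "u q = 1 / (real DIM('a) + 1)" using u(1) by (simp add: field_simps)
  then have "m = barycentre T"
    unfolding T barycentre_simplex[OF ind] u(2)[symmetric]
    by (simp add: uq scaleR_sum_right divide_inverse)
  moreover have "M = \<mu> *\<^sub>R m" using \<mu>0 by (simp add: m_def)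
  ultimately have "M = \<mu> *\<^sub>R barycentre T" by (simp only:)
  moreover have "integral\<^sup>L lborel (\<lambda>x. indicator T x *\<^sub>R (x - barycentre T)) = M - \<mu> *\<^sub>R barycentre T"
    unfolding scaleR_diff_right M_def
    by (subst Bochner_Integration.integral_diff[OF i i]) (use ic in \<open>auto intro: continuous_intros\<close>)
  ultimately show ?thesis by simp
qed


section \<open>Conforming functions are Crouzeix--Raviart functions\<close>

context mesh begin

definition skeleton where "skeleton = \<Omega> - (\<Union>T\<in>\<T>. interior T)"

lemma domain_lebesgue: "\<Omega> \<in> sets lebesgue" using open_domain by simp

lemma skeleton_negligible: "negligible skeleton"
proof -
  have "skeleton \<subseteq> (\<Union>T\<in>\<T>. frontier T)"
  proof
    fix x assume x: "x \<in> skeleton"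
    then have "x \<in> closure \<Omega>" unfolding skeleton_def using closure_subset[of \<Omega>] by blast
    then obtain T where T: "T \<in> \<T>" "x \<in> T" using Union_mesh by blast
    then have "x \<in> frontier T" using x closure_subset[of T] unfolding skeleton_def frontier_def by blast
    then show "x \<in> (\<Union>T\<in>\<T>. frontier T)" using T(1) by blast
  qed
  moreover have "negligible (\<Union>T\<in>\<T>. frontier T)"
    by (rule negligible_Union) (use finite_mesh negligible_convex_frontier element_convex in auto)
  ultimately show ?thesis by (rule negligible_subset[rotated])
qed

text \<open>The open elements exhaust the domain up to the skeleton, a null set, so
  almost-everywhere statements may be checked element by element.\<close>

lemma AE_mesh:
  assumes "\<And>T. T \<in> \<T> \<Longrightarrow> AE x in lebesgue. x \<in> interior T \<longrightarrow> Q x"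
  shows "AE x in lebesgue_on \<Omega>. Q x"
proof -
  have "AE x in lebesgue. \<forall>T\<in>\<T>. x \<in> interior T \<longrightarrow> Q x"
    by (rule AE_finite_allI[OF finite_mesh]) (rule assms)
  moreover have "AE x in lebesgue. x \<notin> skeleton"
    using skeleton_negligible by (simp add: negligible_iff_null_sets AE_not_in)
  ultimately have "AE x in lebesgue. x \<in> \<Omega> \<longrightarrow> Q x"
  proof eventually_elim
    case (elim x)
    show ?case
    proof
      assume "x \<in> \<Omega>"
      then obtain T where "T \<in> \<T>" "x \<in> interior T" using elim(2) unfolding skeleton_def by blast
      then show "Q x" using elim(1) by blast
    qed
  qed
  then show ?thesis using domain_lebesgue by (simp add: AE_restrict_space_iff)
qed

text \<open>The shape in which \<open>marini_flux\<close> is given: pieces cut off by the indicators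
  of the open elements, hence zero on the skeleton and Borel measurable whenever the pieces
  are.\<close>

definition pw_sum :: "('a set \<Rightarrow> 'a \<Rightarrow> 'b::real_vector) \<Rightarrow> 'a \<Rightarrow> 'b" where
  "pw_sum h x = (\<Sum>T\<in>\<T>. indicator (interior T) x *\<^sub>R h T x)"

lemma pw_sum_inside:
  assumes "T \<in> \<T>" "x \<in> interior T" shows "pw_sum h x = h T x"
proof -
  have "pw_sum h x = (\<Sum>S\<in>{T}. indicator (interior S) x *\<^sub>R h S x)"
    unfolding pw_sum_def
  proof (rule sum.mono_neutral_right)
    show "\<forall>S\<in>\<T> - {T}. indicator (interior S) x *\<^sub>R h S x = 0"
    proof
      fix S assume S: "S \<in> \<T> - {T}"
      then have "x \<notin> interior S" using interior_disjoint[of T S] assms interior_subset[of S] by blast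
      then show "indicator (interior S) x *\<^sub>R h S x = 0" by simp
    qed
  qed (use finite_mesh assms in auto)
  then show ?thesis using assms(2) by simp
qed

lemma pw_sum_outside: "x \<notin> (\<Union>T\<in>\<T>. interior T) \<Longrightarrow> pw_sum h x = 0"
  unfolding pw_sum_def by (rule sum.neutral) auto

lemma pw_sum_borel:
  fixes h :: "'a set \<Rightarrow> 'a \<Rightarrow> 'b::euclidean_space"
  assumes "\<And>T. T \<in> \<T> \<Longrightarrow> h T \<in> borel_measurable borel"
  shows "pw_sum h \<in> borel_measurable borel"
  unfolding pw_sum_def[abs_def]
proof (rule borel_measurable_sum)
  fix T assume "T \<in> \<T>"
  then have "h T \<in> borel_measurable borel" by (rule assms)
  moreover have "(\<lambda>x. indicator (interior T) x :: real) \<in> borel_measurable borel"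
    by (intro borel_measurable_indicator) simp
  ultimately show "(\<lambda>x. indicator (interior T) x *\<^sub>R h T x) \<in> borel_measurable borel"
    by (rule borel_measurable_scaleR[rotated])
qed

lemma pw_affine_pw_sum:
  assumes v: "v \<in> pw_affine_space \<T>"
  shows "v = pw_sum (\<lambda>T x. inner (slope T v) x + offset T v)" and "broken_grad \<T> v = pw_sum (\<lambda>T x. slope T v)"
proof -
  have "v x = pw_sum (\<lambda>T x. inner (slope T v) x + offset T v) x \<and> broken_grad \<T> v x = pw_sum (\<lambda>T x. slope T v) x" for x
  proof (cases "\<exists>T\<in>\<T>. x \<in> interior T")
    case True
    then obtain T where T: "T \<in> \<T>" "x \<in> interior T" by blast
    show ?thesis unfolding pw_sum_inside[OF T] using pw_affine_eq[OF v T] pw_affine_grad(3)[OF v T] by blast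
  next
    case False
    then have x: "x \<notin> (\<Union>T\<in>\<T>. interior T)" by blast
    show ?thesis unfolding pw_sum_outside[OF x] using pw_affine_outside[OF v x] x by (simp add: broken_grad_def)
  qed
  note * = this
  show "v = pw_sum (\<lambda>T x. inner (slope T v) x + offset T v)" by (rule ext) (rule conjunct1[OF *])
  show "broken_grad \<T> v = pw_sum (\<lambda>T x. slope T v)" by (rule ext) (rule conjunct2[OF *])
qed

lemma pw_affine_borel: "v \<in> pw_affine_space \<T> \<Longrightarrow> v \<in> borel_measurable borel"
proof -
  assume v: "v \<in> pw_affine_space \<T>"
  have "pw_sum (\<lambda>T x. inner (slope T v) x + offset T v) \<in> borel_measurable borel"
    by (rule pw_sum_borel) (intro borel_measurable_continuous_onI continuous_intros)
  then show "v \<in> borel_measurable borel" by (rule back_subst[OF _ pw_affine_pw_sum(1)[OF v, symmetric]])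
qed

lemma broken_grad_borel:
  assumes "v \<in> pw_affine_space \<T>" shows "broken_grad \<T> v \<in> borel_measurable borel"
  unfolding pw_affine_pw_sum(2)[OF assms] by (rule pw_sum_borel) (rule borel_measurable_const)

lemma outside_domain: "x \<notin> \<Omega> \<Longrightarrow> x \<notin> (\<Union>T\<in>\<T>. interior T)"
  using interior_element_subset by blast

lemma H10_gradient_broken:
  assumes v: "v \<in> pw_affine_space \<T>" and G: "has_H10_gradient \<Omega> v G"
  shows "AE x in lebesgue_on \<Omega>. G x = broken_grad \<T> v x"
proof (rule AE_mesh)
  fix T assume T: "T \<in> \<T>"
  have z: "\<And>x. x \<notin> \<Omega> \<Longrightarrow> v x = 0" using pw_affine_outside[OF v] outside_domain by blast
  have "AE x in lebesgue. x \<in> interior T \<longrightarrow> G x = slope T v"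
    by (rule H10_gradient_affine[OF G open_domain pw_affine_borel[OF v] z open_interior interior_element_subset[OF T] pw_affine_eq[OF v T]])
  then show "AE x in lebesgue. x \<in> interior T \<longrightarrow> G x = broken_grad \<T> v x"
    by (rule eventually_mono) (simp add: pw_affine_grad(3)[OF v T])
qed

text \<open>The sum of the slope norms bounds the broken gradient everywhere. Only points of
  continuity are compared, because on the skeleton \<open>v\<close> carries the conventional value
  0.\<close>

lemma H10_pw_affine_lipschitz:
  assumes v: "v \<in> pw_affine_space \<T>" and G: "has_H10_gradient \<Omega> v G"
  shows "\<exists>K\<ge>0. \<forall>x y. isCont v x \<longrightarrow> isCont v y \<longrightarrow> \<bar>v y - v x\<bar> \<le> K * norm (y - x)"
proof -
  define K where "K = (\<Sum>T\<in>\<T>. norm (slope T v))"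
  have K0: "K \<ge> 0" unfolding K_def by (rule sum_nonneg) simp
  have z: "\<And>x. x \<notin> \<Omega> \<Longrightarrow> v x = 0" using pw_affine_outside[OF v] outside_domain by blast
  have bz: "\<And>x. x \<notin> \<Omega> \<Longrightarrow> broken_grad \<T> v x = 0" using outside_domain unfolding broken_grad_def by presburger
  have bK: "norm (broken_grad \<T> v x) \<le> K" for x
  proof (cases "\<exists>T\<in>\<T>. x \<in> interior T")
    case True
    then obtain T where T: "T \<in> \<T>" "x \<in> interior T" by blast
    have "norm (slope T v) \<le> K" unfolding K_def by (rule member_le_sum[OF T(1)]) (use finite_mesh in auto)
    then show ?thesis by (simp only: pw_affine_grad(3)[OF v T])
  next
    case False
    then show ?thesis using K0 by (simp add: broken_grad_def)
  qed
  show ?thesis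
    using H10_lipschitz[OF G open_domain pw_affine_borel[OF v] z broken_grad_borel[OF v] bz H10_gradient_broken[OF v G] bK] K0
    by blast
qed

text \<open>Sequences in \<open>A\<close> and \<open>B\<close> converging to the same
  \<open>x\<close> approach each other, so the Lipschitz bound forces the two continuous extensions
  to have the same value at \<open>x\<close>.\<close>

lemma lipschitz_limits_agree:
  fixes v f g :: "'a \<Rightarrow> real"
  assumes lip: "\<And>y z. y \<in> A \<Longrightarrow> z \<in> B \<Longrightarrow> \<bar>v z - v y\<bar> \<le> K * norm (z - y)"
    and f: "\<And>y. y \<in> A \<Longrightarrow> v y = f y" "isCont f x" and g: "\<And>y. y \<in> B \<Longrightarrow> v y = g y" "isCont g x"
    and x: "x \<in> closure A" "x \<in> closure B"
  shows "f x = g x"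
proof -
  obtain s where s: "\<And>n. s n \<in> A" "s \<longlonglongrightarrow> x" using x(1) unfolding closure_sequential by blast
  obtain t where t: "\<And>n. t n \<in> B" "t \<longlonglongrightarrow> x" using x(2) unfolding closure_sequential by blast
  have fs: "(\<lambda>n. f (s n)) \<longlonglongrightarrow> f x" by (rule isCont_tendsto_compose[OF f(2) s(2)])
  have gt: "(\<lambda>n. g (t n)) \<longlonglongrightarrow> g x" by (rule isCont_tendsto_compose[OF g(2) t(2)])
  have d: "(\<lambda>n. \<bar>g (t n) - f (s n)\<bar>) \<longlonglongrightarrow> \<bar>g x - f x\<bar>" by (intro tendsto_intros fs gt)
  have "(\<lambda>n. K * norm (t n - s n)) \<longlonglongrightarrow> K * norm (x - x)" by (intro tendsto_intros s t)
  then have k: "(\<lambda>n. K * norm (t n - s n)) \<longlonglongrightarrow> 0" by simp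
  have "\<bar>g (t n) - f (s n)\<bar> \<le> K * norm (t n - s n)" for n
    using lip[OF s(1) t(1), of n n] by (simp only: f(1)[OF s(1)] g(1)[OF t(1)])
  then have "\<bar>g x - f x\<bar> \<le> 0" by (intro LIMSEQ_le[OF d k]) blast
  then show ?thesis by simp
qed

lemma affine_isCont: "isCont (\<lambda>x. inner a x + c) (x::'a)"
  by (intro continuous_intros)

lemma Vc_subset_CR: "Vc_space \<T> \<Omega> \<subseteq> CR_space \<T> \<Omega>"
proof
  fix v assume "v \<in> Vc_space \<T> \<Omega>"
  then obtain G where v: "v \<in> pw_affine_space \<T>" and G: "has_H10_gradient \<Omega> v G"
    unfolding Vc_space_def H10_space_def by blast
  obtain K where K: "\<And>x y. isCont v x \<Longrightarrow> isCont v y \<Longrightarrow> \<bar>v y - v x\<bar> \<le> K * norm (y - x)"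
    using H10_pw_affine_lipschitz[OF v G] by blast
  have z: "v x = 0" if "x \<in> - closure \<Omega>" for x
    using that closure_subset[of \<Omega>] pw_affine_outside[OF v outside_domain, of x] by blast
  \<comment> \<open>The representative vanishes on the open exterior and is thus continuous there.
    The exterior can then act as the missing neighbour across a boundary facet.\<close>
  have cz: "isCont v x" if x: "x \<in> - closure \<Omega>" for x
    by (rule grad_locally_affine(2)[of "- closure \<Omega>" x v 0 0]) (use x z in auto)
  show "v \<in> CR_space \<T> \<Omega>"
    unfolding CR_space_def mem_Collect_eq
  proof (intro conjI ballI allI impI)
    show "v \<in> pw_affine_space \<T>" by (rule v)
  next
    fix T T' F assume T: "T \<in> \<T>" "T' \<in> \<T>" and F: "T \<noteq> T' \<and> F facet_of T \<and> F facet_of T'"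
    show "face_integral F (\<lambda>x. trace_from T v x - trace_from T' v x) = 0"
    proof (rule face_integral_zero)
      fix x assume "x \<in> F"
      then have x: "x \<in> T" "x \<in> T'" using F facet_of_imp_subset by blast+
      have "inner (slope T v) x + offset T v = inner (slope T' v) x + offset T' v"
      proof (rule lipschitz_limits_agree[where A="interior T" and B="interior T'" and v=v and K=K])
        show "\<bar>v z - v y\<bar> \<le> K * norm (z - y)" if "y \<in> interior T" "z \<in> interior T'" for y z
          by (rule K[OF pw_affine_grad(2)[OF v T(1) that(1)] pw_affine_grad(2)[OF v T(2) that(2)]])
        show "x \<in> closure (interior T)" "x \<in> closure (interior T')"
          using x element_closure_interior T by simp_all
      qed (use pw_affine_eq[OF v T(1)] pw_affine_eq[OF v T(2)] affine_isCont in simp_all)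
      then show "trace_from T v x - trace_from T' v x = 0"
        by (simp only: pw_affine_trace[OF v T(1) x(1)] pw_affine_trace[OF v T(2) x(2)] diff_self)
    qed
  next
    fix T F assume T: "T \<in> \<T>" and F: "F facet_of T \<and> F \<subseteq> frontier \<Omega>"
    show "face_integral F (trace_from T v) = 0"
    proof (rule face_integral_zero)
      fix x assume "x \<in> F"
      then have x: "x \<in> T" "x \<in> closure (- closure \<Omega>)" using F facet_of_imp_subset frontier_exterior by blast+
      have "inner (slope T v) x + offset T v = 0"
      proof (rule lipschitz_limits_agree[where A="interior T" and B="- closure \<Omega>" and v=v and K=K and g="\<lambda>_. 0"])
        show "\<bar>v z - v y\<bar> \<le> K * norm (z - y)" if "y \<in> interior T" "z \<in> - closure \<Omega>" for y z
          by (rule K[OF pw_affine_grad(2)[OF v T that(1)] cz[OF that(2)]])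
        show "x \<in> closure (interior T)" using x(1) element_closure_interior[OF T] by simp
      qed (use pw_affine_eq[OF v T] affine_isCont z x(2) in simp_all)
      then show "trace_from T v x = 0" by (simp only: pw_affine_trace[OF v T x(1)])
    qed
  qed
qed

lemma Vc_pw_affine: "v \<in> Vc_space \<T> \<Omega> \<Longrightarrow> v \<in> pw_affine_space \<T>"
  by (simp add: Vc_space_def)

lemma zero_pw_affine: "(\<lambda>_. 0) \<in> pw_affine_space \<T>"
proof -
  have "\<exists>a c. \<forall>x\<in>interior T. 0 = inner a x + c" for T :: "'a set"
    by (intro exI[of _ 0] ballI) simp
  then show ?thesis unfolding pw_affine_space_def by blast
qed

lemma zero_H10: "has_H10_gradient \<Omega> (\<lambda>_. 0) (\<lambda>_. 0)"
proof -
  have g: "grad (\<lambda>_. 0 :: real) x = 0" for x :: 'a by (rule grad_eqI) simp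
  have "Ck_function k (\<lambda>_::'a. 0)" for k by (induction k) (simp_all add: g)
  then have t: "(\<lambda>_. 0) \<in> test_functions \<Omega>" unfolding test_functions_def by simp
  show ?thesis unfolding has_H10_gradient_def
  proof (intro conjI exI[of _ "\<lambda>_ _. 0"])
    show "has_weak_gradient \<Omega> (\<lambda>_. 0) (\<lambda>_. 0)" unfolding has_weak_gradient_def by simp
  qed (simp_all add: t g L2_space_def L2_norm_def L2_inner_def)
qed

lemma Vc_zero: "(\<lambda>_. 0) \<in> Vc_space \<T> \<Omega>"
  using zero_pw_affine zero_H10 unfolding Vc_space_def H10_space_def by blast

lemma Vc_lincomb:
  assumes "v \<in> Vc_space \<T> \<Omega>" "w \<in> Vc_space \<T> \<Omega>"
  shows "(\<lambda>x. c * v x + w x) \<in> Vc_space \<T> \<Omega>"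
proof -
  obtain G H where "has_H10_gradient \<Omega> v G" "has_H10_gradient \<Omega> w H" using assms unfolding Vc_space_def H10_space_def by blast
  from H10_gradient_lincomb[OF open_domain this] have "(\<lambda>x. c * v x + w x) \<in> H10_space \<Omega>"
    unfolding H10_space_def by blast
  then show ?thesis using pw_affine_lincomb(1)[OF Vc_pw_affine[OF assms(1)] Vc_pw_affine[OF assms(2)]] by (simp add: Vc_space_def)
qed

lemma Vc_grad: "v \<in> Vc_space \<T> \<Omega> \<Longrightarrow> AE x in lebesgue_on \<Omega>. H10_grad \<Omega> v x = broken_grad \<T> v x"
proof -
  assume v: "v \<in> Vc_space \<T> \<Omega>"
  then have "\<exists>G. has_H10_gradient \<Omega> v G" unfolding Vc_space_def H10_space_def by blast
  from someI_ex[OF this] have "has_H10_gradient \<Omega> v (H10_grad \<Omega> v)" unfolding H10_grad_def .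
  then show ?thesis by (rule H10_gradient_broken[OF Vc_pw_affine[OF v]])
qed

lemma CR_zero: "(\<lambda>_. 0) \<in> CR_space \<T> \<Omega>" using Vc_zero Vc_subset_CR by blast

end


section \<open>Integrals of piecewise smooth functions\<close>

text \<open>Reconciles three conventions: \<open>second_moment\<close> integrates over the closed
  element, sums over the mesh use open elements, and the centroid is computed with
  \<open>lborel\<close>. The frontier of a convex set is a null set.\<close>

lemma lebesgue_on_interior_integral:
  fixes h :: "'a::euclidean_space \<Rightarrow> 'b::euclidean_space"
  assumes T: "compact T" "convex T" and h: "continuous_on UNIV h"
  shows "integrable (lebesgue_on (interior T)) h"
    and "integral\<^sup>L (lebesgue_on T) h = integral\<^sup>L (lebesgue_on (interior T)) h"
    and "integral\<^sup>L (lebesgue_on T) h = integral\<^sup>L lborel (\<lambda>x. indicator T x *\<^sub>R h x)"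
proof -
  have Tl: "T \<in> sets lebesgue" using compact_imp_closed[OF T(1)] by simp
  have il: "interior T \<in> sets lebesgue" by simp
  have i0: "integrable lborel (\<lambda>x. indicator T x *\<^sub>R h x)"
    by (rule borel_integrable_compact[OF T(1)]) (rule continuous_on_subset[OF h], simp)
  note b0 = borel_measurable_integrable[OF i0]
  have i1: "integrable lebesgue (\<lambda>x. indicator T x *\<^sub>R h x)"
    using integrable_completion[OF b0] i0 by blast
  have hb: "h \<in> borel_measurable borel" by (rule borel_measurable_continuous_onI[OF h])
  have b1: "(\<lambda>x. indicator (interior T) x *\<^sub>R h x) \<in> borel_measurable lebesgue"
  proof -
    have "(\<lambda>x. indicator (interior T) x *\<^sub>R h x) \<in> borel_measurable borel"
      by (intro borel_measurable_scaleR borel_measurable_indicator hb) simp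
    then show ?thesis by (simp add: measurable_completion)
  qed
  have "AE x in lebesgue. x \<notin> frontier T"
    using negligible_convex_frontier[OF T(2)] by (simp add: negligible_iff_null_sets AE_not_in)
  then have ae: "AE x in lebesgue. indicator T x *\<^sub>R h x = indicator (interior T) x *\<^sub>R h x"
  proof (rule eventually_mono)
    fix x assume "x \<notin> frontier T"
    then have "x \<in> T \<longleftrightarrow> x \<in> interior T"
      using compact_imp_closed[OF T(1)] interior_subset[of T] by (auto simp: frontier_def)
    then show "indicator T x *\<^sub>R h x = indicator (interior T) x *\<^sub>R h x" by (simp add: indicator_def)
  qed
  have "integrable lebesgue (\<lambda>x. indicator (interior T) x *\<^sub>R h x)"
    by (rule integrable_cong_AE_imp[OF i1 b1 ae])
  then show "integrable (lebesgue_on (interior T)) h" by (simp add: integrable_restrict_space)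
  have "integral\<^sup>L lebesgue (\<lambda>x. indicator T x *\<^sub>R h x) = integral\<^sup>L lebesgue (\<lambda>x. indicator (interior T) x *\<^sub>R h x)"
    by (rule Bochner_Integration.integral_cong_AE[OF borel_measurable_integrable[OF i1] b1 ae])
  then show "integral\<^sup>L (lebesgue_on T) h = integral\<^sup>L (lebesgue_on (interior T)) h"
    using Tl by (simp add: integral_restrict_space)
  show "integral\<^sup>L (lebesgue_on T) h = integral\<^sup>L lborel (\<lambda>x. indicator T x *\<^sub>R h x)"
    using Tl integral_completion[OF b0] by (simp add: integral_restrict_space)
qed

context mesh begin

definition "vol T = measure lebesgue (interior T)"

lemma vol_pos: "T \<in> \<T> \<Longrightarrow> vol T > 0"
proof -
  assume T: "T \<in> \<T>"
  have "bounded (interior T)" using compact_imp_bounded[OF element_compact[OF T]] interior_subset bounded_subset by blast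
  then have "interior T \<in> lmeasurable" by (intro bounded_set_imp_lmeasurable) auto
  moreover have "\<not> negligible (interior T)" using open_not_negligible[OF open_interior element_interior_nonempty[OF T]] .
  ultimately have "vol T \<noteq> 0" unfolding vol_def by (simp add: negligible_iff_measure)
  then show ?thesis unfolding vol_def by (simp add: less_le)
qed

lemma integral_mesh:
  fixes f :: "'a \<Rightarrow> real"
  assumes m: "f \<in> borel_measurable (lebesgue_on \<Omega>)" and i: "\<And>T. T \<in> \<T> \<Longrightarrow> integrable (lebesgue_on (interior T)) f"
  shows "integrable (lebesgue_on \<Omega>) f" "integral\<^sup>L (lebesgue_on \<Omega>) f = (\<Sum>T\<in>\<T>. integral\<^sup>L (lebesgue_on (interior T)) f)"
proof -
  let ?F = "\<lambda>T x. indicator (interior T) x *\<^sub>R f x" and ?G = "\<lambda>x. indicator \<Omega> x *\<^sub>R f x"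
  have iF: "integrable lebesgue (?F T)" if "T \<in> \<T>" for T using i[OF that] by (simp add: integrable_restrict_space)
  have iS: "integrable lebesgue (\<lambda>x. \<Sum>T\<in>\<T>. ?F T x)" by (rule Bochner_Integration.integrable_sum) (rule iF)
  have mG: "?G \<in> borel_measurable lebesgue"
    using m domain_lebesgue borel_measurable_restrict_space_iff[of \<Omega> lebesgue f] by simp
  have "AE x in lebesgue. x \<notin> skeleton"
    using skeleton_negligible by (simp add: negligible_iff_null_sets AE_not_in)
  then have ae: "AE x in lebesgue. (\<Sum>T\<in>\<T>. ?F T x) = ?G x"
  proof (rule eventually_mono)
    fix x assume x: "x \<notin> skeleton"
    show "(\<Sum>T\<in>\<T>. ?F T x) = ?G x"
    proof (cases "\<exists>T\<in>\<T>. x \<in> interior T")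
      case True
      then obtain T where T: "T \<in> \<T>" "x \<in> interior T" by blast
      have "x \<in> \<Omega>" using T interior_element_subset by blast
      then show ?thesis using pw_sum_inside[OF T, of "\<lambda>_. f"] by (simp add: pw_sum_def)
    next
      case False
      then have "x \<notin> (\<Union>T\<in>\<T>. interior T)" by blast
      moreover from this have "x \<notin> \<Omega>" using x unfolding skeleton_def by blast
      ultimately show ?thesis using pw_sum_outside[of x "\<lambda>_. f"] by (simp add: pw_sum_def)
    qed
  qed
  have "integrable lebesgue ?G" by (rule integrable_cong_AE_imp[OF iS mG ae])
  then show "integrable (lebesgue_on \<Omega>) f" using domain_lebesgue by (simp add: integrable_restrict_space)
  have "integral\<^sup>L (lebesgue_on \<Omega>) f = integral\<^sup>L lebesgue ?G" using domain_lebesgue by (simp add: integral_restrict_space)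
  also have "\<dots> = integral\<^sup>L lebesgue (\<lambda>x. \<Sum>T\<in>\<T>. ?F T x)"
    by (rule Bochner_Integration.integral_cong_AE[OF borel_measurable_integrable[OF iS] mG ae, symmetric])
  also have "\<dots> = (\<Sum>T\<in>\<T>. integral\<^sup>L lebesgue (?F T))" by (rule Bochner_Integration.integral_sum) (rule iF)
  also have "\<dots> = (\<Sum>T\<in>\<T>. integral\<^sup>L (lebesgue_on (interior T)) f)"
    by (intro sum.cong refl) (simp add: integral_restrict_space)
  finally show "integral\<^sup>L (lebesgue_on \<Omega>) f = (\<Sum>T\<in>\<T>. integral\<^sup>L (lebesgue_on (interior T)) f)" .
qed

text \<open>The pieces are continuous on the whole space and agree with \<open>f\<close> only on the
  open elements; integrability then comes from the compactness of the closed elements.\<close>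

lemma integral_mesh_pieces:
  fixes f :: "'a \<Rightarrow> real"
  assumes f: "f \<in> borel_measurable borel"
    and h: "\<And>T. T \<in> \<T> \<Longrightarrow> continuous_on UNIV (h T)" "\<And>T x. T \<in> \<T> \<Longrightarrow> x \<in> interior T \<Longrightarrow> f x = h T x"
  shows "integrable (lebesgue_on \<Omega>) f" "integral\<^sup>L (lebesgue_on \<Omega>) f = (\<Sum>T\<in>\<T>. integral\<^sup>L (lebesgue_on (interior T)) (h T))"
proof -
  have i: "integrable (lebesgue_on (interior T)) f" if T: "T \<in> \<T>" for T
  proof -
    have "integrable (lebesgue_on (interior T)) (h T)"
      by (rule lebesgue_on_interior_integral(1)[OF element_compact[OF T] element_convex[OF T] h(1)[OF T]])
    then show ?thesis
      by (rule Bochner_Integration.integrable_cong[THEN iffD1, rotated -1]) (simp_all add: h(2)[OF T])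
  qed
  note b = borel_imp_lebesgue_on[OF f]
  show "integrable (lebesgue_on \<Omega>) f" by (rule integral_mesh(1)[OF b i])
  have "integral\<^sup>L (lebesgue_on \<Omega>) f = (\<Sum>T\<in>\<T>. integral\<^sup>L (lebesgue_on (interior T)) f)"
    by (rule integral_mesh(2)[OF b i])
  also have "\<dots> = (\<Sum>T\<in>\<T>. integral\<^sup>L (lebesgue_on (interior T)) (h T))"
    by (intro sum.cong refl Bochner_Integration.integral_cong) (simp add: h(2))
  finally show "integral\<^sup>L (lebesgue_on \<Omega>) f = (\<Sum>T\<in>\<T>. integral\<^sup>L (lebesgue_on (interior T)) (h T))" .
qed

lemma integral_const_interior: "T \<in> \<T> \<Longrightarrow> integral\<^sup>L (lebesgue_on (interior T)) (\<lambda>_. c) = vol T * (c::real)"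
  by (simp add: vol_def measure_restrict_space)

text \<open>The broken Dirichlet form. It represents both bilinear forms, as \<open>H10_grad\<close>
  and \<open>broken_grad\<close> agree almost everywhere on conforming functions, and it does not
  involve the choice made in \<open>H10_grad\<close>.\<close>

definition "energy v w = (\<Sum>T\<in>\<T>. vol T * inner (slope T v) (slope T w))"

lemma broken_grad_energy:
  assumes v: "v \<in> pw_affine_space \<T>" and w: "w \<in> pw_affine_space \<T>"
  shows "L2_inner \<Omega> (broken_grad \<T> v) (broken_grad \<T> w) = energy v w"
proof -
  have b: "(\<lambda>x. inner (broken_grad \<T> v x) (broken_grad \<T> w x)) \<in> borel_measurable borel"
    by (intro borel_measurable_inner broken_grad_borel v w)
  have "L2_inner \<Omega> (broken_grad \<T> v) (broken_grad \<T> w)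
    = (\<Sum>T\<in>\<T>. integral\<^sup>L (lebesgue_on (interior T)) (\<lambda>_. inner (slope T v) (slope T w)))"
    unfolding L2_inner_def
    by (rule integral_mesh_pieces(2)[OF b]) (simp_all add: pw_affine_grad(3)[OF v] pw_affine_grad(3)[OF w])
  also have "\<dots> = energy v w" unfolding energy_def by (intro sum.cong refl integral_const_interior)
  finally show ?thesis .
qed

lemma H10_grad_L2: "v \<in> Vc_space \<T> \<Omega> \<Longrightarrow> H10_grad \<Omega> v \<in> borel_measurable (lebesgue_on \<Omega>)"
proof -
  assume "v \<in> Vc_space \<T> \<Omega>"
  then have "\<exists>G. has_H10_gradient \<Omega> v G" unfolding Vc_space_def H10_space_def by blast
  from someI_ex[OF this] have "has_H10_gradient \<Omega> v (H10_grad \<Omega> v)" unfolding H10_grad_def .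
  then show ?thesis unfolding has_H10_gradient_def L2_space_def by blast
qed

lemma L2_inner_cong_AE:
  assumes "f \<in> borel_measurable (lebesgue_on \<Omega>)" "f' \<in> borel_measurable (lebesgue_on \<Omega>)"
    "g \<in> borel_measurable (lebesgue_on \<Omega>)" "g' \<in> borel_measurable (lebesgue_on \<Omega>)"
    and "AE x in lebesgue_on \<Omega>. f x = f' x" "AE x in lebesgue_on \<Omega>. g x = g' x"
  shows "L2_inner \<Omega> f g = L2_inner \<Omega> f' g'"
  unfolding L2_inner_def
proof (rule Bochner_Integration.integral_cong_AE)
  show "AE x in lebesgue_on \<Omega>. inner (f x) (g x) = inner (f' x) (g' x)"
    using assms(5,6) by eventually_elim (simp only:)
qed (intro borel_measurable_inner assms)+

lemma H10_grad_energy: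
  assumes v: "v \<in> Vc_space \<T> \<Omega>" and w: "w \<in> Vc_space \<T> \<Omega>"
  shows "L2_inner \<Omega> (H10_grad \<Omega> v) (H10_grad \<Omega> w) = energy v w"
proof -
  note pv = Vc_pw_affine[OF v] and pw = Vc_pw_affine[OF w]
  have "L2_inner \<Omega> (H10_grad \<Omega> v) (H10_grad \<Omega> w) = L2_inner \<Omega> (broken_grad \<T> v) (broken_grad \<T> w)"
    by (rule L2_inner_cong_AE[OF H10_grad_L2[OF v] _ H10_grad_L2[OF w] _ Vc_grad[OF v] Vc_grad[OF w]])
       (rule borel_imp_lebesgue_on[OF broken_grad_borel[OF pv]] borel_imp_lebesgue_on[OF broken_grad_borel[OF pw]])+
  then show ?thesis using broken_grad_energy[OF pv pw] by simp
qed

lemma pw_product_integrable: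
  assumes v: "v \<in> pw_affine_space \<T>" and w: "w \<in> pw_affine_space \<T>"
  shows "integrable (lebesgue_on \<Omega>) (\<lambda>x. v x * w x)"
proof (rule integral_mesh_pieces(1))
  show "(\<lambda>x. v x * w x) \<in> borel_measurable borel" by (intro borel_measurable_times pw_affine_borel v w)
  show "continuous_on UNIV (\<lambda>x. (inner (slope T v) x + offset T v) * (inner (slope T w) x + offset T w))" for T
    by (intro continuous_intros)
  show "v x * w x = (inner (slope T v) x + offset T v) * (inner (slope T w) x + offset T w)" if "T \<in> \<T>" "x \<in> interior T" for T x
    by (simp only: pw_affine_eq[OF v that] pw_affine_eq[OF w that])
qed

lemma L2_inner_real: "L2_inner \<Omega> f g = integral\<^sup>L (lebesgue_on \<Omega>) (\<lambda>x. f x * (g x :: real))"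
  by (simp add: L2_inner_def)

lemma L2_inner_commute: "L2_inner \<Omega> f g = L2_inner \<Omega> g f"
  by (simp add: L2_inner_def inner_commute)

lemma L2_inner_lincomb:
  assumes g: "g \<in> pw_affine_space \<T>" and v: "v \<in> pw_affine_space \<T>" and w: "w \<in> pw_affine_space \<T>"
  shows "L2_inner \<Omega> g (\<lambda>x. c * v x + w x) = c * L2_inner \<Omega> g v + L2_inner \<Omega> g w"
proof -
  have "L2_inner \<Omega> g (\<lambda>x. c * v x + w x) = integral\<^sup>L (lebesgue_on \<Omega>) (\<lambda>x. c * (g x * v x) + g x * w x)"
    unfolding L2_inner_real by (rule arg_cong[where f="integral\<^sup>L (lebesgue_on \<Omega>)"]) (simp add: fun_eq_iff algebra_simps)
  also have "\<dots> = c * L2_inner \<Omega> g v + L2_inner \<Omega> g w"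
    unfolding L2_inner_real using pw_product_integrable[OF g v] pw_product_integrable[OF g w] by simp
  finally show ?thesis .
qed

lemma energy_commute: "energy v w = energy w v"
  by (simp add: energy_def inner_commute)

lemma energy_lincomb:
  assumes v: "v \<in> pw_affine_space \<T>" and w: "w \<in> pw_affine_space \<T>"
  shows "energy z (\<lambda>x. c * v x + w x) = c * energy z v + energy z w"
proof -
  have "energy z (\<lambda>x. c * v x + w x) = (\<Sum>T\<in>\<T>. c * (vol T * inner (slope T z) (slope T v)) + vol T * inner (slope T z) (slope T w))"
    unfolding energy_def
  proof (rule sum.cong[OF refl])
    fix T assume "T \<in> \<T>"
    then show "vol T * inner (slope T z) (slope T (\<lambda>x. c * v x + w x))
        = c * (vol T * inner (slope T z) (slope T v)) + vol T * inner (slope T z) (slope T w)"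
      unfolding pw_affine_lincomb(2)[OF v w \<open>T \<in> \<T>\<close>] by (simp add: inner_add_right algebra_simps)
  qed
  then show ?thesis by (simp add: energy_def sum.distrib sum_distrib_left)
qed

lemma energy_zero:
  assumes "energy v v = 0" "T \<in> \<T>"
  shows "slope T v = 0"
proof -
  have "\<forall>T\<in>\<T>. vol T * inner (slope T v) (slope T v) = 0"
  proof (rule sum_nonneg_eq_0_iff[THEN iffD1, OF finite_mesh])
    show "0 \<le> vol T * inner (slope T v) (slope T v)" if "T \<in> \<T>" for T
      using vol_pos[OF that] by simp
    show "(\<Sum>T\<in>\<T>. vol T * inner (slope T v) (slope T v)) = 0" using assms(1) by (simp only: energy_def)
  qed
  then show ?thesis using vol_pos[OF assms(2)] assms(2) by force
qed

lemma CR_energy_definite: "v \<in> CR_space \<T> \<Omega> \<Longrightarrow> energy v v = 0 \<Longrightarrow> v = (\<lambda>_. 0)"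
  using CR_definite energy_zero by blast

lemma element_centroid:
  assumes T: "T \<in> \<T>"
  shows "integral\<^sup>L (lebesgue_on (interior T)) (\<lambda>x. x - barycentre T) = 0"
proof -
  obtain C where C: "\<not> affine_dependent C" "int (card C) = int DIM('a) + 1" "T = convex hull C"
    using mesh_simplex[OF T] unfolding simplex_def by blast
  have "card C = DIM('a) + 1" using C(2) by linarith
  from simplex_centroid[OF C(1) this C(3)] show ?thesis
    using lebesgue_on_interior_integral(2,3)[OF element_compact[OF T] element_convex[OF T], of "\<lambda>x. x - barycentre T"]
    by (simp add: continuous_intros)
qed

end


section \<open>Galerkin systems and their matrices\<close>

unbundle no vec_syntax

text \<open>\<open>L\<close> is required to be linear only on \<open>V\<close>, because for the
  integrals in question additivity depends on integrability. The value of \<open>L\<close> at zero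
  is forced by linearity with \<open>c = 1\<close>.\<close>

lemma lincomb_sum:
  fixes \<phi> :: "nat \<Rightarrow> 'a \<Rightarrow> real"
  assumes zero: "(\<lambda>_. 0) \<in> V" and closed: "\<And>c u w. u \<in> V \<Longrightarrow> w \<in> V \<Longrightarrow> (\<lambda>x. c * u x + w x) \<in> V"
    and \<phi>: "\<And>i. i < n \<Longrightarrow> \<phi> i \<in> V"
  shows "(\<lambda>x. \<Sum>i<n. c i * \<phi> i x) \<in> V"
    and "(\<And>c u w. u \<in> V \<Longrightarrow> w \<in> V \<Longrightarrow> L (\<lambda>x. c * u x + w x) = c *\<^sub>R L u + L w) \<Longrightarrow>
      L (\<lambda>x. \<Sum>i<n. c i * \<phi> i x) = (\<Sum>i<n. c i *\<^sub>R (L (\<phi> i) :: 'b::real_vector))"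
proof -
  have "m \<le> n \<Longrightarrow> (\<lambda>x. \<Sum>i<m. c i * \<phi> i x) \<in> V \<and>
    ((\<forall>c u w. u \<in> V \<longrightarrow> w \<in> V \<longrightarrow> L (\<lambda>x. c * u x + w x) = c *\<^sub>R L u + L w) \<longrightarrow>
      L (\<lambda>x. \<Sum>i<m. c i * \<phi> i x) = (\<Sum>i<m. c i *\<^sub>R (L (\<phi> i) :: 'b)))" for m
  proof (induction m)
    case 0
    have "L (\<lambda>_. 0) = 0" if lin: "\<forall>c u w. u \<in> V \<longrightarrow> w \<in> V \<longrightarrow> L (\<lambda>x. c * u x + w x) = c *\<^sub>R L u + L w"
      using lin[rule_format, OF zero zero, of 1] by simp
    then show ?case using zero by simp
  next
    case (Suc m)
    then have IH: "(\<lambda>x. \<Sum>i<m. c i * \<phi> i x) \<in> V" and m: "\<phi> m \<in> V" using \<phi> by auto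
    have eq: "(\<lambda>x. \<Sum>i<Suc m. c i * \<phi> i x) = (\<lambda>x. c m * \<phi> m x + (\<Sum>i<m. c i * \<phi> i x))"
      by (simp add: add.commute)
    show ?case unfolding eq
    proof (intro conjI impI)
      show "(\<lambda>x. c m * \<phi> m x + (\<Sum>i<m. c i * \<phi> i x)) \<in> V" by (rule closed[OF m IH])
      assume lin: "\<forall>c u w. u \<in> V \<longrightarrow> w \<in> V \<longrightarrow> L (\<lambda>x. c * u x + w x) = c *\<^sub>R L u + L w"
      show "L (\<lambda>x. c m * \<phi> m x + (\<Sum>i<m. c i * \<phi> i x)) = (\<Sum>i<Suc m. c i *\<^sub>R L (\<phi> i))"
        using lin[rule_format, OF m IH, of "c m"] Suc lin by (simp add: add.commute)
    qed
  qed
  from this[of n] show "(\<lambda>x. \<Sum>i<n. c i * \<phi> i x) \<in> V"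
    "(\<And>c u w. u \<in> V \<Longrightarrow> w \<in> V \<Longrightarrow> L (\<lambda>x. c * u x + w x) = c *\<^sub>R L u + L w) \<Longrightarrow>
      L (\<lambda>x. \<Sum>i<n. c i * \<phi> i x) = (\<Sum>i<n. c i *\<^sub>R (L (\<phi> i) :: 'b))"
    by simp_all
qed

text \<open>A trivial kernel gives a nonzero determinant, hence a unit of the matrix ring;
  \<open>mat_inverse\<close> is then \<open>Some\<close> and \<open>the\<close> is
  meaningful.\<close>

lemma mat_inverse_injective:
  fixes A :: "real Matrix.mat"
  assumes A: "A \<in> carrier_mat n n" and inj: "\<And>v. v \<in> carrier_vec n \<Longrightarrow> A *\<^sub>v v = 0\<^sub>v n \<Longrightarrow> v = 0\<^sub>v n"
  shows "the (mat_inverse A) \<in> carrier_mat n n" "A * the (mat_inverse A) = 1\<^sub>m n" "the (mat_inverse A) * A = 1\<^sub>m n"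
proof -
  have "det A \<noteq> 0" using det_0_iff_vec_prod_zero_field[OF A] inj by blast
  then have "A \<in> Units (ring_mat TYPE(real) n ())" by (rule det_non_zero_imp_unit[OF A])
  then obtain B where "mat_inverse A = Some B" using mat_inverse(1)[OF A, of "()"] by (cases "mat_inverse A") auto
  then show "the (mat_inverse A) \<in> carrier_mat n n" "A * the (mat_inverse A) = 1\<^sub>m n" "the (mat_inverse A) * A = 1\<^sub>m n"
    using mat_inverse(2)[OF A] by auto
qed

lemma mat_mult_vec_index:
  fixes A :: "real Matrix.mat"
  assumes "A \<in> carrier_mat n m" "v \<in> carrier_vec m" "i < n"
  shows "(A *\<^sub>v v) $ i = (\<Sum>k<m. A $$ (i, k) * v $ k)"
  using assms by (simp add: scalar_prod_def lessThan_atLeast0)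

locale galerkin =
  fixes V :: "('a \<Rightarrow> real) set" and a :: "('a \<Rightarrow> real) \<Rightarrow> ('a \<Rightarrow> real) \<Rightarrow> real"
    and n :: nat and \<phi> :: "nat \<Rightarrow> 'a \<Rightarrow> real"
  assumes zero: "(\<lambda>_. 0) \<in> V" and closed: "\<And>c u w. u \<in> V \<Longrightarrow> w \<in> V \<Longrightarrow> (\<lambda>x. c * u x + w x) \<in> V"
    and basis: "is_basis n \<phi> V"
    and lin1: "\<And>c u w z. u \<in> V \<Longrightarrow> w \<in> V \<Longrightarrow> z \<in> V \<Longrightarrow> a (\<lambda>x. c * u x + w x) z = c * a u z + a w z"
    and lin2: "\<And>c u w z. u \<in> V \<Longrightarrow> w \<in> V \<Longrightarrow> z \<in> V \<Longrightarrow> a z (\<lambda>x. c * u x + w x) = c * a z u + a z w"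
    and definite: "\<And>u. u \<in> V \<Longrightarrow> a u u = 0 \<Longrightarrow> u = (\<lambda>_. 0)"
begin

definition "linear_on l \<longleftrightarrow> (\<forall>c u w. u \<in> V \<longrightarrow> w \<in> V \<longrightarrow> l (\<lambda>x. c * u x + w x) = c * l u + (l w :: real))"

definition "stiffness = Matrix.mat n n (\<lambda>(i, k). a (\<phi> k) (\<phi> i))"

definition "solves z l \<longleftrightarrow> z \<in> V \<and> (\<forall>v\<in>V. a z v = l v)"

lemma \<phi>_in: "i < n \<Longrightarrow> \<phi> i \<in> V" using basis by (simp add: is_basis_def)

lemma basis_expand: "v \<in> V \<Longrightarrow> \<exists>c. v = (\<lambda>x. \<Sum>i<n. c i * \<phi> i x)"
  using basis by (simp add: is_basis_def)

lemma combination_in: "(\<lambda>x. \<Sum>i<n. c i * \<phi> i x) \<in> V"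
  by (rule lincomb_sum(1)[OF zero closed \<phi>_in])

lemma linear_on_sum:
  assumes "linear_on l"
  shows "l (\<lambda>x. \<Sum>i<n. c i * \<phi> i x) = (\<Sum>i<n. c i * l (\<phi> i))"
proof -
  have "l (\<lambda>x. c * u x + w x) = c *\<^sub>R l u + l w" if "u \<in> V" "w \<in> V" for c u w
    using assms[unfolded linear_on_def, rule_format, OF that] by (simp only: real_scaleR_def)
  note lin = this
  have "l (\<lambda>x. \<Sum>i<n. c i * \<phi> i x) = (\<Sum>i<n. c i *\<^sub>R l (\<phi> i))"
    by (rule lincomb_sum(2)[where V=V and L=l]) (assumption | rule zero closed \<phi>_in lin)+
  then show ?thesis by (simp only: real_scaleR_def)
qed

lemma a_linear1: "z \<in> V \<Longrightarrow> linear_on (\<lambda>u. a u z)" and a_linear2: "z \<in> V \<Longrightarrow> linear_on (\<lambda>u. a z u)"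
  by (simp_all add: linear_on_def lin1 lin2)

lemma stiffness_carrier: "stiffness \<in> carrier_mat n n" by (simp add: stiffness_def)

lemma stiffness_mult:
  assumes "i < n" "v \<in> carrier_vec n"
  shows "(stiffness *\<^sub>v v) $ i = a (\<lambda>x. \<Sum>k<n. v $ k * \<phi> k x) (\<phi> i)"
proof -
  have "(stiffness *\<^sub>v v) $ i = (\<Sum>k<n. stiffness $$ (i, k) * v $ k)"
    by (rule mat_mult_vec_index[OF stiffness_carrier assms(2,1)])
  also have "\<dots> = (\<Sum>k<n. v $ k * a (\<phi> k) (\<phi> i))"
    by (rule sum.cong) (use assms in \<open>simp_all add: stiffness_def mult.commute\<close>)
  also have "\<dots> = a (\<lambda>x. \<Sum>k<n. v $ k * \<phi> k x) (\<phi> i)"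
    using linear_on_sum[OF a_linear1[OF \<phi>_in[OF assms(1)]]] by simp
  finally show ?thesis .
qed

text \<open>A kernel vector is the coefficient vector of some \<open>u\<close> orthogonal to all
  basis functions, so \<open>a u u = 0\<close> and definiteness gives \<open>u = 0\<close>.\<close>

lemma stiffness_inverse:
  "the (mat_inverse stiffness) \<in> carrier_mat n n" "stiffness * the (mat_inverse stiffness) = 1\<^sub>m n"
  "the (mat_inverse stiffness) * stiffness = 1\<^sub>m n"
proof -
  have "v = 0\<^sub>v n" if v: "v \<in> carrier_vec n" and z: "stiffness *\<^sub>v v = 0\<^sub>v n" for v
  proof -
    define u where "u = (\<lambda>x. \<Sum>k<n. v $ k * \<phi> k x)"
    have u: "u \<in> V" unfolding u_def by (rule combination_in)
    have "a u (\<phi> i) = 0" if "i < n" for i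
      using stiffness_mult[OF that v] z that by (simp add: u_def)
    then have "(\<Sum>i<n. v $ i * a u (\<phi> i)) = 0" by simp
    then have "a u u = 0" using linear_on_sum[OF a_linear2[OF u], of "\<lambda>i. v $ i"] by (simp add: u_def)
    then have "u = (\<lambda>_. 0)" by (rule definite[OF u])
    then have "\<forall>i<n. v $ i = 0" using basis unfolding is_basis_def u_def by blast
    then show ?thesis using v by (intro eq_vecI) auto
  qed
  from mat_inverse_injective[OF stiffness_carrier this] show
    "the (mat_inverse stiffness) \<in> carrier_mat n n" "stiffness * the (mat_inverse stiffness) = 1\<^sub>m n"
    "the (mat_inverse stiffness) * stiffness = 1\<^sub>m n" by auto
qed

lemma solves_coeffs:
  assumes l: "linear_on l" and v: "v \<in> carrier_vec n" and b: "b = Matrix.vec n (\<lambda>i. l (\<phi> i))"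
  shows "solves (\<lambda>x. \<Sum>k<n. v $ k * \<phi> k x) l \<longleftrightarrow> stiffness *\<^sub>v v = b"
proof
  let ?z = "\<lambda>x. \<Sum>k<n. v $ k * \<phi> k x"
  assume "solves ?z l"
  then show "stiffness *\<^sub>v v = b"
    using stiffness_mult[OF _ v] \<phi>_in by (intro eq_vecI) (auto simp: b solves_def stiffness_def)
next
  let ?z = "\<lambda>x. \<Sum>k<n. v $ k * \<phi> k x"
  assume eq: "stiffness *\<^sub>v v = b"
  have e: "a ?z (\<phi> i) = l (\<phi> i)" if "i < n" for i
    using stiffness_mult[OF that v] eq that by (simp add: b)
  have "a ?z w = l w" if w: "w \<in> V" for w
  proof -
    obtain c where c: "w = (\<lambda>x. \<Sum>i<n. c i * \<phi> i x)" using basis_expand[OF w] by blast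
    show ?thesis unfolding c using linear_on_sum[OF a_linear2[OF combination_in], of "\<lambda>k. v $ k" c]
        linear_on_sum[OF l, of c] e by simp
  qed
  then show "solves ?z l" using combination_in by (simp add: solves_def)
qed

lemma solves_unique:
  assumes "solves z l" "solves w l" shows "z = w"
proof -
  have V: "z \<in> V" "w \<in> V" using assms by (auto simp: solves_def)
  define u where "u = (\<lambda>x. -1 * w x + z x)"
  have u: "u \<in> V" unfolding u_def by (rule closed[OF V(2,1)])
  have "a u u = -1 * a w u + a z u" using lin1[OF V(2,1) u, of "-1"] by (simp add: u_def)
  also have "\<dots> = 0" using assms u by (simp add: solves_def)
  finally have "u = (\<lambda>_. 0)" by (rule definite[OF u])
  then show ?thesis by (auto simp: u_def fun_eq_iff)
qed

lemma solves_exists: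
  assumes l: "linear_on l" shows "\<exists>z. solves z l"
proof -
  let ?b = "Matrix.vec n (\<lambda>i. l (\<phi> i))"
  let ?v = "the (mat_inverse stiffness) *\<^sub>v ?b"
  have v: "?v \<in> carrier_vec n" using stiffness_inverse(1) by auto
  have "stiffness *\<^sub>v ?v = (stiffness * the (mat_inverse stiffness)) *\<^sub>v ?b"
    by (rule assoc_mult_mat_vec[symmetric, OF stiffness_carrier stiffness_inverse(1)]) simp
  also have "\<dots> = ?b" by (simp add: stiffness_inverse(2))
  finally show ?thesis using solves_coeffs[OF l v refl] by blast
qed

lemma solves_The: "linear_on l \<Longrightarrow> solves (THE z. solves z l) l"
  using solves_exists[of l] solves_unique by (metis theI)

lemma stiffness_inverse_mult:
  assumes "v \<in> carrier_vec n" "stiffness *\<^sub>v v = b"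
  shows "the (mat_inverse stiffness) *\<^sub>v b = v"
proof -
  have "the (mat_inverse stiffness) *\<^sub>v b = (the (mat_inverse stiffness) * stiffness) *\<^sub>v v"
    unfolding assms(2)[symmetric]
    by (rule assoc_mult_mat_vec[symmetric, OF stiffness_inverse(1) stiffness_carrier assms(1)])
  also have "\<dots> = v" unfolding stiffness_inverse(3) using assms(1) by simp
  finally show ?thesis .
qed

lemma load_stiffness_vec:
  assumes l: "linear_on l" and z: "solves z l"
  shows "\<exists>v \<in> carrier_vec n. z = (\<lambda>x. \<Sum>k<n. v $ k * \<phi> k x) \<and>
    the (mat_inverse stiffness) *\<^sub>v Matrix.vec n (\<lambda>i. l (\<phi> i)) = v"
proof -
  have "z \<in> V" using z by (simp add: solves_def)
  then obtain c where c: "z = (\<lambda>x. \<Sum>k<n. c k * \<phi> k x)" using basis_expand by blast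
  define v where "v = Matrix.vec n c"
  have v: "v \<in> carrier_vec n" by (simp add: v_def)
  have zv: "z = (\<lambda>x. \<Sum>k<n. v $ k * \<phi> k x)" by (simp add: c v_def)
  have "solves (\<lambda>x. \<Sum>k<n. v $ k * \<phi> k x) l" using z zv by (rule back_subst)
  then have "stiffness *\<^sub>v v = Matrix.vec n (\<lambda>i. l (\<phi> i))"
    by (rule solves_coeffs[OF l v refl, THEN iffD1])
  from stiffness_inverse_mult[OF v this] v zv show ?thesis by blast
qed

text \<open>Column \<open>j\<close> of the inverse stiffness matrix times \<open>B\<close> holds the
  coefficients of the solution \<open>z j\<close>, and row \<open>i\<close> of the transpose of
  \<open>B\<close> applies the functional \<open>l i\<close> to it.\<close>

lemma load_stiffness_entry:
  assumes l: "\<And>j. j < N \<Longrightarrow> linear_on (l j)" and z: "\<And>j. j < N \<Longrightarrow> solves (z j) (l j)"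
    and B: "B = Matrix.mat n N (\<lambda>(i, j). l j (\<phi> i))" and ij: "i < N" "j < N"
  shows "(transpose_mat B * the (mat_inverse stiffness) * B) $$ (i, j) = l i (z j)"
proof -
  define S where "S = the (mat_inverse stiffness)"
  have S: "S \<in> carrier_mat n n" unfolding S_def by (rule stiffness_inverse(1))
  obtain v where v: "v \<in> carrier_vec n" and zv: "z j = (\<lambda>x. \<Sum>k<n. v $ k * \<phi> k x)"
    and Sv: "S *\<^sub>v Matrix.vec n (\<lambda>i. l j (\<phi> i)) = v"
    using load_stiffness_vec[OF l[OF ij(2)] z[OF ij(2)]] unfolding S_def by blast
  have Bc: "B \<in> carrier_mat n N" by (simp add: B)
  have colB: "Matrix.col B j = Matrix.vec n (\<lambda>i. l j (\<phi> i))" using ij by (intro eq_vecI) (auto simp: B)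
  have Bt: "transpose_mat B \<in> carrier_mat N n" using Bc by simp
  have "Matrix.col (S * B) j = S *\<^sub>v Matrix.col B j" by (rule col_mult2[OF S Bc ij(2)])
  then have col: "Matrix.col (S * B) j = v" by (simp only: colB Sv)
  have "transpose_mat B * S * B = transpose_mat B * (S * B)" by (rule assoc_mult_mat[OF Bt S Bc])
  also have "(transpose_mat B * (S * B)) $$ (i, j) = scalar_prod (Matrix.row (transpose_mat B) i) (Matrix.col (S * B) j)"
    by (rule index_mult_mat) (use ij Bc in simp_all)
  also have "\<dots> = (\<Sum>k<n. B $$ (k, i) * v $ k)"
    unfolding col scalar_prod_def using ij v Bc by (intro sum.cong) (auto simp: lessThan_atLeast0)
  also have "\<dots> = (\<Sum>k<n. v $ k * l i (\<phi> k))"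
    by (rule sum.cong) (use ij in \<open>simp_all add: B mult.commute\<close>)
  also have "\<dots> = l i (z j)" unfolding zv by (rule linear_on_sum[OF l[OF ij(1)], symmetric])
  finally show ?thesis unfolding S_def .
qed

end


section \<open>Rayleigh quotients\<close>

text \<open>Coefficients are functions on \<open>nat\<close>, whose product topology supplies the
  compactness used to attain the maximum.\<close>

definition bilinear_sum :: "nat \<Rightarrow> (nat \<Rightarrow> nat \<Rightarrow> real) \<Rightarrow> (nat \<Rightarrow> real) \<Rightarrow> (nat \<Rightarrow> real) \<Rightarrow> real" where
  "bilinear_sum N A u w = (\<Sum>i<N. \<Sum>j<N. u i * A i j * w j)"

lemma bilinear_sum_add_right:
  "bilinear_sum N A u (\<lambda>i. w i + t * z i) = bilinear_sum N A u w + t * bilinear_sum N A u z"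
  by (simp add: bilinear_sum_def distrib_left sum.distrib sum_distrib_left algebra_simps)

lemma bilinear_sum_add_left:
  "bilinear_sum N A (\<lambda>i. w i + t * z i) u = bilinear_sum N A w u + t * bilinear_sum N A z u"
  by (simp add: bilinear_sum_def distrib_left sum.distrib sum_distrib_left algebra_simps)

lemma bilinear_sum_commute:
  assumes "\<And>i j. i < N \<Longrightarrow> j < N \<Longrightarrow> A i j = A j i"
  shows "bilinear_sum N A u w = bilinear_sum N A w u"
proof -
  have "bilinear_sum N A u w = (\<Sum>j<N. \<Sum>i<N. u i * A i j * w j)" unfolding bilinear_sum_def by (rule sum.swap)
  also have "\<dots> = bilinear_sum N A w u"
    unfolding bilinear_sum_def by (intro sum.cong refl) (simp add: assms mult.commute mult.left_commute)
  finally show ?thesis .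
qed

lemma bilinear_sum_scale: "bilinear_sum N A (\<lambda>i. t * u i) (\<lambda>i. t * u i) = t\<^sup>2 * bilinear_sum N A u u"
  by (simp add: bilinear_sum_def sum_distrib_left power2_eq_square algebra_simps)

lemma bilinear_sum_diff_matrix:
  "bilinear_sum N (\<lambda>i j. l * M i j - A i j) u w = l * bilinear_sum N M u w - bilinear_sum N A u w"
  by (simp add: bilinear_sum_def sum_distrib_left sum_subtractf algebra_simps)

text \<open>A closed subset of a product of compact sets. Coordinates from \<open>N\<close> on are
  pinned to 0, and the bound by 1 on the others follows from the norm condition, so this is the
  whole unit sphere.\<close>

lemma compact_unit_sphere_functions:
  "compact {c :: nat \<Rightarrow> real. (\<forall>i. c i \<in> (if i < N then {-1..1} else {0})) \<and> (\<Sum>i<N. (c i)\<^sup>2) = 1}"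
proof -
  let ?S = "\<lambda>i. if i < N then {-1..1} else {0::real}"
  have "compactin (product_topology (\<lambda>_. euclidean) UNIV) (PiE UNIV ?S)"
    by (subst compactin_PiE) (auto split: if_splits)
  then have c: "compact (PiE UNIV ?S)" unfolding euclidean_product_topology compactin_euclidean_iff .
  have "closed {c :: nat \<Rightarrow> real. (\<Sum>i<N. (c i)\<^sup>2) = 1}"
    by (intro closed_Collect_eq continuous_on_sum continuous_on_power continuous_on_product_coordinates continuous_on_const)
  then have "compact (PiE UNIV ?S \<inter> {c. (\<Sum>i<N. (c i)\<^sup>2) = 1})" by (rule compact_Int_closed[OF c])
  moreover have "PiE UNIV ?S \<inter> {c. (\<Sum>i<N. (c i)\<^sup>2) = 1} = {c. (\<forall>i. c i \<in> ?S i) \<and> (\<Sum>i<N. (c i)\<^sup>2) = 1}"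
    unfolding PiE_UNIV_domain Pi_def by blast
  ultimately show ?thesis by (simp only:)
qed

text \<open>The quotient is continuous and attains its maximum on the compact sphere. It is
  invariant under scaling and ignores coordinates from \<open>N\<close> on, so this is the maximum
  over all nonzero coefficients.\<close>

lemma rayleigh_max_exists:
  fixes A M :: "nat \<Rightarrow> nat \<Rightarrow> real"
  assumes N: "N > 0" and pos: "\<And>c. \<exists>i<N. c i \<noteq> 0 \<Longrightarrow> bilinear_sum N M c c > 0"
  shows "\<exists>c0. (\<exists>i<N. c0 i \<noteq> 0) \<and> (\<forall>c. (\<exists>i<N. c i \<noteq> 0) \<longrightarrow>
     bilinear_sum N A c c / bilinear_sum N M c c \<le> bilinear_sum N A c0 c0 / bilinear_sum N M c0 c0)"
proof -
  define K where "K = {c :: nat \<Rightarrow> real. (\<forall>i. c i \<in> (if i < N then {-1..1} else {0})) \<and> (\<Sum>i<N. (c i)\<^sup>2) = 1}"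
  let ?R = "\<lambda>c. bilinear_sum N A c c / bilinear_sum N M c c"
  have nz: "\<exists>i<N. c i \<noteq> 0" if "c \<in> K" for c
  proof (rule ccontr)
    assume "\<not> ?thesis"
    then have "(\<Sum>i<N. (c i)\<^sup>2) = 0" by simp
    then show False using that by (simp add: K_def)
  qed
  have cont: "continuous_on UNIV (\<lambda>c. bilinear_sum N B c c)" for B
    unfolding bilinear_sum_def by (intro continuous_on_sum continuous_on_mult continuous_on_product_coordinates continuous_on_const)
  have cR: "continuous_on K ?R"
  proof (rule continuous_on_divide)
    show "\<forall>c\<in>K. bilinear_sum N M c c \<noteq> 0"
    proof
      fix c assume "c \<in> K"
      from pos[OF nz[OF this]] show "bilinear_sum N M c c \<noteq> 0" by linarith
    qed
  qed (rule continuous_on_subset[OF cont], simp)+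
  have "(\<lambda>i. if i = 0 then 1 else 0) \<in> K"
  proof -
    have "(\<Sum>i<N. (if i = 0 then 1 else 0 :: real)\<^sup>2) = (\<Sum>i<N. if i = 0 then 1 else 0)" by (rule sum.cong) auto
    also have "\<dots> = 1" using N by (simp add: sum.delta)
    finally show ?thesis unfolding K_def using N by simp
  qed
  then have "K \<noteq> {}" by blast
  from continuous_attains_sup[OF compact_unit_sphere_functions[of N, folded K_def] this cR]
  obtain c0 where c0: "c0 \<in> K" "\<And>c. c \<in> K \<Longrightarrow> ?R c \<le> ?R c0" by blast
  have "?R c \<le> ?R c0" if c: "\<exists>i<N. c i \<noteq> 0" for c
  proof -
    define s where "s = (\<Sum>i<N. (c i)\<^sup>2)"
    obtain k where k: "k < N" "c k \<noteq> 0" using c by blast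
    have le: "(c i)\<^sup>2 \<le> s" if "i < N" for i
      unfolding s_def by (rule member_le_sum) (use that in auto)
    have s: "s > 0" using le[OF k(1)] k(2) by (meson less_le_trans zero_less_power2)
    define t where "t = 1 / sqrt s"
    have t: "t > 0" "t\<^sup>2 * s = 1" using s by (simp_all add: t_def power_divide)
    define d where "d = (\<lambda>i. if i < N then t * c i else 0)"
    have eq: "bilinear_sum N B d d = t\<^sup>2 * bilinear_sum N B c c" for B
      unfolding bilinear_sum_scale[symmetric] unfolding bilinear_sum_def d_def by (intro sum.cong refl) simp
    have sum1: "(\<Sum>i<N. (d i)\<^sup>2) = 1"
    proof -
      have "(\<Sum>i<N. (d i)\<^sup>2) = t\<^sup>2 * s" unfolding s_def sum_distrib_left d_def by (intro sum.cong refl) (simp add: power_mult_distrib)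
      then show ?thesis by (simp add: t(2))
    qed
    have bd: "d i \<in> {-1..1}" if "i < N" for i
    proof -
      have "(d i)\<^sup>2 \<le> (\<Sum>i<N. (d i)\<^sup>2)" by (rule member_le_sum) (use that in auto)
      then have "\<bar>d i\<bar> \<le> 1" using sum1 by (simp add: abs_square_le_1)
      then show ?thesis by (simp add: abs_le_iff)
    qed
    have "d \<in> K" unfolding K_def using sum1 bd by (simp add: d_def)
    then have "?R d \<le> ?R c0" by (rule c0(2))
    then show ?thesis using t(1) by (simp add: eq)
  qed
  then show ?thesis using nz[OF c0(1)] by blast
qed

text \<open>A null direction of a positive semidefinite form minimises the form, hence its first
  variation in every direction \<open>w\<close> vanishes.\<close>

lemma psd_kernel:
  assumes sym: "\<And>i j. i < N \<Longrightarrow> j < N \<Longrightarrow> B i j = B j i" and psd: "\<And>c. bilinear_sum N B c c \<ge> 0"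
    and z: "bilinear_sum N B c c = 0"
  shows "bilinear_sum N B w c = 0"
proof -
  define \<beta> where "\<beta> = bilinear_sum N B w c"
  define q where "q = bilinear_sum N B w w"
  have comm: "bilinear_sum N B c w = \<beta>" unfolding \<beta>_def by (rule bilinear_sum_commute) (rule sym)
  have q: "q \<ge> 0" unfolding q_def by (rule psd)
  have ineq: "0 \<le> 2 * t * \<beta> + t\<^sup>2 * q" for t
  proof -
    have "0 \<le> bilinear_sum N B (\<lambda>i. c i + t * w i) (\<lambda>i. c i + t * w i)" by (rule psd)
    also have "\<dots> = 2 * t * \<beta> + t\<^sup>2 * q"
      unfolding bilinear_sum_add_left bilinear_sum_add_right z comm
      by (simp add: \<beta>_def q_def power2_eq_square algebra_simps)
    finally show ?thesis .
  qed
  \<comment> \<open>Close to the minimiser \<open>- \<beta> / q\<close>, but defined for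
    \<open>q = 0\<close> too; the quadratic there, times \<open>(q + 1)\<^sup>2\<close>, is
    \<open>- (\<beta>\<^sup>2 * (q + 2))\<close>.\<close>
  define r where "r = - \<beta> / (q + 1)"
  have "(q + 1)\<^sup>2 * (2 * r * \<beta> + r\<^sup>2 * q) = - (\<beta>\<^sup>2 * (q + 2))"
  proof -
    have rq: "r * (q + 1) = - \<beta>" using q by (simp add: r_def)
    have "(q + 1)\<^sup>2 * (2 * r * \<beta> + r\<^sup>2 * q) = 2 * (r * (q + 1)) * \<beta> * (q + 1) + (r * (q + 1))\<^sup>2 * q"
      by (simp add: power2_eq_square algebra_simps)
    then show ?thesis unfolding rq by (simp add: power2_eq_square algebra_simps)
  qed
  moreover have "(q + 1)\<^sup>2 * (2 * r * \<beta> + r\<^sup>2 * q) \<ge> 0" using ineq[of r] by simp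
  ultimately have "\<beta>\<^sup>2 * (q + 2) \<le> 0" by simp
  moreover have "\<beta>\<^sup>2 * 2 \<le> \<beta>\<^sup>2 * (q + 2)" using q by (intro mult_left_mono) auto
  ultimately have "\<beta>\<^sup>2 \<le> 0" by linarith
  then show ?thesis by (simp add: \<beta>_def)
qed

lemma scalar_prod_bilinear_sum:
  assumes "A \<in> carrier_mat N N" "u \<in> carrier_vec N" "v \<in> carrier_vec N"
  shows "scalar_prod u (A *\<^sub>v v) = bilinear_sum N (\<lambda>i j. A $$ (i, j)) (\<lambda>i. u $ i) (\<lambda>i. v $ i)"
proof -
  have "scalar_prod u (A *\<^sub>v v) = (\<Sum>i<N. u $ i * (A *\<^sub>v v) $ i)"
    using assms by (simp add: scalar_prod_def lessThan_atLeast0)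
  also have "\<dots> = (\<Sum>i<N. u $ i * (\<Sum>k<N. A $$ (i, k) * v $ k))"
    by (intro sum.cong refl) (simp add: mat_mult_vec_index[OF assms(1,3)])
  also have "\<dots> = bilinear_sum N (\<lambda>i j. A $$ (i, j)) (\<lambda>i. u $ i) (\<lambda>i. v $ i)"
    by (simp add: bilinear_sum_def sum_distrib_left mult.assoc)
  finally show ?thesis .
qed

text \<open>For the maximal quotient \<open>l\<close> the form of \<open>l M - A\<close> is positive
  semidefinite and vanishes at a maximiser, which therefore lies in its kernel and is an
  eigenvector. Conversely, any eigenvalue is the Rayleigh quotient of its eigenvector, so none
  exceeds \<open>l\<close>.\<close>

lemma max_rayleigh_eigenvalue:
  fixes A M :: "real Matrix.mat"
  assumes N: "N > 0" and A: "A \<in> carrier_mat N N" and M: "M \<in> carrier_mat N N"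
    and symA: "\<And>i j. i < N \<Longrightarrow> j < N \<Longrightarrow> A $$ (i, j) = A $$ (j, i)"
    and symM: "\<And>i j. i < N \<Longrightarrow> j < N \<Longrightarrow> M $$ (i, j) = M $$ (j, i)"
    and pos: "\<And>c. \<exists>i<N. c i \<noteq> 0 \<Longrightarrow> bilinear_sum N (\<lambda>i j. M $$ (i, j)) c c > 0"
  shows "\<exists>l. is_maximum (rayleigh_quotient A M ` (carrier_vec N - {0\<^sub>v N})) l \<and>
    is_maximum {l. gen_eigenvalue A M l} l"
proof -
  let ?A = "\<lambda>i j. A $$ (i, j)" and ?M = "\<lambda>i j. M $$ (i, j)"
  obtain c0 where c0: "\<exists>i<N. c0 i \<noteq> 0" and max: "\<And>c. \<exists>i<N. c i \<noteq> 0 \<Longrightarrow>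
     bilinear_sum N ?A c c / bilinear_sum N ?M c c \<le> bilinear_sum N ?A c0 c0 / bilinear_sum N ?M c0 c0"
    using rayleigh_max_exists[OF N pos, of ?A] by blast
  define l where "l = bilinear_sum N ?A c0 c0 / bilinear_sum N ?M c0 c0"
  define v0 where "v0 = Matrix.vec N c0"
  have v0: "v0 \<in> carrier_vec N" by (simp add: v0_def)
  have v0n: "v0 \<noteq> 0\<^sub>v N"
  proof
    assume "v0 = 0\<^sub>v N"
    then have "\<forall>i<N. v0 $ i = 0" by simp
    then show False using c0 by (auto simp: v0_def)
  qed
  have vc: "bilinear_sum N B (\<lambda>i. v0 $ i) (\<lambda>i. v0 $ i) = bilinear_sum N B c0 c0" for B
    unfolding bilinear_sum_def v0_def by (intro sum.cong refl) simp
  have rq: "rayleigh_quotient A M v = bilinear_sum N ?A (\<lambda>i. v $ i) (\<lambda>i. v $ i) / bilinear_sum N ?M (\<lambda>i. v $ i) (\<lambda>i. v $ i)"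
    if "v \<in> carrier_vec N" for v
    by (simp only: rayleigh_quotient_def scalar_prod_bilinear_sum[OF A that that] scalar_prod_bilinear_sum[OF M that that])
  have nz: "\<exists>i<N. v $ i \<noteq> 0" if v: "v \<in> carrier_vec N" "v \<noteq> 0\<^sub>v N" for v
  proof (rule ccontr)
    assume n: "\<not> ?thesis"
    have "v = 0\<^sub>v N" by (rule eq_vecI) (use n v(1) in auto)
    then show False using v(2) by simp
  qed
  have le: "rayleigh_quotient A M v \<le> l" if "v \<in> carrier_vec N" "v \<noteq> 0\<^sub>v N" for v
    unfolding rq[OF that(1)] l_def by (rule max[OF nz[OF that]])
  have l0: "rayleigh_quotient A M v0 = l" unfolding rq[OF v0] vc l_def ..
  have 1: "is_maximum (rayleigh_quotient A M ` (carrier_vec N - {0\<^sub>v N})) l"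
    unfolding is_maximum_def
  proof (intro conjI ballI)
    show "l \<in> rayleigh_quotient A M ` (carrier_vec N - {0\<^sub>v N})"
      by (rule image_eqI[of _ _ v0]) (use l0 v0 v0n in auto)
  qed (use le in auto)
  let ?B = "\<lambda>i j. l * ?M i j - ?A i j"
  have psd: "bilinear_sum N ?B c c \<ge> 0" for c
  proof (cases "\<exists>i<N. c i \<noteq> 0")
    case True
    have "bilinear_sum N ?A c c \<le> l * bilinear_sum N ?M c c"
      using max[OF True, folded l_def] pos[OF True] by (simp add: divide_le_eq)
    then show ?thesis by (simp add: bilinear_sum_diff_matrix)
  next
    case False
    then show ?thesis by (simp add: bilinear_sum_def)
  qed
  have B0: "bilinear_sum N ?B c0 c0 = 0"
  proof -
    have "l * bilinear_sum N ?M c0 c0 = bilinear_sum N ?A c0 c0" using pos[OF c0] by (simp add: l_def)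
    then show ?thesis by (simp only: bilinear_sum_diff_matrix diff_self)
  qed
  have ev: "A *\<^sub>v v0 = l \<cdot>\<^sub>v (M *\<^sub>v v0)"
  proof (rule eq_vecI)
    fix i assume "i < dim_vec (l \<cdot>\<^sub>v (M *\<^sub>v v0))"
    then have i: "i < N" using M by simp
    \<comment> \<open>Testing the kernel property against the unit vector \<open>i\<close> reads off
      row \<open>i\<close> of the eigenvalue equation.\<close>
    have "0 = bilinear_sum N ?B (\<lambda>k. if k = i then 1 else 0) c0"
      by (rule psd_kernel[OF _ psd B0, symmetric]) (simp add: symA symM)
    also have "\<dots> = (\<Sum>k<N. if k = i then \<Sum>j<N. ?B k j * c0 j else 0)"
      unfolding bilinear_sum_def by (intro sum.cong refl) simp
    also have "\<dots> = (\<Sum>j<N. ?B i j * c0 j)" using i by (simp add: sum.delta)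
    also have "\<dots> = l * (\<Sum>j<N. ?M i j * c0 j) - (\<Sum>j<N. ?A i j * c0 j)"
      by (simp add: sum_subtractf sum_distrib_left algebra_simps)
    also have "(\<Sum>j<N. ?M i j * c0 j) = (M *\<^sub>v v0) $ i"
      unfolding mat_mult_vec_index[OF M v0 i] by (intro sum.cong refl) (simp add: v0_def)
    also have "(\<Sum>j<N. ?A i j * c0 j) = (A *\<^sub>v v0) $ i"
      unfolding mat_mult_vec_index[OF A v0 i] by (intro sum.cong refl) (simp add: v0_def)
    finally show "(A *\<^sub>v v0) $ i = (l \<cdot>\<^sub>v (M *\<^sub>v v0)) $ i" using i M by simp
  qed (use A M in simp)
  have 2: "is_maximum {l. gen_eigenvalue A M l} l"
    unfolding is_maximum_def
  proof (intro conjI ballI CollectI)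
    show "gen_eigenvalue A M l" unfolding gen_eigenvalue_def using v0 v0n ev A by (intro bexI[of _ v0]) auto
    fix s assume "s \<in> {l. gen_eigenvalue A M l}"
    then obtain v where v: "v \<in> carrier_vec N" "v \<noteq> 0\<^sub>v N" "A *\<^sub>v v = s \<cdot>\<^sub>v (M *\<^sub>v v)"
      using A by (auto simp: gen_eigenvalue_def)
    have Mv: "M *\<^sub>v v \<in> carrier_vec N" by (rule mult_mat_vec_carrier[OF M v(1)])
    have p: "scalar_prod v (M *\<^sub>v v) > 0"
      unfolding scalar_prod_bilinear_sum[OF M v(1) v(1)] by (rule pos[OF nz[OF v(1,2)]])
    have "scalar_prod v (A *\<^sub>v v) = s * scalar_prod v (M *\<^sub>v v)"
      unfolding v(3) by (rule scalar_prod_smult_right) (use v(1) Mv M in auto)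
    then have "rayleigh_quotient A M v = s" using p by (simp add: rayleigh_quotient_def)
    then show "s \<le> l" using le[OF v(1,2)] by simp
  qed
  show ?thesis using 1 2 by blast
qed


section \<open>The Marini gap\<close>

context mesh begin

lemma X_props:
  assumes g: "g \<in> X_space \<T>"
  shows "g \<in> pw_affine_space \<T>" and "T \<in> \<T> \<Longrightarrow> slope T g = 0"
    and "T \<in> \<T> \<Longrightarrow> x \<in> interior T \<Longrightarrow> g x = offset T g" and "T \<in> \<T> \<Longrightarrow> elem_value g T = offset T g"
proof -
  have c: "\<exists>c. \<forall>x\<in>interior T. g x = c" if "T \<in> \<T>" for T using g that unfolding X_space_def by blast
  have "\<exists>a c. \<forall>x\<in>interior T. g x = inner a x + c" if T: "T \<in> \<T>" for T
  proof -
    obtain c where "\<forall>x\<in>interior T. g x = c" using c[OF T] by blast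
    then have "\<forall>x\<in>interior T. g x = inner 0 x + c" by simp
    then show ?thesis by blast
  qed
  then show pg: "g \<in> pw_affine_space \<T>" using g unfolding X_space_def pw_affine_space_def by blast
  show s: "slope T g = 0" if T: "T \<in> \<T>" for T
  proof -
    obtain c where "\<forall>x\<in>interior T. g x = c" using c[OF T] by blast
    then have "\<And>x. x \<in> interior T \<Longrightarrow> g x = inner 0 x + c" by simp
    then show ?thesis by (rule affine_coeffs_unique(1)[OF T])
  qed
  show o: "g x = offset T g" if T: "T \<in> \<T>" and x: "x \<in> interior T" for T x
    using pw_affine_eq[OF pg T x] s[OF T] by simp
  show "elem_value g T = offset T g" if T: "T \<in> \<T>" for T
    unfolding elem_value_def
  proof (rule the_equality)
    show "\<forall>x\<in>interior T. g x = offset T g" using o[OF T] by blast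
    fix c assume "\<forall>x\<in>interior T. g x = c"
    then show "c = offset T g" using element_interior_nonempty[OF T] o[OF T] by (metis ex_in_conv)
  qed
qed

lemma X_I:
  assumes "\<And>T x. T \<in> \<T> \<Longrightarrow> x \<in> interior T \<Longrightarrow> g x = k T" "\<And>x. x \<notin> (\<Union>T\<in>\<T>. interior T) \<Longrightarrow> g x = 0"
  shows "g \<in> X_space \<T>"
  unfolding X_space_def mem_Collect_eq using assms by blast

lemma X_lincomb:
  assumes "f \<in> X_space \<T>" "g \<in> X_space \<T>"
  shows "(\<lambda>x. c * f x + g x) \<in> X_space \<T>"
proof (rule X_I[where k="\<lambda>T. c * offset T f + offset T g"])
  fix x assume x: "x \<notin> (\<Union>T\<in>\<T>. interior T)"
  show "c * f x + g x = 0"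
    using pw_affine_outside[OF X_props(1)[OF assms(1)] x] pw_affine_outside[OF X_props(1)[OF assms(2)] x] by simp
qed (simp only: X_props(3)[OF assms(1)] X_props(3)[OF assms(2)])

lemma X_zero: "(\<lambda>_. 0) \<in> X_space \<T>" by (rule X_I[where k="\<lambda>_. 0"]) simp_all

lemma mesh_nonempty: "\<T> \<noteq> {}"
  using Union_mesh domain_nonempty closure_subset[of \<Omega>] by auto

text \<open>Keeps the supremum in \<open>kappa_M\<close> from ranging over the empty set, and gives
  \<open>N > 0\<close>.\<close>

lemma X_nontrivial: "\<exists>g\<in>X_space \<T>. g \<noteq> (\<lambda>_. 0)"
proof -
  let ?g = "pw_sum (\<lambda>T x. 1 :: real)"
  have "?g \<in> X_space \<T>"
    by (rule X_I[where k="\<lambda>_. 1"]) (simp_all only: pw_sum_inside pw_sum_outside not_False_eq_True)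
  moreover have "?g \<noteq> (\<lambda>_. 0)"
  proof -
    obtain T x where "T \<in> \<T>" "x \<in> interior T" using mesh_nonempty element_interior_nonempty by blast
    then have "?g x = 1" by (rule pw_sum_inside)
    then show ?thesis by (metis zero_neq_one)
  qed
  ultimately show ?thesis by blast
qed

lemma X_L2_inner:
  assumes f: "f \<in> X_space \<T>" and g: "g \<in> X_space \<T>"
  shows "L2_inner \<Omega> f g = (\<Sum>T\<in>\<T>. vol T * (offset T f * offset T g))"
proof -
  have b: "(\<lambda>x. f x * g x) \<in> borel_measurable borel" by (intro borel_measurable_times pw_affine_borel X_props(1) f g)
  have "L2_inner \<Omega> f g = (\<Sum>T\<in>\<T>. integral\<^sup>L (lebesgue_on (interior T)) (\<lambda>_. offset T f * offset T g))"
    unfolding L2_inner_real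
    by (rule integral_mesh_pieces(2)[OF b]) (simp_all add: X_props(3)[OF f] X_props(3)[OF g])
  also have "\<dots> = (\<Sum>T\<in>\<T>. vol T * (offset T f * offset T g))" by (intro sum.cong refl integral_const_interior)
  finally show ?thesis .
qed

lemma X_L2_inner_pos:
  assumes g: "g \<in> X_space \<T>" and nz: "g \<noteq> (\<lambda>_. 0)"
  shows "L2_inner \<Omega> g g > 0"
proof -
  have nn: "\<And>T. T \<in> \<T> \<Longrightarrow> 0 \<le> vol T * (offset T g * offset T g)" using vol_pos by (simp add: less_imp_le)
  have "\<exists>T\<in>\<T>. offset T g \<noteq> 0"
  proof (rule ccontr)
    assume n: "\<not> ?thesis"
    have "g x = 0" for x
    proof (cases "\<exists>T\<in>\<T>. x \<in> interior T")
      case True then show ?thesis using n X_props(3)[OF g] by metis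
    next
      case False then show ?thesis using pw_affine_outside[OF X_props(1)[OF g]] by blast
    qed
    then show False using nz by blast
  qed
  then obtain T where T: "T \<in> \<T>" "offset T g \<noteq> 0" by blast
  have "0 < vol T * (offset T g * offset T g)" using vol_pos[OF T(1)] T(2) by (simp add: zero_less_mult_iff) (use linorder_neqE_linordered_idom in blast)
  also have "\<dots> \<le> L2_inner \<Omega> g g"
    unfolding X_L2_inner[OF g g] by (rule member_le_sum[OF T(1) _ finite_mesh]) (use nn in blast)
  finally show ?thesis .
qed

definition "moment_form f g = 1 / (real DIM('a))\<^sup>2 * (\<Sum>T\<in>\<T>. second_moment T * elem_value f T * elem_value g T)"

lemma moment_form_lincomb:
  assumes f: "f \<in> X_space \<T>" and g: "g \<in> X_space \<T>" and h: "h \<in> X_space \<T>"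
  shows "moment_form (\<lambda>x. c * f x + g x) h = c * moment_form f h + moment_form g h"
proof -
  have "(\<Sum>T\<in>\<T>. second_moment T * elem_value (\<lambda>x. c * f x + g x) T * elem_value h T)
    = (\<Sum>T\<in>\<T>. c * (second_moment T * elem_value f T * elem_value h T) + second_moment T * elem_value g T * elem_value h T)"
  proof (rule sum.cong[OF refl])
    fix T assume T: "T \<in> \<T>"
    show "second_moment T * elem_value (\<lambda>x. c * f x + g x) T * elem_value h T
      = c * (second_moment T * elem_value f T * elem_value h T) + second_moment T * elem_value g T * elem_value h T"
      unfolding X_props(4)[OF X_lincomb[OF f g] T] X_props(4)[OF f T] X_props(4)[OF g T]
        pw_affine_lincomb(3)[OF X_props(1)[OF f] X_props(1)[OF g] T] by (simp add: algebra_simps)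
  qed
  then show ?thesis unfolding moment_form_def by (simp add: sum.distrib sum_distrib_left algebra_simps)
qed

lemma moment_form_commute: "moment_form f g = moment_form g f"
  unfolding moment_form_def by (simp add: mult.commute mult.left_commute)

lemma element_flux_integral:
  fixes A B :: 'a and a b :: real
  assumes T: "T \<in> \<T>"
  shows "integral\<^sup>L (lebesgue_on (interior T)) (\<lambda>x. inner (A - a *\<^sub>R (x - barycentre T)) (B - b *\<^sub>R (x - barycentre T)))
    = vol T * inner A B + a * b * second_moment T"
proof -
  let ?m = "lebesgue_on (interior T)" and ?y = "\<lambda>x. x - barycentre T"
  have i: "integrable ?m h" if "continuous_on UNIV h" for h :: "'a \<Rightarrow> real"
    by (rule lebesgue_on_interior_integral(1)[OF element_compact[OF T] element_convex[OF T] that])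
  have iy: "integrable ?m ?y"
    by (rule lebesgue_on_interior_integral(1)[OF element_compact[OF T] element_convex[OF T]]) (intro continuous_intros)
  have z: "integral\<^sup>L ?m (\<lambda>x. inner C (?y x)) = 0" for C
    using integral_inner_right[OF iy, of C] element_centroid[OF T] by simp
  have sm: "second_moment T = integral\<^sup>L ?m (\<lambda>x. (norm (?y x))\<^sup>2)"
    unfolding second_moment_def
    by (rule lebesgue_on_interior_integral(2)[OF element_compact[OF T] element_convex[OF T]]) (intro continuous_intros)
  have "integral\<^sup>L ?m (\<lambda>x. inner (A - a *\<^sub>R ?y x) (B - b *\<^sub>R ?y x))
     = integral\<^sup>L ?m (\<lambda>x. (inner A B + a * b * (norm (?y x))\<^sup>2) - (b * inner A (?y x) + a * inner B (?y x)))"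
    by (rule arg_cong[where f="integral\<^sup>L ?m"])
       (simp add: fun_eq_iff inner_diff_left inner_diff_right power2_norm_eq_inner inner_commute algebra_simps)
  also have "\<dots> = integral\<^sup>L ?m (\<lambda>x. inner A B + a * b * (norm (?y x))\<^sup>2) - integral\<^sup>L ?m (\<lambda>x. b * inner A (?y x) + a * inner B (?y x))"
    by (rule Bochner_Integration.integral_diff; rule i; intro continuous_intros)
  also have "integral\<^sup>L ?m (\<lambda>x. inner A B + a * b * (norm (?y x))\<^sup>2) = integral\<^sup>L ?m (\<lambda>x. inner A B) + integral\<^sup>L ?m (\<lambda>x. a * b * (norm (?y x))\<^sup>2)"
    by (rule Bochner_Integration.integral_add; rule i; intro continuous_intros)
  also have "integral\<^sup>L ?m (\<lambda>x. b * inner A (?y x) + a * inner B (?y x)) = integral\<^sup>L ?m (\<lambda>x. b * inner A (?y x)) + integral\<^sup>L ?m (\<lambda>x. a * inner B (?y x))"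
    by (rule Bochner_Integration.integral_add; rule i; intro continuous_intros)
  finally show ?thesis by (simp only: integral_mult_right_zero z sm integral_const_interior[OF T] mult_zero_right add_0_right diff_zero)
qed

lemma marini_flux_pw_sum:
  "marini_flux \<T> \<Omega> g = pw_sum (\<lambda>T x. broken_grad \<T> (z_CR \<T> \<Omega> g) x - (g x / real DIM('a)) *\<^sub>R (x - barycentre T))"
  by (rule ext) (simp only: marini_flux_def pw_sum_def)

text \<open>\<open>H10_grad\<close> is known only up to null sets, so the gap is replaced by the
  Borel function \<open>pw_sum (q g)\<close>: on each element the slope difference \<open>s\<close>
  minus the centred linear part.\<close>

lemma marini_gap_inner:
  assumes f: "f \<in> X_space \<T>" "z_CR \<T> \<Omega> f \<in> CR_space \<T> \<Omega>" "z_c \<T> \<Omega> f \<in> Vc_space \<T> \<Omega>"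
    and g: "g \<in> X_space \<T>" "z_CR \<T> \<Omega> g \<in> CR_space \<T> \<Omega>" "z_c \<T> \<Omega> g \<in> Vc_space \<T> \<Omega>"
  shows "L2_inner \<Omega> (marini_gap \<T> \<Omega> f) (marini_gap \<T> \<Omega> g)
    = (energy (z_CR \<T> \<Omega> f) (z_CR \<T> \<Omega> g) - energy (z_CR \<T> \<Omega> f) (z_c \<T> \<Omega> g)
       - energy (z_c \<T> \<Omega> f) (z_CR \<T> \<Omega> g) + energy (z_c \<T> \<Omega> f) (z_c \<T> \<Omega> g)) + moment_form f g"
proof -
  define s where "s = (\<lambda>g T. slope T (z_CR \<T> \<Omega> g) - slope T (z_c \<T> \<Omega> g))"
  define q where "q = (\<lambda>g T x. s g T - (offset T g / real DIM('a)) *\<^sub>R (x - barycentre T))"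
  have meas: "marini_gap \<T> \<Omega> g \<in> borel_measurable (lebesgue_on \<Omega>)"
    and qmeas: "pw_sum (q g) \<in> borel_measurable borel"
    and ae: "AE x in lebesgue_on \<Omega>. marini_gap \<T> \<Omega> g x = pw_sum (q g) x"
    if g: "g \<in> X_space \<T>" "z_CR \<T> \<Omega> g \<in> CR_space \<T> \<Omega>" "z_c \<T> \<Omega> g \<in> Vc_space \<T> \<Omega>" for g
  proof -
    note bz = broken_grad_borel[OF CR_pw_affine[OF g(2)]] and bg = pw_affine_borel[OF X_props(1)[OF g(1)]]
    have id: "(\<lambda>x. x - barycentre T) \<in> borel_measurable borel" for T :: "'a set"
      by (intro borel_measurable_continuous_onI continuous_intros)
    have "marini_flux \<T> \<Omega> g \<in> borel_measurable borel"
      unfolding marini_flux_pw_sum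
      by (rule pw_sum_borel) (intro borel_measurable_diff borel_measurable_scaleR borel_measurable_divide borel_measurable_const bz bg id)
    then show "marini_gap \<T> \<Omega> g \<in> borel_measurable (lebesgue_on \<Omega>)"
      unfolding marini_gap_def[abs_def]
      by (intro borel_measurable_diff borel_imp_lebesgue_on H10_grad_L2[OF g(3)])
    show "pw_sum (q g) \<in> borel_measurable borel"
      unfolding q_def by (rule pw_sum_borel) (intro borel_measurable_diff borel_measurable_scaleR borel_measurable_const id)
    have "AE x in lebesgue_on \<Omega>. \<exists>T\<in>\<T>. x \<in> interior T" by (rule AE_mesh) auto
    with Vc_grad[OF g(3)] show "AE x in lebesgue_on \<Omega>. marini_gap \<T> \<Omega> g x = pw_sum (q g) x"
    proof eventually_elim
      case (elim x)
      then obtain T where T: "T \<in> \<T>" "x \<in> interior T" by blast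
      have "marini_gap \<T> \<Omega> g x = (broken_grad \<T> (z_CR \<T> \<Omega> g) x - (g x / real DIM('a)) *\<^sub>R (x - barycentre T)) - broken_grad \<T> (z_c \<T> \<Omega> g) x"
        unfolding marini_gap_def marini_flux_pw_sum pw_sum_inside[OF T] elim(1) ..
      also have "\<dots> = q g T x"
        unfolding q_def s_def pw_affine_grad(3)[OF CR_pw_affine[OF g(2)] T] pw_affine_grad(3)[OF Vc_pw_affine[OF g(3)] T]
          X_props(3)[OF g(1) T] by simp
      finally show ?case unfolding pw_sum_inside[OF T] .
    qed
  qed
  have "L2_inner \<Omega> (marini_gap \<T> \<Omega> f) (marini_gap \<T> \<Omega> g) = L2_inner \<Omega> (pw_sum (q f)) (pw_sum (q g))"
    by (rule L2_inner_cong_AE[OF meas[OF f] borel_imp_lebesgue_on[OF qmeas[OF f]] meas[OF g] borel_imp_lebesgue_on[OF qmeas[OF g]] ae[OF f] ae[OF g]])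
  also have "\<dots> = (\<Sum>T\<in>\<T>. integral\<^sup>L (lebesgue_on (interior T)) (\<lambda>x. inner (q f T x) (q g T x)))"
    unfolding L2_inner_def
  proof (rule integral_mesh_pieces(2))
    show "(\<lambda>x. inner (pw_sum (q f) x) (pw_sum (q g) x)) \<in> borel_measurable borel"
      by (intro borel_measurable_inner qmeas f g)
    show "continuous_on UNIV (\<lambda>x. inner (q f T x) (q g T x))" for T
      unfolding q_def by (intro continuous_intros)
  qed (simp only: pw_sum_inside)
  also have "\<dots> = (\<Sum>T\<in>\<T>. vol T * inner (s f T) (s g T) + offset T f / real DIM('a) * (offset T g / real DIM('a)) * second_moment T)"
    unfolding q_def by (intro sum.cong refl element_flux_integral)
  also have "\<dots> = (\<Sum>T\<in>\<T>. vol T * inner (s f T) (s g T)) + moment_form f g"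
    unfolding sum.distrib moment_form_def sum_distrib_left
    by (intro arg_cong2[where f="(+)"] refl sum.cong)
       (simp add: X_props(4)[OF f(1)] X_props(4)[OF g(1)] power2_eq_square)
  also have "(\<Sum>T\<in>\<T>. vol T * inner (s f T) (s g T)) = energy (z_CR \<T> \<Omega> f) (z_CR \<T> \<Omega> g) - energy (z_CR \<T> \<Omega> f) (z_c \<T> \<Omega> g)
       - energy (z_c \<T> \<Omega> f) (z_CR \<T> \<Omega> g) + energy (z_c \<T> \<Omega> f) (z_c \<T> \<Omega> g)"
    unfolding s_def energy_def sum_subtractf[symmetric] sum.distrib[symmetric]
    by (intro sum.cong refl) (simp add: inner_diff_left inner_diff_right algebra_simps)
  finally show ?thesis .
qed

end

section \<open>The two Galerkin problems on a mesh and the matrix identities\<close>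

locale mesh_bases = mesh \<Omega> \<T> for \<Omega> :: "'a::euclidean_space set" and \<T> +
  fixes nc nCR :: nat and \<phi>c \<phi>CR :: "nat \<Rightarrow> 'a \<Rightarrow> real"
  assumes c_basis: "is_basis nc \<phi>c (Vc_space \<T> \<Omega>)"
    and CR_basis: "is_basis nCR \<phi>CR (CR_space \<T> \<Omega>)"
begin

sublocale CR: galerkin "CR_space \<T> \<Omega>" energy nCR \<phi>CR
proof
  fix c u w z assume *: "u \<in> CR_space \<T> \<Omega>" "w \<in> CR_space \<T> \<Omega>" "z \<in> CR_space \<T> \<Omega>"
  show "energy z (\<lambda>x. c * u x + w x) = c * energy z u + energy z w"
    by (rule energy_lincomb[OF CR_pw_affine[OF *(1)] CR_pw_affine[OF *(2)]])
  then show "energy (\<lambda>x. c * u x + w x) z = c * energy u z + energy w z"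
    by (simp only: energy_commute[of _ z])
qed (rule CR_zero CR_lincomb CR_basis CR_energy_definite; assumption)+

sublocale Vc: galerkin "Vc_space \<T> \<Omega>" energy nc \<phi>c
proof
  fix c u w z assume *: "u \<in> Vc_space \<T> \<Omega>" "w \<in> Vc_space \<T> \<Omega>" "z \<in> Vc_space \<T> \<Omega>"
  show "energy z (\<lambda>x. c * u x + w x) = c * energy z u + energy z w"
    by (rule energy_lincomb[OF Vc_pw_affine[OF *(1)] Vc_pw_affine[OF *(2)]])
  then show "energy (\<lambda>x. c * u x + w x) z = c * energy u z + energy w z"
    by (simp only: energy_commute[of _ z])
next
  fix u assume "u \<in> Vc_space \<T> \<Omega>" "energy u u = 0"
  \<comment> \<open>Definiteness on the conforming space is inherited from the larger
    Crouzeix-Raviart space.\<close>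
  then show "u = (\<lambda>_. 0)" using CR_energy_definite Vc_subset_CR by blast
qed (rule Vc_zero Vc_lincomb c_basis; assumption)+

lemma load_linear:
  assumes g: "g \<in> X_space \<T>"
  shows "CR.linear_on (L2_inner \<Omega> g)" "Vc.linear_on (L2_inner \<Omega> g)"
  unfolding CR.linear_on_def Vc.linear_on_def
  using L2_inner_lincomb[OF X_props(1)[OF g]] CR_pw_affine Vc_pw_affine by blast+

lemma z_CR_solves:
  assumes g: "g \<in> X_space \<T>" shows "CR.solves (z_CR \<T> \<Omega> g) (L2_inner \<Omega> g)"
proof -
  have "z_CR \<T> \<Omega> g = (THE z. CR.solves z (L2_inner \<Omega> g))"
    unfolding z_CR_def CR.solves_def
    by (rule arg_cong[where f=The]) (intro ext conj_cong ball_cong refl, simp only: broken_grad_energy CR_pw_affine)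
  then show ?thesis using CR.solves_The[OF load_linear(1)[OF g]] by (simp only:)
qed

lemma z_c_solves:
  assumes g: "g \<in> X_space \<T>" shows "Vc.solves (z_c \<T> \<Omega> g) (L2_inner \<Omega> g)"
proof -
  have "z_c \<T> \<Omega> g = (THE z. Vc.solves z (L2_inner \<Omega> g))"
    unfolding z_c_def Vc.solves_def
    by (rule arg_cong[where f=The]) (intro ext conj_cong ball_cong refl, simp only: H10_grad_energy)
  then show ?thesis using Vc.solves_The[OF load_linear(2)[OF g]] by (simp only:)
qed

text \<open>Of the four energies, the three that contain a conforming solution all equal
  \<open>L2_inner \<Omega> f (z_c \<T> \<Omega> g)\<close>, with signs that leave one negative
  copy.\<close>

lemma gap_form:
  assumes f: "f \<in> X_space \<T>" and g: "g \<in> X_space \<T>"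
  shows "L2_inner \<Omega> (marini_gap \<T> \<Omega> f) (marini_gap \<T> \<Omega> g)
    = L2_inner \<Omega> f (z_CR \<T> \<Omega> g) - L2_inner \<Omega> f (z_c \<T> \<Omega> g) + moment_form f g"
proof -
  have V: "z_CR \<T> \<Omega> f \<in> CR_space \<T> \<Omega>" "z_c \<T> \<Omega> f \<in> Vc_space \<T> \<Omega>" "z_CR \<T> \<Omega> g \<in> CR_space \<T> \<Omega>" "z_c \<T> \<Omega> g \<in> Vc_space \<T> \<Omega>"
    using z_CR_solves[OF f] z_c_solves[OF f] z_CR_solves[OF g] z_c_solves[OF g] by (simp_all add: CR.solves_def Vc.solves_def)
  have eCR: "energy (z_CR \<T> \<Omega> h) v = L2_inner \<Omega> h v" if "h \<in> X_space \<T>" "v \<in> CR_space \<T> \<Omega>" for h v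
    using z_CR_solves[OF that(1)] that(2) by (simp add: CR.solves_def)
  have ec: "energy (z_c \<T> \<Omega> h) v = L2_inner \<Omega> h v" if "h \<in> X_space \<T>" "v \<in> Vc_space \<T> \<Omega>" for h v
    using z_c_solves[OF that(1)] that(2) by (simp add: Vc.solves_def)
  have c: "z_c \<T> \<Omega> f \<in> CR_space \<T> \<Omega>" "z_c \<T> \<Omega> g \<in> CR_space \<T> \<Omega>" using V Vc_subset_CR by blast+
  have 1: "energy (z_CR \<T> \<Omega> f) (z_CR \<T> \<Omega> g) = L2_inner \<Omega> f (z_CR \<T> \<Omega> g)" by (rule eCR[OF f V(3)])
  have 2: "energy (z_CR \<T> \<Omega> f) (z_c \<T> \<Omega> g) = L2_inner \<Omega> f (z_c \<T> \<Omega> g)" by (rule eCR[OF f c(2)])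
  have 3: "energy (z_c \<T> \<Omega> f) (z_c \<T> \<Omega> g) = L2_inner \<Omega> f (z_c \<T> \<Omega> g)" by (rule ec[OF f V(4)])
  \<comment> \<open>This mixed term has its data on the wrong side: it is moved to \<open>g\<close>
    by the Crouzeix-Raviart equation and back to \<open>f\<close> by symmetry of the conforming
    one.\<close>
  have "energy (z_c \<T> \<Omega> f) (z_CR \<T> \<Omega> g) = energy (z_CR \<T> \<Omega> g) (z_c \<T> \<Omega> f)" by (rule energy_commute)
  also have "\<dots> = L2_inner \<Omega> g (z_c \<T> \<Omega> f)" by (rule eCR[OF g c(1)])
  also have "\<dots> = energy (z_c \<T> \<Omega> g) (z_c \<T> \<Omega> f)" by (rule ec[OF g V(2), symmetric])
  also have "\<dots> = L2_inner \<Omega> f (z_c \<T> \<Omega> g)" unfolding 3[symmetric] by (rule energy_commute)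
  finally show ?thesis unfolding marini_gap_inner[OF f V(1,2) g V(3,4)] 1 2 3 by simp
qed

text \<open>The right-hand side of \<open>gap_form\<close> contains \<open>f\<close> only through
  the load and the moments, so linearity in \<open>f\<close> can be read off without considering the
  solution maps.\<close>

lemma gap_form_lincomb:
  assumes f: "f \<in> X_space \<T>" and g: "g \<in> X_space \<T>" and h: "h \<in> X_space \<T>"
  shows "L2_inner \<Omega> (marini_gap \<T> \<Omega> (\<lambda>x. c * f x + g x)) (marini_gap \<T> \<Omega> h)
    = c * L2_inner \<Omega> (marini_gap \<T> \<Omega> f) (marini_gap \<T> \<Omega> h) + L2_inner \<Omega> (marini_gap \<T> \<Omega> g) (marini_gap \<T> \<Omega> h)"
proof -
  have p: "z_CR \<T> \<Omega> h \<in> pw_affine_space \<T>" "z_c \<T> \<Omega> h \<in> pw_affine_space \<T>"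
    using z_CR_solves[OF h] z_c_solves[OF h] CR_pw_affine Vc_pw_affine by (simp_all add: CR.solves_def Vc.solves_def)
  have l: "L2_inner \<Omega> (\<lambda>x. c * f x + g x) v = c * L2_inner \<Omega> f v + L2_inner \<Omega> g v" if "v \<in> pw_affine_space \<T>" for v
    using L2_inner_lincomb[OF that X_props(1)[OF f] X_props(1)[OF g], of c] by (simp only: L2_inner_commute[of v])
  show ?thesis
    unfolding gap_form[OF X_lincomb[OF f g] h] gap_form[OF f h] gap_form[OF g h]
      moment_form_lincomb[OF f g h] l[OF p(1)] l[OF p(2)] by (simp add: algebra_simps)
qed

text \<open>Stated for an arbitrary symmetric form \<open>B\<close>, so that the gap matrix and the
  mass matrix are treated alike; linearity in the first argument and symmetry suffice.\<close>

lemma bilinear_expand: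
  assumes B: "\<And>c f g h. f \<in> X_space \<T> \<Longrightarrow> g \<in> X_space \<T> \<Longrightarrow> h \<in> X_space \<T> \<Longrightarrow> B (\<lambda>x. c * f x + g x) h = c * B f h + (B g h :: real)"
    and sym: "\<And>f g. B f g = B g f"
    and \<psi>: "\<And>i. i < N \<Longrightarrow> \<psi> i \<in> X_space \<T>"
  shows "B (\<lambda>x. \<Sum>i<N. c i * \<psi> i x) (\<lambda>x. \<Sum>i<N. c i * \<psi> i x) = bilinear_sum N (\<lambda>i j. B (\<psi> j) (\<psi> i)) c c"
proof -
  let ?g = "\<lambda>x. \<Sum>i<N. c i * \<psi> i x"
  have gX: "?g \<in> X_space \<T>" by (rule lincomb_sum(1)[OF X_zero X_lincomb \<psi>])
  have lin: "B ?g h = (\<Sum>i<N. c i * B (\<psi> i) h)" if h: "h \<in> X_space \<T>" for h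
  proof -
    have "B ?g h = (\<Sum>i<N. c i *\<^sub>R B (\<psi> i) h)"
    proof (rule lincomb_sum(2)[where V="X_space \<T>" and L="\<lambda>u. B u h"])
      fix k u w assume "u \<in> X_space \<T>" "w \<in> X_space \<T>"
      then show "B (\<lambda>x. k * u x + w x) h = k *\<^sub>R B u h + B w h" using B[OF _ _ h] by simp
    qed (rule X_zero X_lincomb \<psi>; assumption)+
    then show ?thesis by simp
  qed
  have "B ?g ?g = (\<Sum>i<N. c i * B ?g (\<psi> i))"
    unfolding lin[OF gX] by (intro sum.cong refl) (simp only: sym[of _ ?g])
  also have "\<dots> = (\<Sum>i<N. c i * (\<Sum>j<N. c j * B (\<psi> j) (\<psi> i)))"
    by (intro sum.cong refl) (simp add: lin \<psi>)
  also have "\<dots> = bilinear_sum N (\<lambda>i j. B (\<psi> j) (\<psi> i)) c c"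
    unfolding bilinear_sum_def sum_distrib_left by (intro sum.cong refl) (simp add: mult.commute mult.left_commute)
  finally show ?thesis .
qed

end

lemma bilinear_sum_cong:
  assumes "\<And>i j. i < N \<Longrightarrow> j < N \<Longrightarrow> A i j = B i j"
  shows "bilinear_sum N A u w = bilinear_sum N B u w"
  unfolding bilinear_sum_def by (intro sum.cong refl) (simp add: assms)

context mesh_bases begin

context
  fixes \<psi> :: "nat \<Rightarrow> 'a \<Rightarrow> real" and N :: nat
  assumes X_basis: "is_basis N \<psi> (X_space \<T>)"
begin

lemma \<psi>_in: "i < N \<Longrightarrow> \<psi> i \<in> X_space \<T>"
  using X_basis by (simp add: is_basis_def)

lemma X_dim_pos: "N > 0"
proof (rule ccontr)
  assume "\<not> N > 0"
  then have "v = (\<lambda>_. 0)" if "v \<in> X_space \<T>" for v using X_basis that unfolding is_basis_def by simp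
  then show False using X_nontrivial by blast
qed

text \<open>The load functional belongs to the row index \<open>i\<close> and the solution to the
  column index \<open>j\<close>, so \<open>gap_form\<close> is applied with the two swapped and
  symmetry restores the order.\<close>

lemma gap_matrix_entry:
  assumes ij: "i < N" "j < N"
  shows "(transpose_mat (Matrix.mat nCR N (\<lambda>(i, j). L2_inner \<Omega> (\<psi> j) (\<phi>CR i))) * the (mat_inverse CR.stiffness)
            * Matrix.mat nCR N (\<lambda>(i, j). L2_inner \<Omega> (\<psi> j) (\<phi>CR i))
          - transpose_mat (Matrix.mat nc N (\<lambda>(i, j). L2_inner \<Omega> (\<psi> j) (\<phi>c i))) * the (mat_inverse Vc.stiffness)
            * Matrix.mat nc N (\<lambda>(i, j). L2_inner \<Omega> (\<psi> j) (\<phi>c i))) $$ (i, j)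
    + moment_form (\<psi> j) (\<psi> i) = L2_inner \<Omega> (marini_gap \<T> \<Omega> (\<psi> j)) (marini_gap \<T> \<Omega> (\<psi> i))"
proof -
  have CR: "(transpose_mat (Matrix.mat nCR N (\<lambda>(i, j). L2_inner \<Omega> (\<psi> j) (\<phi>CR i))) * the (mat_inverse CR.stiffness)
            * Matrix.mat nCR N (\<lambda>(i, j). L2_inner \<Omega> (\<psi> j) (\<phi>CR i))) $$ (i, j) = L2_inner \<Omega> (\<psi> i) (z_CR \<T> \<Omega> (\<psi> j))"
    by (rule CR.load_stiffness_entry[where l="\<lambda>j. L2_inner \<Omega> (\<psi> j)" and z="\<lambda>j. z_CR \<T> \<Omega> (\<psi> j)", OF _ _ refl ij])
       (rule load_linear(1) z_CR_solves; rule \<psi>_in; assumption)+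
  have c: "(transpose_mat (Matrix.mat nc N (\<lambda>(i, j). L2_inner \<Omega> (\<psi> j) (\<phi>c i))) * the (mat_inverse Vc.stiffness)
            * Matrix.mat nc N (\<lambda>(i, j). L2_inner \<Omega> (\<psi> j) (\<phi>c i))) $$ (i, j) = L2_inner \<Omega> (\<psi> i) (z_c \<T> \<Omega> (\<psi> j))"
    by (rule Vc.load_stiffness_entry[where l="\<lambda>j. L2_inner \<Omega> (\<psi> j)" and z="\<lambda>j. z_c \<T> \<Omega> (\<psi> j)", OF _ _ refl ij])
       (rule load_linear(2) z_c_solves; rule \<psi>_in; assumption)+
  have "L2_inner \<Omega> (marini_gap \<T> \<Omega> (\<psi> j)) (marini_gap \<T> \<Omega> (\<psi> i))
      = L2_inner \<Omega> (marini_gap \<T> \<Omega> (\<psi> i)) (marini_gap \<T> \<Omega> (\<psi> j))" by (rule L2_inner_commute)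
  also have "\<dots> = L2_inner \<Omega> (\<psi> i) (z_CR \<T> \<Omega> (\<psi> j)) - L2_inner \<Omega> (\<psi> i) (z_c \<T> \<Omega> (\<psi> j)) + moment_form (\<psi> i) (\<psi> j)"
    by (rule gap_form[OF \<psi>_in[OF ij(1)] \<psi>_in[OF ij(2)]])
  finally show ?thesis
    unfolding CR[symmetric] c[symmetric] moment_form_commute[of "\<psi> i"] using ij by (subst index_minus_mat) simp_all
qed

text \<open>The Rayleigh quotient of a coefficient vector is the squared ratio of norms for the
  function it represents. As the ratios are nonnegative, maximising squares and maximising ratios
  agree, and the supremum in \<open>kappa_M\<close> is attained.\<close>

lemma kappa_max:
  assumes GM: "GM = Matrix.mat N N (\<lambda>(i, j). L2_inner \<Omega> (marini_gap \<T> \<Omega> (\<psi> j)) (marini_gap \<T> \<Omega> (\<psi> i)))"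
    and M0: "M0 = Matrix.mat N N (\<lambda>(i, j). L2_inner \<Omega> (\<psi> j) (\<psi> i))"
  shows "is_maximum (rayleigh_quotient GM M0 ` (carrier_vec N - {0\<^sub>v N})) ((kappa_M \<T> \<Omega>)\<^sup>2) \<and>
         is_maximum {l. gen_eigenvalue GM M0 l} ((kappa_M \<T> \<Omega>)\<^sup>2)"
proof -
  let ?gap = "marini_gap \<T> \<Omega>"
  define comb where "comb = (\<lambda>c x. \<Sum>i<N. c i * \<psi> i x)"
  have carr: "GM \<in> carrier_mat N N" "M0 \<in> carrier_mat N N" by (simp_all add: GM M0)
  have combX: "comb c \<in> X_space \<T>" for c
    unfolding comb_def by (rule lincomb_sum(1)[OF X_zero X_lincomb \<psi>_in])
  have comb_nz: "comb c \<noteq> (\<lambda>_. 0)" if "\<exists>i<N. c i \<noteq> 0" for c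
    using X_basis that unfolding is_basis_def comb_def by blast
  have qG: "bilinear_sum N (\<lambda>i j. GM $$ (i, j)) c c = L2_inner \<Omega> (?gap (comb c)) (?gap (comb c))" for c
  proof -
    have "L2_inner \<Omega> (?gap (comb c)) (?gap (comb c)) = bilinear_sum N (\<lambda>i j. L2_inner \<Omega> (?gap (\<psi> j)) (?gap (\<psi> i))) c c"
      unfolding comb_def
      by (rule bilinear_expand[where B="\<lambda>f g. L2_inner \<Omega> (?gap f) (?gap g)", OF gap_form_lincomb L2_inner_commute \<psi>_in])
    also have "\<dots> = bilinear_sum N (\<lambda>i j. GM $$ (i, j)) c c" by (rule bilinear_sum_cong) (simp add: GM)
    finally show ?thesis by simp
  qed
  have qM: "bilinear_sum N (\<lambda>i j. M0 $$ (i, j)) c c = L2_inner \<Omega> (comb c) (comb c)" for c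
  proof -
    have lin: "L2_inner \<Omega> (\<lambda>x. k * f x + g x) h = k * L2_inner \<Omega> f h + L2_inner \<Omega> g h"
      if "f \<in> X_space \<T>" "g \<in> X_space \<T>" "h \<in> X_space \<T>" for k f g h
      using L2_inner_lincomb[OF X_props(1)[OF that(3)] X_props(1)[OF that(1)] X_props(1)[OF that(2)], of k]
      by (simp only: L2_inner_commute[of h])
    have "L2_inner \<Omega> (comb c) (comb c) = bilinear_sum N (\<lambda>i j. L2_inner \<Omega> (\<psi> j) (\<psi> i)) c c"
      unfolding comb_def by (rule bilinear_expand[where B="L2_inner \<Omega>", OF lin L2_inner_commute \<psi>_in])
    also have "\<dots> = bilinear_sum N (\<lambda>i j. M0 $$ (i, j)) c c" by (rule bilinear_sum_cong) (simp add: M0)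
    finally show ?thesis by simp
  qed
  have pos: "bilinear_sum N (\<lambda>i j. M0 $$ (i, j)) c c > 0" if "\<exists>i<N. c i \<noteq> 0" for c
    unfolding qM by (rule X_L2_inner_pos[OF combX comb_nz[OF that]])
  have sym: "GM $$ (i, j) = GM $$ (j, i)" "M0 $$ (i, j) = M0 $$ (j, i)" if "i < N" "j < N" for i j
    using that by (simp_all add: GM M0 L2_inner_commute)
  obtain l where l: "is_maximum (rayleigh_quotient GM M0 ` (carrier_vec N - {0\<^sub>v N})) l"
    "is_maximum {l. gen_eigenvalue GM M0 l} l"
    using max_rayleigh_eigenvalue[OF X_dim_pos carr sym pos] by blast
  define \<rho> where "\<rho> = (\<lambda>g. L2_norm \<Omega> (?gap g) / L2_norm \<Omega> g)"
  have \<rho>0: "\<rho> g \<ge> 0" for g unfolding \<rho>_def by simp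
  have ray: "rayleigh_quotient GM M0 v = (\<rho> (comb (\<lambda>i. v $ i)))\<^sup>2" if v: "v \<in> carrier_vec N" for v
  proof -
    have sq: "L2_inner \<Omega> h h = (L2_norm \<Omega> h)\<^sup>2" for h :: "'a \<Rightarrow> 'b::euclidean_space"
      unfolding L2_norm_sq by (simp add: L2_inner_def power2_norm_eq_inner)
    show ?thesis
      unfolding rayleigh_quotient_def scalar_prod_bilinear_sum[OF carr(1) v v] scalar_prod_bilinear_sum[OF carr(2) v v]
        qG qM sq \<rho>_def power_divide ..
  qed
  have vec_nz: "\<exists>i<N. v $ i \<noteq> 0" if v: "v \<in> carrier_vec N" "v \<noteq> 0\<^sub>v N" for v :: "real Matrix.vec"
  proof (rule ccontr)
    assume n: "\<not> ?thesis"
    have "v = 0\<^sub>v N" by (rule eq_vecI) (use n v(1) in auto)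
    then show False using v(2) by simp
  qed
  obtain v0 where v0: "v0 \<in> carrier_vec N" "v0 \<noteq> 0\<^sub>v N" "l = rayleigh_quotient GM M0 v0"
    using l(1) unfolding is_maximum_def by blast
  define g0 where "g0 = comb (\<lambda>i. v0 $ i)"
  have lg0: "l = (\<rho> g0)\<^sup>2" unfolding g0_def v0(3) by (rule ray[OF v0(1)])
  have g0: "g0 \<in> X_space \<T> - {\<lambda>_. 0}" unfolding g0_def using combX comb_nz[OF vec_nz[OF v0(1,2)]] by blast
  have max: "\<rho> g \<le> \<rho> g0" if g: "g \<in> X_space \<T> - {\<lambda>_. 0}" for g
  proof -
    obtain c where c: "g = comb c" using g X_basis unfolding is_basis_def comb_def by blast
    define v where "v = Matrix.vec N c"
    have v: "v \<in> carrier_vec N" by (simp add: v_def)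
    have gv: "g = comb (\<lambda>i. v $ i)" unfolding c comb_def v_def by (intro ext sum.cong refl) simp
    have "v \<noteq> 0\<^sub>v N"
    proof
      assume "v = 0\<^sub>v N"
      then have "g = (\<lambda>_. 0)" unfolding gv comb_def by simp
      then show False using g by blast
    qed
    then have "rayleigh_quotient GM M0 v \<le> l" using l(1) v unfolding is_maximum_def by blast
    then have "(\<rho> g)\<^sup>2 \<le> (\<rho> g0)\<^sup>2" unfolding ray[OF v] gv[symmetric] lg0 .
    then show ?thesis by (rule power2_le_imp_le[OF _ \<rho>0])
  qed
  have "kappa_M \<T> \<Omega> = \<rho> g0"
    unfolding kappa_M_def \<rho>_def[symmetric]
    by (rule cSup_eq_maximum) (use g0 max in \<open>auto simp: \<rho>_def\<close>)
  then have "(kappa_M \<T> \<Omega>)\<^sup>2 = l" unfolding lg0 by (simp only:)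
  then show ?thesis using l by (simp only:)
qed

end
end

theorem mainTheorem2:
  fixes \<Omega> :: "(real ^ 'd) set"
    and \<T> :: "(real ^ 'd) set set"
    and \<psi> \<phi>c \<phi>CR :: "nat \<Rightarrow> real ^ 'd \<Rightarrow> real"
    and N nc nCR :: nat
    and M0 Ac Bc ACR BCR Ggap DM GM :: "real Matrix.mat"
  assumes "CARD('d) \<in> {2, 3}"
    and "bounded \<Omega>" and "polyhedral_lipschitz_domain \<Omega>"
    and "conforming_mesh \<T> \<Omega>"
    and "is_basis N \<psi> (X_space \<T>)"
    and "is_basis nc \<phi>c (Vc_space \<T> \<Omega>)"
    and "is_basis nCR \<phi>CR (CR_space \<T> \<Omega>)"
    and "M0 = Matrix.mat N N (\<lambda>(i, j). L2_inner \<Omega> (\<psi> j) (\<psi> i))"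
    and "Ac = Matrix.mat nc nc (\<lambda>(i, k). L2_inner \<Omega> (H10_grad \<Omega> (\<phi>c k)) (H10_grad \<Omega> (\<phi>c i)))"
    and "Bc = Matrix.mat nc N (\<lambda>(i, j). L2_inner \<Omega> (\<psi> j) (\<phi>c i))"
    and "ACR = Matrix.mat nCR nCR
                 (\<lambda>(i, k). L2_inner \<Omega> (broken_grad \<T> (\<phi>CR k)) (broken_grad \<T> (\<phi>CR i)))"
    and "BCR = Matrix.mat nCR N (\<lambda>(i, j). L2_inner \<Omega> (\<psi> j) (\<phi>CR i))"
    and "Ggap = transpose_mat BCR * the (mat_inverse ACR) * BCR
                 - transpose_mat Bc * the (mat_inverse Ac) * Bc"
    and "DM = Matrix.mat N N
                 (\<lambda>(i, j). 1 / (real CARD('d))\<^sup>2 *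
                    (\<Sum>T\<in>\<T>. second_moment T * elem_value (\<psi> j) T * elem_value (\<psi> i) T))"
    and "GM = Matrix.mat N N
                 (\<lambda>(i, j). L2_inner \<Omega> (marini_gap \<T> \<Omega> (\<psi> j)) (marini_gap \<T> \<Omega> (\<psi> i)))"
  shows "GM = Ggap + DM \<and>
         is_maximum (rayleigh_quotient (Ggap + DM) M0 ` (carrier_vec N - {0\<^sub>v N}))
           ((kappa_M \<T> \<Omega>)\<^sup>2) \<and>
         is_maximum {l. gen_eigenvalue (Ggap + DM) M0 l} ((kappa_M \<T> \<Omega>)\<^sup>2)"
proof -
  interpret mesh \<Omega> \<T> by unfold_locales fact+
  interpret mesh_bases \<Omega> \<T> nc nCR \<phi>c \<phi>CR by unfold_locales fact+
  note X_basis = assms(5)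
  have Ac: "Ac = Vc.stiffness"
    unfolding assms(9) Vc.stiffness_def by (rule eq_matI) (simp_all add: H10_grad_energy Vc.\<phi>_in)
  have ACR: "ACR = CR.stiffness"
    unfolding assms(11) CR.stiffness_def by (rule eq_matI) (simp_all add: broken_grad_energy CR_pw_affine CR.\<phi>_in)
  have GM: "GM = Ggap + DM"
  proof (rule eq_matI)
    show "dim_row GM = dim_row (Ggap + DM)" "dim_col GM = dim_col (Ggap + DM)" by (simp_all add: assms)
    fix i j assume "i < dim_row (Ggap + DM)" "j < dim_col (Ggap + DM)"
    then have ij: "i < N" "j < N" by (simp_all add: assms)
    \<comment> \<open>The factor agrees because the dimension of \<open>real ^ 'd\<close> is
      \<open>CARD('d)\<close>.\<close>
    have DM: "DM $$ (i, j) = moment_form (\<psi> j) (\<psi> i)" using ij by (simp add: assms(14) moment_form_def)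
    have "(Ggap + DM) $$ (i, j) = Ggap $$ (i, j) + DM $$ (i, j)" using ij by (intro index_add_mat) (simp_all add: assms)
    also have "\<dots> = L2_inner \<Omega> (marini_gap \<T> \<Omega> (\<psi> j)) (marini_gap \<T> \<Omega> (\<psi> i))"
      unfolding DM assms(13) Ac ACR assms(10) assms(12) by (rule gap_matrix_entry[OF X_basis ij])
    finally show "GM $$ (i, j) = (Ggap + DM) $$ (i, j)" using ij by (simp add: assms(15))
  qed
  then show ?thesis using kappa_max[OF X_basis assms(15) assms(8)] by (simp only: simp_thms)
qed

end
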